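(* Let $m,\beta_0,\beta_\infty>0$ and let $\omega=\mathtt{p}^*\omega_\Sigma+\sqrt{-1}\partial\bar\partial f(s)$ be a Kähler metric with Calabi symmetry on $X\smallsetminus(S_0\cup S_\infty)$, in the Kähler class $2\pi(\mathsf{C}+mS_\infty)$, whose momentum profile $\phi$ is smooth on $[1,m+1]$, positive on $(1,m+1)$, with $\phi(1)=\phi(m+1)=0$, $\phi'(1)=\beta_0$, $\phi'(m+1)=-\beta_\infty$ (so that $\omega$ has conical singularities of cone angles $2\pi\beta_0$, $2\pi\beta_\infty$ along $S_0$, $S_\infty$). For $\epsilon>0$ let $\omega_\epsilon=\mathtt{p}^*\omega_\Sigma+\sqrt{-1}\partial\bar\partial f_\epsilon(s)$, where $f_\epsilon(s)=f\left(\ln(e^s+\epsilon^2)\right)$. Then $\omega_\epsilon$ is a Kähler metric which is smooth on $X\smallsetminus S_\infty$, and as $\epsilon\to0$ $$c_2(\omega_\epsilon)\longrightarrow\frac{\lambda(\omega)}{2(2\pi)^2}\,\omega^2+\frac{\beta_0-1}{\pi}\,\mathtt{p}^*\omega_\Sigma\wedge[S_0],$$ where the convergence is in the $\mathcal{C}^\infty$ sense on $X\smallsetminus(S_0\cup S_\infty)$ and weakly in the sense of currents in a neighbourhood of $S_0$.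
   Context: Surface. $\Sigma$ is a compact Riemann surface of genus $2$ with a Kähler metric $\omega_\Sigma$ with $\mathrm{Ric}(\omega_\Sigma)=-2\omega_\Sigma$ (so $\int_\Sigma\omega_\Sigma=2\pi$); $L\to\Sigma$ is a holomorphic line bundle of degree $-1$ with a Hermitian metric $h$ of curvature form $-\omega_\Sigma$ (so $\sqrt{-1}\partial\bar\partial\ln h=\omega_\Sigma$ locally). $X=\mathbb{P}(L\oplus\mathcal{O})$ with projection $\mathtt{p}:X\to\Sigma$, $\mathsf{C}$ is a fibre, $S_0=\mathbb{P}(\{0\}\oplus\mathcal{O})$ is the zero divisor, $S_\infty=\mathbb{P}(L\oplus\{0\})$ the infinity divisor. On $X\smallsetminus(S_0\cup S_\infty)$ (= $L$ minus its zero section), $s=\ln|w|^2+\ln h(z)$ is the logarithm of the fibrewise squared norm, $z$ a local coordinate on $\Sigma$, $w$ a fibre coordinate. Calabi symmetry. $\omega=\mathtt{p}^*\omega_\Sigma+\sqrt{-1}\partial\bar\partial f(s)$ with $f:\mathbb{R}\to\mathbb{R}$ smooth, strictly convex, $\lim_{s\to-\infty}f'(s)=0$, $\lim_{s\to\infty}f'(s)=m$ (this is the condition for the class $2\pi(\mathsf{C}+mS_\infty)$). The momentum variable is $\gamma=1+f'(s)$ and the momentum profile is $\phi(\gamma)=f''(s)$. For a Kähler metric $\omega$ on a complex surface with Hermitian matrix $H$ in local coordinates, $\Theta(\omega)=\bar\partial(H^{-1}\partial H)$, $c_2(\omega)=\det\left(\frac{\sqrt{-1}}{2\pi}\Theta(\omega)\right)$,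 and the higher scalar curvature $\lambda(\omega)$ is defined by $c_2(\omega)=\frac{\lambda(\omega)}{2(2\pi)^2}\omega^2$ (for the conical $\omega$ this is on $X\smallsetminus(S_0\cup S_\infty)$; $\lambda(\omega)\omega^2$ is locally integrable and is viewed as a current). $[S_0]$ is the current of integration along $S_0$, so $\left(\mathtt{p}^*\omega_\Sigma\wedge[S_0]\right)(\varphi)=\int_{S_0}\varphi\,\mathtt{p}^*\omega_\Sigma$. Weak convergence near $S_0$ means convergence when tested against smooth functions compactly supported in a tubular neighbourhood of $S_0$ in $X\smallsetminus S_\infty$. *)

theory Defs
  imports "HOL-Analysis.Analysis" "HOL-Homology.Homology"
begin

section \<open>Smooth functions and convergence with all derivatives\<close>

fun iter_deriv ::
    "'v::real_normed_vector list \<Rightarrow> ('v \<Rightarrow> 'w::real_normed_vector) \<Rightarrow> 'v \<Rightarrow> 'w" where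
  "iter_deriv [] F = F"
| "iter_deriv (v # vs) F = (\<lambda>x. frechet_derivative (iter_deriv vs F) (at x) v)"

text \<open>The next two notions are meant for open \<open>S\<close>.\<close>

definition smooth_on :: "'v::real_normed_vector set \<Rightarrow> ('v \<Rightarrow> 'w::real_normed_vector) \<Rightarrow> bool" where
  "smooth_on S F \<longleftrightarrow> (\<forall>vs. \<forall>x\<in>S. iter_deriv vs F differentiable (at x))"

definition smooth_convergence ::
    "'v::real_normed_vector set \<Rightarrow> ('i \<Rightarrow> 'v \<Rightarrow> 'w::real_normed_vector) \<Rightarrow> ('v \<Rightarrow> 'w) \<Rightarrow> 'i filter \<Rightarrow> bool"
  where
  "smooth_convergence S F F0 net \<longleftrightarrow>
     smooth_on S F0 \<and> eventually (\<lambda>i. smooth_on S (F i)) net \<and>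
     (\<forall>vs K. compact K \<and> K \<subseteq> S \<longrightarrow>
        uniform_limit K (\<lambda>i. iter_deriv vs (F i)) (iter_deriv vs F0) net)"

text \<open>Smoothness on a closed interval, with one-sided derivatives at the end points.\<close>

definition smooth_on_interval :: "real \<Rightarrow> real \<Rightarrow> (real \<Rightarrow> real) \<Rightarrow> bool" where
  "smooth_on_interval a b g \<longleftrightarrow>
     (\<exists>d. d 0 = g \<and>
        (\<forall>n::nat. \<forall>x\<in>{a..b}. (d n has_real_derivative d (Suc n) x) (at x within {a..b})))"

definition strictly_convex :: "(real \<Rightarrow> real) \<Rightarrow> bool" where
  "strictly_convex f \<longleftrightarrow>
     (\<forall>x y t. x \<noteq> y \<and> 0 < t \<and> t < 1 \<longrightarrow>
        f ((1 - t) * x + t * y) < (1 - t) * f x + t * f y)"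


section \<open>Wirtinger derivatives\<close>

definition d_z :: "(complex \<Rightarrow> complex) \<Rightarrow> complex \<Rightarrow> complex" where
  "d_z F x = (frechet_derivative F (at x) 1 - \<i> * frechet_derivative F (at x) \<i>) / 2"

definition d_zbar :: "(complex \<Rightarrow> complex) \<Rightarrow> complex \<Rightarrow> complex" where
  "d_zbar F x = (frechet_derivative F (at x) 1 + \<i> * frechet_derivative F (at x) \<i>) / 2"

type_synonym c2 = "complex \<times> complex"

definition coord :: "2 \<Rightarrow> c2 \<Rightarrow> complex" where
  "coord k q = (if k = 1 then fst q else snd q)"

definition dir :: "2 \<Rightarrow> complex \<Rightarrow> c2" where
  "dir k c = (if k = 1 then (c, 0) else (0, c))"

definition del :: "2 \<Rightarrow> (c2 \<Rightarrow> complex) \<Rightarrow> c2 \<Rightarrow> complex" where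
  "del k F q = (frechet_derivative F (at q) (dir k 1)
                 - \<i> * frechet_derivative F (at q) (dir k \<i>)) / 2"

definition delbar :: "2 \<Rightarrow> (c2 \<Rightarrow> complex) \<Rightarrow> c2 \<Rightarrow> complex" where
  "delbar k F q = (frechet_derivative F (at q) (dir k 1)
                    + \<i> * frechet_derivative F (at q) (dir k \<i>)) / 2"


section \<open>Riemann surfaces\<close>

text \<open>The points of the surface form the whole type \<open>'a\<close>.\<close>

type_synonym 'a chart = "'a set \<times> ('a \<Rightarrow> complex)"

definition chart_inv :: "'a chart \<Rightarrow> complex \<Rightarrow> 'a" where
  "chart_inv \<kappa> = inv_into (fst \<kappa>) (snd \<kappa>)"

definition riemann_surface :: "'a::t2_space chart set \<Rightarrow> bool" where
  "riemann_surface A \<longleftrightarrow>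
     connected (UNIV :: 'a set) \<and>
     (\<Union>\<kappa>\<in>A. fst \<kappa>) = UNIV \<and>
     (\<forall>\<kappa>\<in>A. open (fst \<kappa>) \<and> open (snd \<kappa> ` fst \<kappa>) \<and>
        homeomorphism (fst \<kappa>) (snd \<kappa> ` fst \<kappa>) (snd \<kappa>) (chart_inv \<kappa>)) \<and>
     (\<forall>\<kappa>\<in>A. \<forall>\<kappa>'\<in>A.
        (snd \<kappa>' \<circ> chart_inv \<kappa>) holomorphic_on (snd \<kappa> ` (fst \<kappa> \<inter> fst \<kappa>')))"

definition has_genus :: "'a::t2_space itself \<Rightarrow> nat \<Rightarrow> bool" where
  "has_genus _ g \<longleftrightarrow>
     homology_group 1 (euclidean :: 'a topology) \<cong> free_Abelian_group {..<2 * g}"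

text \<open>A real (1,1)-form on the surface is given by functions \<open>g\<^sub>\<kappa>\<close> on the images of the charts:
  it is \<open>\<i> g\<^sub>\<kappa> dz \<and> dz-bar\<close> in the chart \<open>\<kappa>\<close> with coordinate \<open>z\<close>.\<close>

type_synonym 'a base_form = "'a chart \<Rightarrow> complex \<Rightarrow> real"

definition base_kahler :: "'a chart set \<Rightarrow> 'a base_form \<Rightarrow> bool" where
  "base_kahler A om \<longleftrightarrow>
     (\<forall>\<kappa>\<in>A. smooth_on (snd \<kappa> ` fst \<kappa>) (om \<kappa>) \<and> (\<forall>\<zeta>\<in>snd \<kappa> ` fst \<kappa>. 0 < om \<kappa> \<zeta>)) \<and>
     (\<forall>\<kappa>\<in>A. \<forall>\<kappa>'\<in>A. \<forall>\<zeta>\<in>snd \<kappa> ` (fst \<kappa> \<inter> fst \<kappa>').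
        om \<kappa> \<zeta> = (cmod (deriv (snd \<kappa>' \<circ> chart_inv \<kappa>) \<zeta>))\<^sup>2
                   * om \<kappa>' (snd \<kappa>' (chart_inv \<kappa> \<zeta>)))"

text \<open>The coefficient of the Ricci form \<open>- \<i> \<partial> \<partial>-bar ln g\<^sub>\<kappa>\<close>.\<close>

definition ricci :: "'a base_form \<Rightarrow> 'a chart \<Rightarrow> complex \<Rightarrow> complex" where
  "ricci om \<kappa> = (\<lambda>\<zeta>. - d_z (d_zbar (\<lambda>\<xi>. complex_of_real (ln (om \<kappa> \<xi>)))) \<zeta>)"


section \<open>Holomorphic line bundles\<close>

text \<open>A line bundle is given by its total space (the whole type \<open>'l\<close>) with its projection, the
  scalar multiplication in the fibres, and a family of local holomorphic frames \<open>(U, e)\<close>.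
  In a fibre, each vector is a unique multiple of \<open>e x\<close>; this determines the addition,
  independently of the frame.  The zero vector of the fibre of \<open>l\<close> is \<open>scale L 0 l\<close>.\<close>

record ('a, 'l) line_bundle =
  base_point :: "'l \<Rightarrow> 'a"
  scale :: "complex \<Rightarrow> 'l \<Rightarrow> 'l"
  frames :: "('a set \<times> ('a \<Rightarrow> 'l)) set"

definition frame_coeff :: "('a, 'l) line_bundle \<Rightarrow> ('a \<Rightarrow> 'l) \<Rightarrow> 'l \<Rightarrow> complex" where
  "frame_coeff L e l = (THE c. l = scale L c (e (base_point L l)))"

definition holomorphic_line_bundle ::
    "'a::t2_space chart set \<Rightarrow> ('a, 'l) line_bundle \<Rightarrow> bool" where
  "holomorphic_line_bundle A L \<longleftrightarrow>
     (\<forall>c l. base_point L (scale L c l) = base_point L l) \<and>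
     (\<forall>l. scale L 1 l = l) \<and>
     (\<forall>c d l. scale L c (scale L d l) = scale L (c * d) l) \<and>
     (\<Union>(U, e)\<in>frames L. U) = UNIV \<and>
     (\<forall>(U, e)\<in>frames L. open U \<and>
        (\<forall>x\<in>U. bij_betw (\<lambda>c. scale L c (e x)) UNIV {l. base_point L l = x})) \<and>
     (\<forall>(U, e)\<in>frames L. \<forall>(V, e')\<in>frames L. \<forall>\<kappa>\<in>A.
        (\<lambda>\<zeta>. frame_coeff L e (e' (chart_inv \<kappa> \<zeta>))) holomorphic_on (snd \<kappa> ` (fst \<kappa> \<inter> U \<inter> V)))"

text \<open>A chart of the base together with a local frame.\<close>

type_synonym ('a, 'l) bchart = "'a chart \<times> 'a set \<times> ('a \<Rightarrow> 'l)"

definition bcharts :: "'a chart set \<Rightarrow> ('a, 'l) line_bundle \<Rightarrow> ('a, 'l) bchart set" where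
  "bcharts A L = A \<times> frames L"

definition bdom :: "('a, 'l) bchart \<Rightarrow> 'a set" where
  "bdom b = fst (fst b) \<inter> fst (snd b)"

definition bcoord :: "('a, 'l) bchart \<Rightarrow> 'a \<Rightarrow> complex" where
  "bcoord b = snd (fst b)"

definition bframe :: "('a, 'l) bchart \<Rightarrow> complex \<Rightarrow> 'l" where
  "bframe b \<zeta> = snd (snd b) (chart_inv (fst b) \<zeta>)"

text \<open>A Hermitian metric, given by the squared norm \<open>h\<close> on the total space.\<close>

definition hermitian_metric ::
    "'a chart set \<Rightarrow> ('a, 'l) line_bundle \<Rightarrow> ('l \<Rightarrow> real) \<Rightarrow> bool" where
  "hermitian_metric A L h \<longleftrightarrow>
     (\<forall>l. l \<noteq> scale L 0 l \<longrightarrow> 0 < h l) \<and>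
     (\<forall>c l. h (scale L c l) = (cmod c)\<^sup>2 * h l) \<and>
     (\<forall>b\<in>bcharts A L. smooth_on (bcoord b ` bdom b) (\<lambda>\<zeta>. h (bframe b \<zeta>)))"

text \<open>The coefficient of the curvature form \<open>- \<i> \<partial> \<partial>-bar ln h\<close>.\<close>

definition curvature ::
    "('l \<Rightarrow> real) \<Rightarrow> ('a, 'l) bchart \<Rightarrow> complex \<Rightarrow> complex" where
  "curvature h b = (\<lambda>\<zeta>. - d_z (d_zbar (\<lambda>\<xi>. complex_of_real (ln (h (bframe b \<xi>))))) \<zeta>)"

text \<open>To integrate over the surface (and over the total space of \<open>L\<close>) the surface is cut into
  finitely many disjoint Borel pieces, each relatively compact in the domain of a chart: the
  \<open>j\<close>-th piece is \<open>K\<^sub>j\<close> minus the earlier ones.  By the change of variables formula, the integral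
  of a form does not depend on the decomposition.\<close>

type_synonym ('a, 'l) decomp = "(('a, 'l) bchart \<times> 'a set) list"

definition decomposition ::
    "'a::t2_space chart set \<Rightarrow> ('a, 'l) line_bundle \<Rightarrow> ('a, 'l) decomp \<Rightarrow> bool" where
  "decomposition A L D \<longleftrightarrow>
     (\<forall>(b, K)\<in>set D. b \<in> bcharts A L \<and> compact K \<and> K \<subseteq> bdom b) \<and>
     (\<Union>(b, K)\<in>set D. K) = UNIV"

definition piece :: "('a, 'l) decomp \<Rightarrow> nat \<Rightarrow> complex set" where
  "piece D j = bcoord (fst (D ! j)) ` (snd (D ! j) - (\<Union>i<j. snd (D ! i)))"

text \<open>The integral of \<open>\<i> \<eta>\<^sub>b dz \<and> dz-bar = 2 \<eta>\<^sub>b dx dy\<close>.\<close>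

definition base_integral ::
    "('a, 'l) decomp \<Rightarrow> (('a, 'l) bchart \<Rightarrow> complex \<Rightarrow> complex) \<Rightarrow> complex" where
  "base_integral D \<eta> =
     (\<Sum>j<length D. set_lebesgue_integral lborel (piece D j) (\<lambda>\<zeta>. 2 * \<eta> (fst (D ! j)) \<zeta>))"

definition has_degree :: "'a::t2_space chart set \<Rightarrow> ('a, 'l) line_bundle \<Rightarrow> int \<Rightarrow> bool" where
  "has_degree A L d \<longleftrightarrow>
     (\<exists>h D. hermitian_metric A L h \<and> decomposition A L D \<and>
        base_integral D (curvature h) / (2 * pi) = of_int d)"


section \<open>The ruled surface\<close>

text \<open>A point of \<open>\<bbbP>(L \<oplus> \<O>)\<close> is a line, represented by the set of its nonzero vectors
  \<open>(l, t)\<close>, with \<open>l\<close> in a fibre of \<open>L\<close> and \<open>t\<close> a number.\<close>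

type_synonym 'l line = "('l \<times> complex) set"

definition line_of :: "('a, 'l) line_bundle \<Rightarrow> 'l \<Rightarrow> complex \<Rightarrow> 'l line" where
  "line_of L l t = {(scale L c l, c * t) | c. c \<noteq> 0}"

definition ruled_surface :: "('a, 'l) line_bundle \<Rightarrow> 'l line set" where
  "ruled_surface L = {line_of L l t | l t. \<not> (l = scale L 0 l \<and> t = 0)}"

definition zero_divisor :: "('a, 'l) line_bundle \<Rightarrow> 'l line set" where
  "zero_divisor L = {line_of L (scale L 0 l) 1 | l. True}"

definition infinity_divisor :: "('a, 'l) line_bundle \<Rightarrow> 'l line set" where
  "infinity_divisor L = {line_of L l 0 | l. l \<noteq> scale L 0 l}"

text \<open>The parametrizations \<open>(z, w) \<mapsto> [w e(z) : 1]\<close> of the complement of the infinity divisor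
  and \<open>(z, v) \<mapsto> [e(z) : v]\<close> of the complement of the zero divisor.\<close>

definition pt :: "('a, 'l) line_bundle \<Rightarrow> ('a, 'l) bchart \<Rightarrow> c2 \<Rightarrow> 'l line" where
  "pt L b q = line_of L (scale L (snd q) (bframe b (fst q))) 1"

definition pt_inf :: "('a, 'l) line_bundle \<Rightarrow> ('a, 'l) bchart \<Rightarrow> c2 \<Rightarrow> 'l line" where
  "pt_inf L b q = line_of L (bframe b (fst q)) (snd q)"

definition cdom :: "('a, 'l) bchart \<Rightarrow> c2 set" where
  "cdom b = (bcoord b ` bdom b) \<times> UNIV"

definition ruled_topology ::
    "'a chart set \<Rightarrow> ('a, 'l) line_bundle \<Rightarrow> 'l line topology" where
  "ruled_topology A L = topology (\<lambda>V. V \<subseteq> ruled_surface L \<and>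
     (\<forall>b\<in>bcharts A L. open {q \<in> cdom b. pt L b q \<in> V} \<and> open {q \<in> cdom b. pt_inf L b q \<in> V}))"

text \<open>The part of the \<open>(z, w)\<close> coordinate domain of \<open>b\<close> lying over \<open>Y\<close>.\<close>

definition coord_part :: "('a, 'l) line_bundle \<Rightarrow> 'l line set \<Rightarrow> ('a, 'l) bchart \<Rightarrow> c2 set" where
  "coord_part L Y b = {q \<in> cdom b. pt L b q \<in> Y}"

definition transition ::
    "('a, 'l) line_bundle \<Rightarrow> ('a, 'l) bchart \<Rightarrow> ('a, 'l) bchart \<Rightarrow> c2 \<Rightarrow> c2" where
  "transition L b b' q = inv_into (cdom b') (pt L b') (pt L b q)"


section \<open>Forms on the complement of the infinity divisor\<close>

text \<open>A (1,1)-form is given in the coordinates \<open>(z\<^sub>1, z\<^sub>2) = (z, w)\<close> of each \<open>b\<close> by the matrix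
  \<open>a\<close> for which it is \<open>\<i> \<Sum> a\<^sub>k\<^sub>l dz\<^sub>k \<and> dz\<^sub>l-bar\<close>.\<close>

type_synonym ('a, 'l) form11 = "('a, 'l) bchart \<Rightarrow> c2 \<Rightarrow> complex^2^2"

definition pullback_form :: "'a base_form \<Rightarrow> ('a, 'l) form11" where
  "pullback_form om b q =
     (\<chi> k l. if k = 1 \<and> l = 1 then complex_of_real (om (fst b) (fst q)) else 0)"

text \<open>The form \<open>\<i> \<partial> \<partial>-bar u\<close> of a function \<open>u\<close> on the surface.\<close>

definition ddbar_form ::
    "('a, 'l) line_bundle \<Rightarrow> ('l line \<Rightarrow> real) \<Rightarrow> ('a, 'l) form11" where
  "ddbar_form L u b q =
     (\<chi> k l. del k (delbar l (\<lambda>q'. complex_of_real (u (pt L b q')))) q)"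

text \<open>A Kaehler metric on the open subset \<open>Y\<close> of the complement of the infinity divisor: a smooth
  positive closed (1,1)-form.\<close>

definition kahler_metric ::
    "'a chart set \<Rightarrow> ('a, 'l) line_bundle \<Rightarrow> 'l line set \<Rightarrow> ('a, 'l) form11 \<Rightarrow> bool" where
  "kahler_metric A L Y G \<longleftrightarrow>
     (\<forall>b\<in>bcharts A L.
        smooth_on (coord_part L Y b) (G b) \<and>
        (\<forall>q\<in>coord_part L Y b.
           (\<forall>k l. G b q $ l $ k = cnj (G b q $ k $ l)) \<and>
           (\<forall>v. v \<noteq> 0 \<longrightarrow> 0 < Re (\<Sum>k\<in>UNIV. \<Sum>l\<in>UNIV. G b q $ k $ l * v $ k * cnj (v $ l))) \<and>
           (\<forall>j k l. del j (\<lambda>q'. G b q' $ k $ l) q = del k (\<lambda>q'. G b q' $ j $ l) q))) \<and>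
     (\<forall>b\<in>bcharts A L. \<forall>b'\<in>bcharts A L. \<forall>q\<in>coord_part L Y b. pt L b q \<in> pt L b' ` cdom b' \<longrightarrow>
        (\<forall>k l. G b q $ k $ l =
           (\<Sum>i\<in>UNIV. \<Sum>j\<in>UNIV. del k (\<lambda>q'. coord i (transition L b b' q')) q
              * G b' (transition L b b' q) $ i $ j
              * cnj (del l (\<lambda>q'. coord j (transition L b b' q')) q))))"

text \<open>All (2,2)-forms are written as multiples of
  \<open>\<i> dz\<^sub>1 \<and> dz\<^sub>1-bar \<and> \<i> dz\<^sub>2 \<and> dz\<^sub>2-bar\<close>, which is 4 times Lebesgue measure.\<close>

type_synonym ('a, 'l) form22 = "('a, 'l) bchart \<Rightarrow> c2 \<Rightarrow> complex"

definition wedge :: "complex^2^2 \<Rightarrow> complex^2^2 \<Rightarrow> complex" where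
  "wedge a b = a$1$1 * b$2$2 + a$2$2 * b$1$1 - a$1$2 * b$2$1 - a$2$1 * b$1$2"

text \<open>For \<open>H\<^sup>-\<^sup>1 \<partial>H\<close> to be the Chern connection of the tangent bundle, the Hermitian matrix is
  \<open>H\<^sub>i\<^sub>j = G\<^sub>j\<^sub>i\<close>, the inner product of the \<open>j\<close>-th with the \<open>i\<close>-th coordinate vector field;
  the formula with \<open>G\<close> itself is not invariant under changes of coordinates.
  The factor \<open>connection G k q\<close> is the coefficient of \<open>dz\<^sub>k\<close>.\<close>

definition connection :: "(c2 \<Rightarrow> complex^2^2) \<Rightarrow> 2 \<Rightarrow> c2 \<Rightarrow> complex^2^2" where
  "connection G k q =
     matrix_inv (transpose (G q)) ** (\<chi> i j. del k (\<lambda>q'. transpose (G q') $ i $ j) q)"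

text \<open>The \<open>(i, j)\<close> entry of \<open>\<Theta>\<close>, as the matrix of coefficients of \<open>dz\<^sub>k \<and> dz\<^sub>l-bar\<close>; the sign
  is that of \<open>dz\<^sub>l-bar \<and> dz\<^sub>k\<close>.\<close>

definition Theta :: "(c2 \<Rightarrow> complex^2^2) \<Rightarrow> c2 \<Rightarrow> 2 \<Rightarrow> 2 \<Rightarrow> complex^2^2" where
  "Theta G q i j = (\<chi> k l. - delbar l (\<lambda>q'. connection G k q' $ i $ j) q)"

definition chern2 :: "('a, 'l) form11 \<Rightarrow> ('a, 'l) form22" where
  "chern2 G b q =
     (wedge (Theta (G b) q 1 1) (Theta (G b) q 2 2) - wedge (Theta (G b) q 1 2) (Theta (G b) q 2 1))
       / (2 * pi)\<^sup>2"

definition higher_scalar_curvature :: "('a, 'l) form11 \<Rightarrow> ('a, 'l) bchart \<Rightarrow> c2 \<Rightarrow> real" where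
  "higher_scalar_curvature G b q =
     (THE r. chern2 G b q = complex_of_real (r / (2 * (2 * pi)\<^sup>2)) * wedge (G b q) (G b q))"

definition hsc_form :: "('a, 'l) form11 \<Rightarrow> ('a, 'l) form22" where
  "hsc_form G b q =
     complex_of_real (higher_scalar_curvature G b q / (2 * (2 * pi)\<^sup>2)) * wedge (G b q) (G b q)"


section \<open>Currents\<close>

definition test_function ::
    "'a chart set \<Rightarrow> ('a, 'l) line_bundle \<Rightarrow> ('l line \<Rightarrow> complex) \<Rightarrow> bool" where
  "test_function A L \<phi> \<longleftrightarrow>
     (\<forall>b\<in>bcharts A L. smooth_on (cdom b) (\<lambda>q. \<phi> (pt L b q))) \<and>
     (\<exists>K. compactin (ruled_topology A L) K \<and> K \<subseteq> ruled_surface L - infinity_divisor L \<and>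
        (\<forall>P\<in>ruled_surface L - infinity_divisor L - K. \<phi> P = 0))"

text \<open>The integral of \<open>\<phi> \<eta>\<close> over \<open>Y\<close>.\<close>

definition form_current ::
    "('a, 'l) line_bundle \<Rightarrow> ('a, 'l) decomp \<Rightarrow> 'l line set \<Rightarrow> ('a, 'l) form22
       \<Rightarrow> ('l line \<Rightarrow> complex) \<Rightarrow> complex" where
  "form_current L D Y \<eta> \<phi> =
     (\<Sum>j<length D. set_lebesgue_integral lborel
        {q \<in> piece D j \<times> UNIV. pt L (fst (D ! j)) q \<in> Y}
        (\<lambda>q. 4 * (\<phi> (pt L (fst (D ! j)) q) * \<eta> (fst (D ! j)) q)))"

text \<open>The current \<open>p\<^sup>* \<omega>\<^sub>\<Sigma> \<and> [S\<^sub>0]\<close>: integration of \<open>\<phi> p\<^sup>* \<omega>\<^sub>\<Sigma>\<close> over the zero divisor,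
  on which \<open>z\<close> is a local coordinate.\<close>

definition zero_divisor_current ::
    "('a, 'l) line_bundle \<Rightarrow> ('a, 'l) decomp \<Rightarrow> 'a base_form \<Rightarrow> ('l line \<Rightarrow> complex) \<Rightarrow> complex"
  where
  "zero_divisor_current L D om \<phi> =
     base_integral D (\<lambda>b \<zeta>. \<phi> (pt L b (\<zeta>, 0)) * complex_of_real (om (fst b) \<zeta>))"

definition locally_integrable ::
    "'a chart set \<Rightarrow> ('a, 'l) line_bundle \<Rightarrow> 'l line set \<Rightarrow> ('a, 'l) form22 \<Rightarrow> bool" where
  "locally_integrable A L Y \<eta> \<longleftrightarrow>
     (\<forall>b\<in>bcharts A L. \<forall>K. compact K \<and> K \<subseteq> cdom b \<longrightarrow>
        set_integrable lborel (K \<inter> coord_part L Y b) (\<eta> b))"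


section \<open>Calabi symmetry\<close>

text \<open>The function \<open>s\<close>; it is only meant off the two divisors.\<close>

definition log_norm :: "('a, 'l) line_bundle \<Rightarrow> ('l \<Rightarrow> real) \<Rightarrow> 'l line \<Rightarrow> real" where
  "log_norm L h P = (THE r. \<exists>l. P = line_of L l 1 \<and> r = ln (h l))"

definition calabi_form ::
    "('a, 'l) line_bundle \<Rightarrow> ('l \<Rightarrow> real) \<Rightarrow> 'a base_form \<Rightarrow> (real \<Rightarrow> real) \<Rightarrow> ('a, 'l) form11"
  where
  "calabi_form L h om f b q =
     pullback_form om b q + ddbar_form L (\<lambda>P. f (log_norm L h P)) b q"

text \<open>The potential \<open>f\<^sub>\<epsilon>(s) = f(ln(e\<^sup>s + \<epsilon>\<^sup>2))\<close>, extended to the zero divisor, where \<open>e\<^sup>s\<close> extends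
  by 0.\<close>

definition eps_potential ::
    "('a, 'l) line_bundle \<Rightarrow> ('l \<Rightarrow> real) \<Rightarrow> (real \<Rightarrow> real) \<Rightarrow> real \<Rightarrow> 'l line \<Rightarrow> real" where
  "eps_potential L h f \<epsilon> P =
     (if P \<in> zero_divisor L then f (ln (\<epsilon>\<^sup>2)) else f (ln (exp (log_norm L h P) + \<epsilon>\<^sup>2)))"

definition eps_form ::
    "('a, 'l) line_bundle \<Rightarrow> ('l \<Rightarrow> real) \<Rightarrow> 'a base_form \<Rightarrow> (real \<Rightarrow> real) \<Rightarrow> real
       \<Rightarrow> ('a, 'l) form11" where
  "eps_form L h om f \<epsilon> b q =
     pullback_form om b q + ddbar_form L (eps_potential L h f \<epsilon>) b q"

end

(*
  Locally omega_eps is the Calabi metric with potential F(r + eps^2), where r = e^s = |w|^2 h and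
  F(r) = f(ln r); it is smooth across w = 0. Let P = 1 + r F' be the momentum, Q = P', and let R, V be
  the derivatives of ln P, ln Q with respect to ln r. A direct computation of the Chern connection gives

    c_2 = 2 g h W'(r) / (2 pi)^2,   W = (1 + R)(1 + V) - R^2 / 2,

  where g is the coefficient of the metric on the base. The right-hand side is smooth in (z, w, eps^2)
  up to eps = 0 off the zero divisor, whence the smooth convergence. On a fibre, c_2 integrates to a
  difference of values of W. For eps > 0 we have W = 1 at r = 0, whereas for eps = 0 we have
  W -> phi'(1) = beta_0: the difference beta_0 - 1 is the mass that concentrates on the zero divisor.
  Subtracting from a test function its value at w = 0 leaves a term controlled by dominated convergence,
  thanks to the bound |r W'(r)| <= C, uniform in eps.
*)
theory Submission
  imports Defs
begin

section \<open>Calculus of smooth functions\<close>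

text \<open>The constant (beta_0 - 1) / pi: the volume form contributes 4, the formula for c_2
  contributes 2 / (2 pi)^2 and the push-forward of area on a fibre contributes pi, so a unit jump of
  W leaves 2 g / pi on the base, where integration of a form already carries the factor 2. The
  obstacle is control at the zero divisor, uniformly in eps. F(r) = f(ln r) need not be smooth at r
  = 0; only the momentum profile is regular there. The derivatives of f are therefore rewritten as
  functions of gamma = 1 + f' on the closed interval. Since phi has a simple zero at gamma = 1, f''
  is comparable with f', which bounds R, V and their derivatives in ln r. For the integral of W'
  over a fibre at eps = 0 a bound C / r is too weak; there W' is compared with d gamma / dr, the
  derivative of a bounded monotone function. All of this is local, for one chart and one frame. The
  global part adds the invariance under transition maps and, by compactness, a tube r < r0
  containing the support of the test function.\<close>

lemma iter_deriv_append:
  "iter_deriv (vs @ [v]) F = iter_deriv vs (\<lambda>x. frechet_derivative F (at x) v)"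
  by (induction vs) auto

text \<open>\<open>frechet_derivative\<close> is a choice operator. Comparing all candidate
  derivatives \<open>D\<close> of the two functions settles the equality also at points where no
  derivative exists.\<close>

lemma iter_deriv_cong:
  assumes "open S" "\<And>x. x \<in> S \<Longrightarrow> F x = G x" "x \<in> S"
  shows "iter_deriv vs F x = iter_deriv vs G x" using assms(3)
proof (induction vs arbitrary: x)
  case Nil
  then show ?case using assms(2) by simp
next
  case (Cons v vs)
  have "(iter_deriv vs F has_derivative D) (at x) \<longleftrightarrow> (iter_deriv vs G has_derivative D) (at x)" for D
    using Cons assms(1) has_derivative_transform_within_open[of _ _ x UNIV S]
    by (metis (no_types, lifting))
  then show ?case by (simp add: frechet_derivative_def)
qed

lemma differentiable_cong_open:
  assumes "open S" "\<And>x. x \<in> S \<Longrightarrow> F x = G x" "x \<in> S" "F differentiable (at x)"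
  shows "G differentiable (at x)" using assms has_derivative_transform_within_open[of _ _ x UNIV S]
  unfolding differentiable_def by (metis (no_types, lifting))

lemma frechet_derivative_cong_open:
  assumes "open S" "\<And>x. x \<in> S \<Longrightarrow> F x = G x" "x \<in> S"
  shows "frechet_derivative F (at x) v = frechet_derivative G (at x) v"
  using iter_deriv_cong[OF assms, where vs = "[v]"] by simp

text \<open>\<open>iter_deriv\<close> adds derivatives on the outside, while product and chain rules
  speak about the first derivative of the function itself. This recursion peels derivatives off on
  the inside, and counting the order makes induction possible.\<close>

fun smooth_upto ::
    "nat \<Rightarrow> 'v::real_normed_vector set \<Rightarrow> ('v \<Rightarrow> 'w::real_normed_vector) \<Rightarrow> bool" where
  "smooth_upto 0 S F = (\<forall>x\<in>S. F differentiable (at x))"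
| "smooth_upto (Suc n) S F = ((\<forall>x\<in>S. F differentiable (at x)) \<and>
     (\<forall>v. smooth_upto n S (\<lambda>x. frechet_derivative F (at x) v)))"

lemma smooth_upto_imp_differentiable: "smooth_upto n S F \<Longrightarrow> x \<in> S \<Longrightarrow> F differentiable (at x)"
  by (cases n) auto

lemma smooth_upto_frechet:
  "smooth_upto (Suc n) S F \<Longrightarrow> smooth_upto n S (\<lambda>x. frechet_derivative F (at x) v)"
  by simp

lemma smooth_upto_Suc_imp: "smooth_upto (Suc n) S F \<Longrightarrow> smooth_upto n S F"
proof (induction n arbitrary: F)
  case (Suc n)
  have "smooth_upto n S (\<lambda>x. frechet_derivative F (at x) v)" for v
    by (rule Suc.IH) (use Suc.prems in \<open>simp only: smooth_upto.simps(2)[of "Suc n"]\<close>)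
  then show ?case using Suc.prems by (simp only: smooth_upto.simps(2)) blast
qed simp

lemma smooth_upto_iff:
  "smooth_upto n S F \<longleftrightarrow>
     (\<forall>vs. length vs \<le> n \<longrightarrow> (\<forall>x\<in>S. iter_deriv vs F differentiable (at x)))"
proof (induction n arbitrary: F)
  case 0
  then show ?case by auto
next
  case (Suc n)
  show ?case
  proof
    assume *: "smooth_upto (Suc n) S F"
    show "\<forall>vs. length vs \<le> Suc n \<longrightarrow> (\<forall>x\<in>S. iter_deriv vs F differentiable (at x))"
    proof (intro allI impI ballI)
      fix vs :: "'a list" and x assume "length vs \<le> Suc n" "x \<in> S"
      then show "iter_deriv vs F differentiable (at x)"
        using * by (cases vs rule: rev_cases) (auto simp: iter_deriv_append Suc.IH)
    qed
  next
    assume *: "\<forall>vs. length vs \<le> Suc n \<longrightarrow> (\<forall>x\<in>S. iter_deriv vs F differentiable (at x))"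
    then have "smooth_upto n S (\<lambda>x. frechet_derivative F (at x) v)" for v
      unfolding Suc.IH iter_deriv_append[symmetric] by simp
    moreover have "\<forall>x\<in>S. F differentiable (at x)" using *[rule_format, of "[]"] by simp
    ultimately show "smooth_upto (Suc n) S F" by simp
  qed
qed

lemma smooth_on_iff_upto: "smooth_on S F \<longleftrightarrow> (\<forall>n. smooth_upto n S F)"
  unfolding smooth_on_def smooth_upto_iff by blast

lemma smooth_on_subset: "smooth_on S F \<Longrightarrow> T \<subseteq> S \<Longrightarrow> smooth_on T F"
  unfolding smooth_on_def by blast

lemma smooth_on_imp_differentiable: "smooth_on S F \<Longrightarrow> x \<in> S \<Longrightarrow> F differentiable (at x)"
  using smooth_on_iff_upto smooth_upto_imp_differentiable by blast

lemma smooth_on_imp_continuous_on: "smooth_on S F \<Longrightarrow> continuous_on S F"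
  by (meson continuous_at_imp_continuous_on differentiable_imp_continuous_within
      smooth_on_imp_differentiable)

lemma smooth_on_frechet: "smooth_on S F \<Longrightarrow> smooth_on S (\<lambda>x. frechet_derivative F (at x) v)"
  unfolding smooth_on_iff_upto by (metis smooth_upto.simps(2))

lemma smooth_on_iter_deriv: "smooth_on S F \<Longrightarrow> smooth_on S (iter_deriv vs F)"
  by (induction vs) (auto intro: smooth_on_frechet)

lemma smooth_upto_cong:
  assumes "open S" "\<And>x. x \<in> S \<Longrightarrow> F x = G x" "smooth_upto n S F"
  shows "smooth_upto n S G" using assms(2,3)
proof (induction n arbitrary: F G)
  case 0
  have "G differentiable (at x)" if "x \<in> S" for x
    using differentiable_cong_open[OF assms(1) 0(1) that] 0(2) that by auto
  then show ?case by simp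
next
  case (Suc n)
  have "smooth_upto n S (\<lambda>x. frechet_derivative G (at x) v)" for v
    by (rule Suc.IH[of "\<lambda>x. frechet_derivative F (at x) v"])
       (use Suc.prems frechet_derivative_cong_open[OF assms(1) Suc.prems(1)] in auto)
  moreover have "G differentiable (at x)" if "x \<in> S" for x
    using differentiable_cong_open[OF assms(1) Suc.prems(1) that] Suc.prems(2) that by auto
  ultimately show ?case by simp
qed

lemma smooth_on_cong:
  assumes "open S" "\<And>x. x \<in> S \<Longrightarrow> F x = G x" "smooth_on S F"
  shows "smooth_on S G" using assms smooth_upto_cong unfolding smooth_on_iff_upto by metis

text \<open>The derivative is supplied explicitly, so each closure rule reduces to a
  \<open>has_derivative\<close> fact and to smoothness of the supplied expression to one order
  less.\<close>

lemma smooth_upto_SucI: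
  assumes "open S"
    and "\<And>x. x \<in> S \<Longrightarrow> (F has_derivative D x) (at x)"
    and "\<And>v. smooth_upto n S (\<lambda>x. D x v)"
  shows "smooth_upto (Suc n) S F"
proof -
  have "frechet_derivative F (at x) = D x" if "x \<in> S" for x
    using assms(2)[OF that] frechet_derivative_at by metis
  then have "smooth_upto n S (\<lambda>x. frechet_derivative F (at x) v)" for v
    by (intro smooth_upto_cong[OF assms(1) _ assms(3)]) simp
  then show ?thesis using assms(2) differentiableI by (simp) blast
qed

lemma smooth_upto_const: "smooth_upto n S (\<lambda>x. c)"
  by (induction n arbitrary: c) (auto)

lemma smooth_upto_bounded_linear:
  assumes "open S" "bounded_linear l"
  shows "smooth_upto n S l"
proof (cases n)
  case 0
  then show ?thesis by (simp add: assms(2) bounded_linear_imp_differentiable)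
next
  case (Suc k)
  show ?thesis unfolding Suc by (rule smooth_upto_SucI[OF assms(1), of _ "\<lambda>_. l"])
       (auto intro: smooth_upto_const bounded_linear_imp_has_derivative assms)
qed

lemma smooth_upto_add:
  assumes "open S" "smooth_upto n S F" "smooth_upto n S G"
  shows "smooth_upto n S (\<lambda>x. F x + G x)" using assms(2,3)
proof (induction n arbitrary: F G)
  case (Suc n)
  show ?case
    by (rule smooth_upto_SucI[OF assms(1), of _
          "\<lambda>x v. frechet_derivative F (at x) v + frechet_derivative G (at x) v"])
       (use Suc in \<open>auto intro!: has_derivative_add simp: frechet_derivative_works\<close>)
qed (auto)

text \<open>Proved for every bounded bilinear map, so that it covers both multiplication and
  \<open>scaleR\<close>; the latter is needed for the chain rule.\<close>

lemma (in bounded_bilinear) smooth_upto_prod: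
  assumes "open S" "smooth_upto n S F" "smooth_upto n S G"
  shows "smooth_upto n S (\<lambda>x. prod (F x) (G x))" using assms(2,3)
proof (induction n arbitrary: F G)
  case 0
  then show ?case unfolding smooth_upto.simps differentiable_def using FDERIV by metis
next
  case (Suc n)
  have "smooth_upto n S (\<lambda>x. prod (F x) (frechet_derivative G (at x) v) +
            prod (frechet_derivative F (at x) v) (G x))" for v
    by (intro smooth_upto_add[OF assms(1)] Suc.IH smooth_upto_Suc_imp[OF Suc.prems(1)]
        smooth_upto_Suc_imp[OF Suc.prems(2)] smooth_upto_frechet[OF Suc.prems(1)]
        smooth_upto_frechet[OF Suc.prems(2)])
  then show ?case
    by (intro smooth_upto_SucI[OF assms(1), of _
          "\<lambda>x v. prod (F x) (frechet_derivative G (at x) v) +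
            prod (frechet_derivative F (at x) v) (G x)"])
       (use Suc in \<open>auto intro!: FDERIV simp: frechet_derivative_works\<close>)
qed

lemma smooth_upto_linear_comp:
  assumes "open S" "bounded_linear l" "smooth_upto n S F"
  shows "smooth_upto n S (\<lambda>x. l (F x))" using assms(3)
proof (induction n arbitrary: F)
  case 0
  then show ?case unfolding smooth_upto.simps differentiable_def
    using bounded_linear.has_derivative[OF assms(2)] by metis
next
  case (Suc n)
  show ?case
    by (rule smooth_upto_SucI[OF assms(1), of _ "\<lambda>x v. l (frechet_derivative F (at x) v)"])
       (use Suc in \<open>auto intro!: bounded_linear.has_derivative[OF assms(2)] 
          simp: frechet_derivative_works\<close>)
qed

lemma smooth_upto_comp_linear:
  assumes "open S" "open T" "bounded_linear l" "l ` S \<subseteq> T" "smooth_upto n T F"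
  shows "smooth_upto n S (\<lambda>x. F (l x))" using assms(5)
proof (induction n arbitrary: F)
  case 0
  show ?case using 0 assms(3,4) differentiable_chain_at[of l _ F] bounded_linear_imp_differentiable
    unfolding smooth_upto.simps comp_def by blast
next
  case (Suc n)
  have "((\<lambda>x. F (l x)) has_derivative (\<lambda>v. frechet_derivative F (at (l x)) (l v))) (at x)"
    if "x \<in> S" for x using diff_chain_at[OF bounded_linear_imp_has_derivative[OF assms(3)],
        of F "frechet_derivative F (at (l x))"] that assms(4) Suc.prems
    by (auto simp: comp_def frechet_derivative_works image_subset_iff)
  then show ?case
    by (intro smooth_upto_SucI[OF assms(1), of _ "\<lambda>x v. frechet_derivative F (at (l x)) (l v)"])
       (use Suc in auto)
qed

lemma has_derivative_real_comp:
  fixes \<Phi> :: "real \<Rightarrow> 'w::real_normed_vector" and u :: "'v::real_normed_vector \<Rightarrow> real"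
  assumes "\<Phi> differentiable (at (u x))" "u differentiable (at x)"
  shows "((\<lambda>x. \<Phi> (u x)) has_derivative
     (\<lambda>v. frechet_derivative u (at x) v *\<^sub>R frechet_derivative \<Phi> (at (u x)) 1)) (at x)"
proof -
  have "linear (frechet_derivative \<Phi> (at (u x)))"
    using assms linear_frechet_derivative by blast
  then have "frechet_derivative \<Phi> (at (u x)) (frechet_derivative u (at x) v) =
    frechet_derivative u (at x) v *\<^sub>R frechet_derivative \<Phi> (at (u x)) 1" for v
    using linear_scale[of "frechet_derivative \<Phi> (at (u x))" "frechet_derivative u (at x) v" 1]
    by simp
  then show ?thesis
    using diff_chain_at[of u "frechet_derivative u (at x)" x \<Phi> "frechet_derivative \<Phi> (at (u x))"]
      assms by (simp add: comp_def frechet_derivative_works)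
qed

text \<open>With a real intermediate variable the derivative of the outer function is determined by
  its value at 1. The derivative of the composition is then a \<open>scaleR\<close> product, and the
  product rule closes the induction.\<close>

lemma smooth_upto_real_comp:
  fixes \<Phi> :: "real \<Rightarrow> 'w::real_normed_vector"
  assumes "open S" "open T" "u ` S \<subseteq> T" "smooth_upto n T \<Phi>" "smooth_upto n S u"
  shows "smooth_upto n S (\<lambda>x. \<Phi> (u x))" using assms(4,5)
proof (induction n arbitrary: \<Phi>)
  case 0
  then have "\<Phi> differentiable (at (u x))" "u differentiable (at x)" if "x \<in> S" for x
    using that assms(3) by auto
  then show ?case
    using has_derivative_real_comp unfolding smooth_upto.simps differentiable_def by metis
next
  case (Suc n)
  have "smooth_upto n S (\<lambda>x. frechet_derivative \<Phi> (at (u x)) 1)"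
    by (intro Suc.IH smooth_upto_frechet[OF Suc.prems(1)] smooth_upto_Suc_imp[OF Suc.prems(2)])
  then have "smooth_upto n S
      (\<lambda>x. frechet_derivative u (at x) v *\<^sub>R frechet_derivative \<Phi> (at (u x)) 1)" for v
    using Suc by (intro bounded_bilinear.smooth_upto_prod[OF bounded_bilinear_scaleR assms(1)]) auto
  then show ?case by (intro smooth_upto_SucI[OF assms(1) has_derivative_real_comp])
       (use Suc.prems assms(3) in auto)
qed

lemma smooth_upto_inverse: "smooth_upto n (- {0}) (inverse :: real \<Rightarrow> real)"
proof (induction n)
  case 0
  have "(inverse :: real \<Rightarrow> real) differentiable (at x)" if "x \<noteq> 0" for x
    using has_derivative_inverse'[OF that] unfolding differentiable_def by blast
  then show ?case by auto
next
  case (Suc n)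
  have "smooth_upto n (- {0::real}) (\<lambda>x. - (inverse x * v * inverse x))" for v
    by (intro smooth_upto_linear_comp[OF _ bounded_linear_minus[OF bounded_linear_ident]]
        bounded_bilinear.smooth_upto_prod[OF bounded_bilinear_mult] Suc smooth_upto_const) auto
  then show ?case by (intro smooth_upto_SucI[OF _ has_derivative_inverse']) auto
qed

lemma smooth_on_const [intro]: "smooth_on S (\<lambda>x. c)"
  by (simp add: smooth_on_iff_upto smooth_upto_const)

lemma smooth_on_bounded_linear: "open S \<Longrightarrow> bounded_linear l \<Longrightarrow> smooth_on S l"
  by (simp add: smooth_on_iff_upto smooth_upto_bounded_linear)

lemma smooth_on_linear_comp:
  "open S \<Longrightarrow> bounded_linear l \<Longrightarrow> smooth_on S F \<Longrightarrow> smooth_on S (\<lambda>x. l (F x))"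
  by (simp add: smooth_on_iff_upto smooth_upto_linear_comp)

lemma smooth_on_comp_linear:
  "open S \<Longrightarrow> open T \<Longrightarrow> bounded_linear l \<Longrightarrow> l ` S \<subseteq> T \<Longrightarrow> smooth_on T F \<Longrightarrow>
   smooth_on S (\<lambda>x. F (l x))" by (metis smooth_on_iff_upto smooth_upto_comp_linear)

lemma smooth_on_add:
  "open S \<Longrightarrow> smooth_on S F \<Longrightarrow> smooth_on S G \<Longrightarrow> smooth_on S (\<lambda>x. F x + G x)"
  by (simp add: smooth_on_iff_upto smooth_upto_add)

lemma smooth_on_minus: "open S \<Longrightarrow> smooth_on S F \<Longrightarrow> smooth_on S (\<lambda>x. - F x)"
  by (rule smooth_on_linear_comp[OF _ bounded_linear_minus[OF bounded_linear_ident]])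

lemma smooth_on_diff:
  "open S \<Longrightarrow> smooth_on S F \<Longrightarrow> smooth_on S G \<Longrightarrow> smooth_on S (\<lambda>x. F x - G x)"
  using smooth_on_add[of S F "\<lambda>x. - G x"] smooth_on_minus[of S G] by simp

lemma smooth_on_mult:
  fixes F G :: "'v::real_normed_vector \<Rightarrow> 'w::real_normed_algebra"
  shows "open S \<Longrightarrow> smooth_on S F \<Longrightarrow> smooth_on S G \<Longrightarrow> smooth_on S (\<lambda>x. F x * G x)"
  by (simp add: smooth_on_iff_upto bounded_bilinear.smooth_upto_prod[OF bounded_bilinear_mult])

lemma smooth_on_power:
  fixes F :: "'v::real_normed_vector \<Rightarrow> 'w::real_normed_algebra_1"
  shows "open S \<Longrightarrow> smooth_on S F \<Longrightarrow> smooth_on S (\<lambda>x. F x ^ n)"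
  by (induction n) (auto intro: smooth_on_mult)

lemma smooth_on_real_comp:
  fixes \<Phi> :: "real \<Rightarrow> 'w::real_normed_vector"
  shows "open S \<Longrightarrow> open T \<Longrightarrow> u ` S \<subseteq> T \<Longrightarrow> smooth_on T \<Phi> \<Longrightarrow> smooth_on S u \<Longrightarrow>
    smooth_on S (\<lambda>x. \<Phi> (u x))" by (metis smooth_on_iff_upto smooth_upto_real_comp)

lemma smooth_on_inverse:
  fixes u :: "'v::real_normed_vector \<Rightarrow> real"
  assumes "open S" "smooth_on S u" "\<And>x. x \<in> S \<Longrightarrow> u x \<noteq> 0"
  shows "smooth_on S (\<lambda>x. inverse (u x))"
  by (rule smooth_on_real_comp[OF assms(1), of "- {0}"])
     (use assms in \<open>auto simp: smooth_on_iff_upto smooth_upto_inverse\<close>)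

lemma smooth_on_divide:
  fixes u v :: "'v::real_normed_vector \<Rightarrow> real"
  assumes "open S" "smooth_on S u" "smooth_on S v" "\<And>x. x \<in> S \<Longrightarrow> v x \<noteq> 0"
  shows "smooth_on S (\<lambda>x. u x / v x)"
  using smooth_on_mult[OF assms(1,2) smooth_on_inverse[OF assms(1,3,4)]] by (simp add: field_simps)

lemma smooth_on_of_real:
  fixes u :: "'v::real_normed_vector \<Rightarrow> real"
  shows "open S \<Longrightarrow> smooth_on S u \<Longrightarrow> smooth_on S (\<lambda>x. complex_of_real (u x))"
  by (rule smooth_on_linear_comp[OF _ bounded_linear_of_real])

lemma smooth_on_cnj: "open S \<Longrightarrow> smooth_on S F \<Longrightarrow> smooth_on S (\<lambda>x. cnj (F x))"
  by (rule smooth_on_linear_comp[OF _ bounded_linear_cnj])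

lemma smooth_on_deriv:
  fixes \<Phi> :: "real \<Rightarrow> real"
  assumes "open T" "smooth_on T \<Phi>"
  shows "smooth_on T (deriv \<Phi>)"
proof (rule smooth_on_cong[OF assms(1) _ smooth_on_frechet[OF assms(2), of 1]])
  fix x assume "x \<in> T"
  then have "\<Phi> differentiable (at x)" using assms smooth_on_imp_differentiable by blast
  then show "frechet_derivative \<Phi> (at x) 1 = deriv \<Phi> x"
    by (metis DERIV_imp_deriv frechet_derivative_works has_field_derivative_def
        frechet_derivative_at mult.right_neutral real_differentiableE)
qed

lemma smooth_on_has_deriv:
  fixes \<Phi> :: "real \<Rightarrow> real"
  assumes "smooth_on T \<Phi>" "x \<in> T"
  shows "(\<Phi> has_real_derivative deriv \<Phi> x) (at x)"
  using smooth_on_imp_differentiable[OF assms] by (metis DERIV_imp_deriv real_differentiable_def)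

lemma smooth_on_ln: "smooth_on {0<..} (ln :: real \<Rightarrow> real)"
proof -
  have "smooth_upto n {0<..} (ln :: real \<Rightarrow> real)" for n
  proof (cases n)
    case 0
    then show ?thesis by (auto simp: differentiable_def intro!: exI derivative_eq_intros)
  next
    case (Suc k)
    have "smooth_on {0<..} (\<lambda>x::real. v * inverse x)" for v
      by (intro smooth_on_mult smooth_on_const smooth_on_inverse smooth_on_bounded_linear
          bounded_linear_ident) auto
    then show ?thesis unfolding Suc
      by (intro smooth_upto_SucI[of _ _ "\<lambda>x v. v * inverse x"])
         (auto intro!: derivative_eq_intros simp: smooth_on_iff_upto divide_inverse mult.commute)
  qed
  then show ?thesis by (simp add: smooth_on_iff_upto)
qed

lemma smooth_on_vec2:
  fixes F :: "'v::real_normed_vector \<Rightarrow> complex^2^2"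
  assumes "open S" "\<And>k l. smooth_on S (\<lambda>x. F x $ k $ l)"
  shows "smooth_on S F"
proof -
  define E :: "2 \<Rightarrow> 2 \<Rightarrow> complex \<Rightarrow> complex^2^2"
    where "E k l c = axis k (axis l c)" for k l c
  have ax: "axis k (a + b) = axis k a + axis k b" "axis k (x *\<^sub>R a) = x *\<^sub>R axis k a"
    for k :: 2 and a b :: "'c::real_normed_vector" and x by (auto simp: axis_def vec_eq_iff)
  have "bounded_linear (E k l)" for k l
    by (intro linear_conv_bounded_linear[THEN iffD1] linearI) (auto simp: E_def ax)
  then have "smooth_on S (\<lambda>x. E k l (F x $ k $ l))" for k l
    using smooth_on_linear_comp assms by blast
  then have "smooth_on S (\<lambda>x. E 1 1 (F x $ 1 $ 1) + E 1 2 (F x $ 1 $ 2) +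
       E 2 1 (F x $ 2 $ 1) + E 2 2 (F x $ 2 $ 2))" by (intro smooth_on_add assms) auto
  also have "(\<lambda>x. E 1 1 (F x $ 1 $ 1) + E 1 2 (F x $ 1 $ 2) +
       E 2 1 (F x $ 2 $ 1) + E 2 2 (F x $ 2 $ 2)) = F"
    by (auto simp: fun_eq_iff vec_eq_iff forall_2 E_def axis_def)
  finally show ?thesis .
qed

section \<open>Smooth dependence on a parameter, and convergence of all derivatives\<close>

lemma frechet_derivative_slice:
  fixes \<Psi> :: "'v::real_normed_vector \<times> 'u::real_normed_vector \<Rightarrow> 'w::real_normed_vector"
  assumes "\<Psi> differentiable (at (x, t))"
  shows "(\<lambda>y. \<Psi> (y, t)) differentiable (at x)"
    and "frechet_derivative (\<lambda>y. \<Psi> (y, t)) (at x) v = frechet_derivative \<Psi> (at (x, t)) (v, 0)"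
proof -
  have "((\<lambda>y. (y, t)) has_derivative (\<lambda>v. (v, 0))) (at x)"
    by (auto intro!: derivative_eq_intros)
  from diff_chain_at[OF this, of \<Psi> "frechet_derivative \<Psi> (at (x, t))"] assms
  have *: "((\<lambda>y. \<Psi> (y, t)) has_derivative (\<lambda>v. frechet_derivative \<Psi> (at (x, t)) (v, 0))) (at x)"
    by (simp add: comp_def frechet_derivative_works)
  from frechet_derivative_at[OF this]
  show "frechet_derivative (\<lambda>y. \<Psi> (y, t)) (at x) v = frechet_derivative \<Psi> (at (x, t)) (v, 0)"
    by metis
  show "(\<lambda>y. \<Psi> (y, t)) differentiable (at x)" using * unfolding differentiable_def by blast
qed

lemma iter_deriv_slice:
  fixes \<Psi> :: "'v::real_normed_vector \<times> 'u::real_normed_vector \<Rightarrow> 'w::real_normed_vector"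
  assumes "open S" "smooth_on O' \<Psi>" "S \<times> {t} \<subseteq> O'" "x \<in> S"
  shows "iter_deriv vs (\<lambda>y. \<Psi> (y, t)) x = iter_deriv (map (\<lambda>v. (v, 0)) vs) \<Psi> (x, t)"
  using assms(4)
proof (induction vs arbitrary: x)
  case (Cons v vs)
  have "iter_deriv (v # vs) (\<lambda>y. \<Psi> (y, t)) x =
      frechet_derivative (\<lambda>y. iter_deriv (map (\<lambda>v. (v, 0)) vs) \<Psi> (y, t)) (at x) v"
    using frechet_derivative_cong_open[OF assms(1) Cons.IH] Cons.prems by simp
  also have "\<dots> = iter_deriv (map (\<lambda>v. (v, 0)) (v # vs)) \<Psi> (x, t)"
    using frechet_derivative_slice(2)[OF smooth_on_imp_differentiable[OF smooth_on_iter_deriv[OF assms(2)]]]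
      assms(3) Cons.prems by (simp add: subset_iff)
  finally show ?case .
qed simp

lemma smooth_on_slice:
  fixes \<Psi> :: "'v::real_normed_vector \<times> 'u::real_normed_vector \<Rightarrow> 'w::real_normed_vector"
  assumes "open S" "smooth_on O' \<Psi>" "S \<times> {t} \<subseteq> O'"
  shows "smooth_on S (\<lambda>y. \<Psi> (y, t))" unfolding smooth_on_def
proof (intro allI ballI)
  fix vs :: "'v list" and x assume x: "x \<in> S"
  have "iter_deriv (map (\<lambda>v. (v, 0)) vs) \<Psi> differentiable (at (x, t))"
    using smooth_on_imp_differentiable[OF smooth_on_iter_deriv[OF assms(2)]] assms(3) x by blast
  from frechet_derivative_slice(1)[OF this]
  show "iter_deriv vs (\<lambda>y. \<Psi> (y, t)) differentiable (at x)"
    by (rule differentiable_cong_open[OF assms(1) _ x, rotated]) (simp add: iter_deriv_slice[OF assms])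
qed

text \<open>Each iterated derivative of a slice is a slice of an iterated derivative of
  \<open>\<Psi>\<close>, which is uniformly continuous on the compact set
  \<open>K \<times> {0..1}\<close>. The set \<open>O'\<close> is open and contains
  \<open>S \<times> {0}\<close>, so it also reaches negative parameters and \<open>\<Psi>\<close>
  has two-sided derivatives at parameter 0.\<close>

lemma smooth_convergence_of_joint:
  fixes \<Psi> :: "'v::real_normed_vector \<times> real \<Rightarrow> 'w::real_normed_vector"
  assumes S: "open S" and "open O'" and sm: "smooth_on O' \<Psi>"
    and sub: "S \<times> {0..} \<subseteq> O'"
    and d: "filterlim d (at_right 0) net"
    and F: "\<And>i x. d i > 0 \<Longrightarrow> x \<in> S \<Longrightarrow> F i x = \<Psi> (x, d i)"
    and F0: "\<And>x. x \<in> S \<Longrightarrow> F0 x = \<Psi> (x, 0)"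
  shows "smooth_convergence S F F0 net"
proof -
  have ev: "eventually (\<lambda>i. d i > 0) net"
    using d eventually_at_right_less filterlim_iff by fastforce
  have 0: "smooth_on S F0"
    by (rule smooth_on_cong[OF S _ smooth_on_slice[OF S sm, of 0]]) (use F0 sub in auto)
  have sub': "S \<times> {d i} \<subseteq> O'" if "d i > 0" for i using sub that by auto
  have 1: "smooth_on S (F i)" if "d i > 0" for i
    by (rule smooth_on_cong[OF S _ smooth_on_slice[OF S sm sub'[OF that]]]) (use F that in auto)
  have 2: "uniform_limit K (\<lambda>i. iter_deriv vs (F i)) (iter_deriv vs F0) net"
    if K: "compact K" "K \<subseteq> S" for vs K
  proof -
    define \<Theta> where "\<Theta> = iter_deriv (map (\<lambda>v. (v, 0::real)) vs) \<Psi>"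
    have eqi: "iter_deriv vs (F i) x = \<Theta> (x, d i)" if "d i > 0" "x \<in> S" for i x
      using iter_deriv_slice[OF S sm sub'[OF that(1)] that(2), of vs]
        iter_deriv_cong[OF S F[OF that(1)] that(2), where vs = vs] unfolding \<Theta>_def by simp
    have eq0: "iter_deriv vs F0 x = \<Theta> (x, 0)" if "x \<in> S" for x
    proof -
      have "S \<times> {0} \<subseteq> O'" using sub by auto
      from iter_deriv_slice[OF S sm this that, of vs] show ?thesis
        using iter_deriv_cong[OF S F0 that, where vs = vs] unfolding \<Theta>_def by simp
    qed
    have "continuous_on (K \<times> {0..1}) \<Theta>" unfolding \<Theta>_def
      by (rule continuous_on_subset[OF smooth_on_imp_continuous_on[OF smooth_on_iter_deriv[OF sm]]])
         (use K sub in auto)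
    then have uc: "uniformly_continuous_on (K \<times> {0..1}) \<Theta>"
      using K compact_uniformly_continuous compact_Times by blast
    show ?thesis
    proof (rule uniform_limitI)
      fix e :: real assume "e > 0"
      with uc obtain \<eta> where \<eta>: "\<eta> > 0"
        "\<And>p p'. p \<in> K \<times> {0..1} \<Longrightarrow> p' \<in> K \<times> {0..1} \<Longrightarrow> dist p' p < \<eta> \<Longrightarrow> dist (\<Theta> p') (\<Theta> p) < e"
        unfolding uniformly_continuous_on_def by metis
      have "eventually (\<lambda>t::real. t < min \<eta> 1) (at_right 0)"
        by (rule eventually_at_right_real[THEN eventually_mono, of 0 "min \<eta> 1"]) (use \<eta> in auto)
      with d have "eventually (\<lambda>i. d i < min \<eta> 1) net" unfolding filterlim_iff by blast
      with ev show "eventually (\<lambda>i. \<forall>x\<in>K. dist (iter_deriv vs (F i) x) (iter_deriv vs F0 x) < e) net"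
      proof eventually_elim
        case (elim i)
        show ?case
        proof
          fix x assume x: "x \<in> K"
          have "dist (\<Theta> (x, d i)) (\<Theta> (x, 0)) < e"
            by (rule \<eta>(2)) (use elim x in \<open>auto simp: dist_Pair_Pair\<close>)
          then show "dist (iter_deriv vs (F i) x) (iter_deriv vs F0 x) < e"
            using eqi eq0 x K elim by auto
        qed
      qed
    qed
  qed
  show ?thesis unfolding smooth_convergence_def using 0 1 2 ev by (auto elim: eventually_mono)
qed

section \<open>Wirtinger calculus\<close>

text \<open>The operators \<open>d_z\<close>, \<open>d_zbar\<close>, \<open>del\<close> and \<open>delbar\<close> are all of this form, with
  \<open>c = - \<i>\<close> or \<open>c = \<i>\<close>.\<close>

definition wirt ::
    "complex \<Rightarrow> 'v \<Rightarrow> 'v \<Rightarrow> ('v::real_normed_vector \<Rightarrow> complex) \<Rightarrow> 'v \<Rightarrow> complex" where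
  "wirt c x y F q = (frechet_derivative F (at q) x + c * frechet_derivative F (at q) y) / 2"

lemma d_z_wirt: "d_z F q = wirt (-\<i>) 1 \<i> F q"
  and d_zbar_wirt: "d_zbar F q = wirt \<i> 1 \<i> F q"
  and del_wirt: "del k f q' = wirt (-\<i>) (dir k 1) (dir k \<i>) f q'"
  and delbar_wirt: "delbar k f q' = wirt \<i> (dir k 1) (dir k \<i>) f q'"
  by (auto simp: d_z_def d_zbar_def del_def delbar_def wirt_def)

lemma frechet_derivative_eqI: "(F has_derivative D) (at q) \<Longrightarrow> frechet_derivative F (at q) = D"
  by (metis frechet_derivative_at)

lemma wirt_eqI: "(F has_derivative D) (at q) \<Longrightarrow> wirt c x y F q = (D x + c * D y) / 2"
  unfolding wirt_def by (simp add: frechet_derivative_eqI)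

lemma wirt_cong:
  assumes "open S" "q \<in> S" "\<And>p. p \<in> S \<Longrightarrow> F p = G p"
  shows "wirt c x y F q = wirt c x y G q"
  unfolding wirt_def using frechet_derivative_cong_open[OF assms(1,3,2)] by simp

lemma wirt_const [simp]: "wirt c x y (\<lambda>p. k) q = 0"
  by (simp add: wirt_def)

lemma wirt_add:
  assumes "F differentiable (at q)" "G differentiable (at q)"
  shows "wirt c x y (\<lambda>p. F p + G p) q = wirt c x y F q + wirt c x y G q"
  using wirt_eqI[OF has_derivative_add[OF assms[unfolded frechet_derivative_works]]]
  by (simp add: wirt_def algebra_simps add_divide_distrib)

lemma wirt_diff:
  assumes "F differentiable (at q)" "G differentiable (at q)"
  shows "wirt c x y (\<lambda>p. F p - G p) q = wirt c x y F q - wirt c x y G q"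
  using wirt_eqI[OF has_derivative_diff[OF assms[unfolded frechet_derivative_works]]]
  by (simp add: wirt_def algebra_simps add_divide_distrib diff_divide_distrib)

lemma wirt_mult:
  assumes "F differentiable (at q)" "G differentiable (at q)"
  shows "wirt c x y (\<lambda>p. F p * G p) q = wirt c x y F q * G q + F q * wirt c x y G q"
  using wirt_eqI[OF has_derivative_mult[OF assms[unfolded frechet_derivative_works]]]
  by (simp add: wirt_def algebra_simps add_divide_distrib diff_divide_distrib)

lemma wirt_of_real_comp:
  fixes u :: "'v::real_normed_vector \<Rightarrow> real"
  assumes "(\<Phi> has_real_derivative D) (at (u q))" "u differentiable (at q)"
  shows "wirt c x y (\<lambda>p. complex_of_real (\<Phi> (u p))) q =
     complex_of_real D * wirt c x y (\<lambda>p. complex_of_real (u p)) q"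
proof -
  let ?u = "frechet_derivative u (at q)"
  have u: "(u has_derivative ?u) (at q)" using assms frechet_derivative_works by blast
  have 1: "((\<lambda>p. complex_of_real (u p)) has_derivative (\<lambda>v. of_real (?u v))) (at q)"
    using has_derivative_of_real[OF u] by simp
  have "((\<lambda>p. \<Phi> (u p)) has_derivative (\<lambda>v. D * ?u v)) (at q)"
    using diff_chain_at[OF u assms(1)[unfolded has_field_derivative_def]] by (simp add: comp_def)
  from has_derivative_of_real[OF this]
  have 2: "((\<lambda>p. complex_of_real (\<Phi> (u p))) has_derivative (\<lambda>v. of_real (D * ?u v))) (at q)"
    by simp
  show ?thesis unfolding wirt_eqI[OF 1] wirt_eqI[OF 2] by (simp add: algebra_simps)
qed

lemma wirt_cnj:
  assumes "F differentiable (at q)"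
  shows "wirt c x y (\<lambda>p. cnj (F p)) q = cnj (wirt (cnj c) x y F q)"
  using wirt_eqI[OF has_derivative_cnj[OF assms[unfolded frechet_derivative_works]]]
  by (simp add: wirt_def)

lemma differentiable_cnj: "F differentiable (at q) \<Longrightarrow> (\<lambda>p. cnj (F p)) differentiable (at q)"
  using has_derivative_cnj unfolding differentiable_def by blast

lemma differentiable_fst_comp:
  assumes "F differentiable (at (fst q))"
  shows "(\<lambda>p. F (fst p)) differentiable (at q)"
  using differentiable_chain_at[OF bounded_linear_imp_differentiable[OF bounded_linear_fst] assms]
  by (simp add: comp_def)

lemma frechet_derivative_fst_comp:
  assumes "F differentiable (at (fst q))"
  shows "frechet_derivative (\<lambda>p. F (fst p)) (at q) v = frechet_derivative F (at (fst q)) (fst v)"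
  using frechet_derivative_eqI[OF diff_chain_at[OF bounded_linear_imp_has_derivative[OF bounded_linear_fst] 
     assms[unfolded frechet_derivative_works]]] by (simp add: comp_def)

lemma dir_simps [simp]: "dir 1 c = (c, 0)" "dir 2 c = (0, c)"
  by (auto simp: dir_def)

lemma wirt_fst_comp:
  fixes F :: "complex \<Rightarrow> complex" and q :: c2
  assumes "F differentiable (at (fst q))"
  shows "wirt c (dir 1 x) (dir 1 y) (\<lambda>p. F (fst p)) q = wirt c x y F (fst q)"
    and "wirt c (dir 2 x) (dir 2 y) (\<lambda>p. F (fst p)) q = 0"
  using linear_0[OF linear_frechet_derivative[OF assms]]
  by (simp_all add: wirt_def frechet_derivative_fst_comp[OF assms])

lemma wirt_snd:
  fixes q :: c2
  shows "wirt c (dir 1 x) (dir 1 y) snd q = 0"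
    and "wirt c (dir 2 x) (dir 2 y) snd q = (x + c * y) / 2"
    and "wirt c (dir 1 x) (dir 1 y) (\<lambda>p. cnj (snd p)) q = 0"
    and "wirt c (dir 2 x) (dir 2 y) (\<lambda>p. cnj (snd p)) q = (cnj x + c * cnj y) / 2"
proof -
  have s: "(snd has_derivative snd) (at q)"
    by (rule bounded_linear_imp_has_derivative[OF bounded_linear_snd])
  note 1 = s has_derivative_cnj[OF s]
  show "wirt c (dir 1 x) (dir 1 y) snd q = 0"
    "wirt c (dir 2 x) (dir 2 y) snd q = (x + c * y) / 2"
    "wirt c (dir 1 x) (dir 1 y) (\<lambda>p. cnj (snd p)) q = 0"
    "wirt c (dir 2 x) (dir 2 y) (\<lambda>p. cnj (snd p)) q = (cnj x + c * cnj y) / 2"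
    unfolding wirt_eqI[OF 1(1)] wirt_eqI[OF 1(2)] by simp_all
qed

text \<open>Carries differentiability and all four first derivatives together, in the order
  \<open>del 1\<close>, \<open>del 2\<close>, \<open>delbar 1\<close>, \<open>delbar 2\<close>. The
  derivatives of a long expression are then assembled by composing rules along its syntax
  tree.\<close>

definition wd :: "(c2 \<Rightarrow> complex) \<Rightarrow> c2 \<Rightarrow> complex \<Rightarrow> complex \<Rightarrow> complex \<Rightarrow> complex \<Rightarrow> bool" where
  "wd F q p1 p2 s1 s2 \<longleftrightarrow> F differentiable (at q) \<and>
     del 1 F q = p1 \<and> del 2 F q = p2 \<and> delbar 1 F q = s1 \<and> delbar 2 F q = s2"

lemma wd_eq: "wd F q p1 p2 s1 s2 \<Longrightarrow> p1 = p1' \<Longrightarrow> p2 = p2' \<Longrightarrow> s1 = s1' \<Longrightarrow> s2 = s2' \<Longrightarrow> wd F q p1' p2' s1' s2'"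
  by simp

lemma wd_const: "wd (\<lambda>p. k) q 0 0 0 0"
  by (simp add: wd_def del_wirt delbar_wirt)

lemma wd_add:
  "wd F q p1 p2 s1 s2 \<Longrightarrow> wd G q p1' p2' s1' s2' \<Longrightarrow>
   wd (\<lambda>p. F p + G p) q (p1 + p1') (p2 + p2') (s1 + s1') (s2 + s2')"
  by (auto simp: wd_def del_wirt delbar_wirt wirt_add)

lemma wd_diff:
  "wd F q p1 p2 s1 s2 \<Longrightarrow> wd G q p1' p2' s1' s2' \<Longrightarrow>
   wd (\<lambda>p. F p - G p) q (p1 - p1') (p2 - p2') (s1 - s1') (s2 - s2')"
  by (auto simp: wd_def del_wirt delbar_wirt wirt_diff)

lemma wd_mult:
  "wd F q p1 p2 s1 s2 \<Longrightarrow> wd G q p1' p2' s1' s2' \<Longrightarrow>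
   wd (\<lambda>p. F p * G p) q (p1 * G q + F q * p1') (p2 * G q + F q * p2')
      (s1 * G q + F q * s1') (s2 * G q + F q * s2')"
  by (auto simp: wd_def del_wirt delbar_wirt wirt_mult)

lemma wd_cnj:
  "wd F q p1 p2 s1 s2 \<Longrightarrow> wd (\<lambda>p. cnj (F p)) q (cnj s1) (cnj s2) (cnj p1) (cnj p2)"
  by (auto simp: wd_def del_wirt delbar_wirt wirt_cnj differentiable_cnj)

lemma wd_of_real_comp:
  assumes "wd (\<lambda>p. complex_of_real (u p)) q p1 p2 s1 s2" "u differentiable (at q)"
    "(\<Phi> has_real_derivative D) (at (u q))"
  shows "wd (\<lambda>p. complex_of_real (\<Phi> (u p))) q (D * p1) (D * p2) (D * s1) (D * s2)"
proof -
  have "\<Phi> differentiable (at (u q))" using assms(3) real_differentiable_def by blast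
  then have "(\<lambda>p. \<Phi> (u p)) differentiable (at q)"
    using differentiable_chain_at[OF assms(2)] by (simp add: comp_def)
  then have "(\<lambda>p. complex_of_real (\<Phi> (u p))) differentiable (at q)"
    using has_derivative_of_real unfolding differentiable_def by blast
  then show ?thesis using assms by (simp add: wd_def del_wirt delbar_wirt wirt_of_real_comp)
qed

lemma wd_fst_comp:
  assumes "F differentiable (at (fst q))"
  shows "wd (\<lambda>p. F (fst p)) q (d_z F (fst q)) 0 (d_zbar F (fst q)) 0"
  using differentiable_fst_comp[OF assms] wirt_fst_comp[OF assms]
  by (simp add: wd_def del_wirt delbar_wirt d_z_wirt d_zbar_wirt del: dir_simps)

lemma wd_snd: "wd snd q 0 1 0 0" "wd (\<lambda>p. cnj (snd p)) q 0 0 0 1"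
proof -
  have s: "snd differentiable (at q)"
    by (rule bounded_linear_imp_differentiable[OF bounded_linear_snd])
  then have "(\<lambda>p. cnj (snd p)) differentiable (at q)"
    using has_derivative_cnj unfolding differentiable_def by blast
  with s show "wd snd q 0 1 0 0" "wd (\<lambda>p. cnj (snd p)) q 0 0 0 1"
    by (simp_all add: wd_def del_wirt delbar_wirt wirt_snd del: dir_simps)
qed

lemma wirt_holomorphic:
  assumes "(F has_field_derivative D) (at z)"
  shows "wirt c 1 \<i> F z = D * (1 + c * \<i>) / 2"
  using wirt_eqI[OF assms[unfolded has_field_derivative_def]] by (simp add: algebra_simps)

section \<open>The Calabi ansatz in local coordinates\<close>

lemma smooth_on_wirt: "open S \<Longrightarrow> smooth_on S F \<Longrightarrow> smooth_on S (\<lambda>q. wirt c x y F q)"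
  unfolding wirt_def by (rule smooth_on_linear_comp[where l = "\<lambda>z. z / 2"])
     (auto intro!: smooth_on_add smooth_on_mult smooth_on_frechet smooth_on_const
       bounded_linear_divide)

text \<open>The two positivity conditions say that the metric is positive along the base and along
  the fibres. The set \<open>J\<close> may contain 0 and negative numbers, so that the zero section
  can be an interior part of the domain. The derivatives are named, not written with
  \<open>deriv\<close>, so that closed forms can be inserted.\<close>

locale potential =
  fixes J :: "real set" and F F1 F2 F3 F4 :: "real \<Rightarrow> real"
  assumes open_J: "open J"
    and F_deriv: "\<And>x. x \<in> J \<Longrightarrow> (F has_real_derivative F1 x) (at x)"
    "\<And>x. x \<in> J \<Longrightarrow> (F1 has_real_derivative F2 x) (at x)"
    "\<And>x. x \<in> J \<Longrightarrow> (F2 has_real_derivative F3 x) (at x)"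
    "\<And>x. x \<in> J \<Longrightarrow> (F3 has_real_derivative F4 x) (at x)"
    and P_pos': "\<And>x. x \<in> J \<Longrightarrow> 1 + x * F1 x > 0" and Q_pos': "\<And>x. x \<in> J \<Longrightarrow> F1 x + x * F2 x > 0"
begin

text \<open>For a potential \<open>F(x)\<close>, \<open>x = e\<^sup>s\<close>, the metric is \<open>P g\<close> on the base and \<open>Q H\<close> along the fibres, in the
  coframe \<open>dz\<close>, \<open>dw + w \<partial>ln H\<close>. The products \<open>x E\<close> and \<open>x Z\<close> are the derivatives of \<open>ln P\<close> and \<open>ln Q\<close>
  with respect to \<open>s\<close>.\<close>

definition "P x = 1 + x * F1 x"
definition "Q x = F1 x + x * F2 x"
definition "Q1 x = 2 * F2 x + x * F3 x"
definition "Q2 x = 3 * F3 x + x * F4 x"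
definition "E x = Q x / P x"
definition "E1 x = Q1 x / P x - (Q x / P x)\<^sup>2"
definition "Z x = Q1 x / Q x"
definition "Z1 x = Q2 x / Q x - (Q1 x / Q x)\<^sup>2"
definition "W1 x = (1 + x * E x) * (Z x + x * Z1 x) + (E x + x * E1 x) * (1 + x * Z x - x * E x)"

lemma P_pos: "x \<in> J \<Longrightarrow> P x > 0" and Q_pos: "x \<in> J \<Longrightarrow> Q x > 0"
  using P_pos' Q_pos' by (auto simp: P_def Q_def)

lemma PQ_deriv:
  assumes "x \<in> J"
  shows "(P has_real_derivative Q x) (at x)" "(Q has_real_derivative Q1 x) (at x)"
    "(Q1 has_real_derivative Q2 x) (at x)"
    "(E has_real_derivative E1 x) (at x)" "(Z has_real_derivative Z1 x) (at x)"
proof -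
  show P: "(P has_real_derivative Q x) (at x)" and Q: "(Q has_real_derivative Q1 x) (at x)"
    and Q1: "(Q1 has_real_derivative Q2 x) (at x)"
    unfolding P_def[abs_def] Q_def[abs_def] Q1_def[abs_def] Q2_def
    by (auto intro!: derivative_eq_intros F_deriv[OF assms])
  note pos = P_pos[OF assms] Q_pos[OF assms]
  show "(E has_real_derivative E1 x) (at x)" "(Z has_real_derivative Z1 x) (at x)"
    unfolding E_def[abs_def] Z_def[abs_def] E1_def Z1_def using pos
    by (auto intro!: derivative_eq_intros P Q Q1 simp: field_simps power2_eq_square)
qed

text \<open>\<open>W1\<close> is the expression that comes out of the curvature computation; that it
  is an exact derivative turns the fibre integrals of \<open>c_2\<close> into boundary
  terms.\<close>

lemma W_deriv:
  "x \<in> J \<Longrightarrow> ((\<lambda>x. (1 + x * E x) * (1 + x * Z x) - (x * E x)\<^sup>2 / 2) has_real_derivative W1 x) (at x)"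
  unfolding W1_def
  by (auto intro!: derivative_eq_intros PQ_deriv simp: algebra_simps power2_eq_square)

end

text \<open>Here \<open>g\<close> is the coefficient of the metric on the base, and \<open>H\<close> is the squared norm of the
  frame; \<open>a = \<partial>ln H\<close>, \<open>mu = \<partial>ln g\<close> and \<open>r = e\<^sup>s\<close> below.\<close>

locale calabi_local =
  fixes U :: "complex set" and g H :: "complex \<Rightarrow> real"
  assumes open_U: "open U"
    and smooth_g: "smooth_on U g" and smooth_H: "smooth_on U H"
    and g_pos: "\<And>z. z \<in> U \<Longrightarrow> g z > 0" and H_pos: "\<And>z. z \<in> U \<Longrightarrow> H z > 0"
    and curv: "\<And>z. z \<in> U \<Longrightarrow> d_z (d_zbar (\<lambda>\<xi>. complex_of_real (ln (H \<xi>)))) z = of_real (g z)"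
    and ric: "\<And>z. z \<in> U \<Longrightarrow> d_z (d_zbar (\<lambda>\<xi>. complex_of_real (ln (g \<xi>)))) z = of_real (2 * g z)"
begin

definition a :: "complex \<Rightarrow> complex" where "a = d_z (\<lambda>\<xi>. complex_of_real (ln (H \<xi>)))"
definition mu :: "complex \<Rightarrow> complex" where "mu = d_z (\<lambda>\<xi>. complex_of_real (ln (g \<xi>)))"
definition r :: "c2 \<Rightarrow> real" where "r q = (cmod (snd q))\<^sup>2 * H (fst q)"
definition \<Omega> :: "c2 set" where "\<Omega> = U \<times> UNIV"

lemma open_\<Omega>: "open \<Omega>"
  unfolding \<Omega>_def using open_U by (intro open_Times) auto

lemma r_nonneg: "q \<in> \<Omega> \<Longrightarrow> r q \<ge> 0"
  using H_pos by (auto simp: r_def \<Omega>_def less_imp_le)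

lemma r_complex: "complex_of_real (r q) = snd q * cnj (snd q) * of_real (H (fst q))"
  unfolding r_def of_real_mult complex_norm_square ..

lemma smooth_ln:
  assumes "smooth_on U k" "\<And>z. z \<in> U \<Longrightarrow> k z > 0"
  shows "smooth_on U (\<lambda>\<xi>. complex_of_real (ln (k \<xi>)))"
  by (intro smooth_on_of_real open_U smooth_on_real_comp[OF open_U _ _ smooth_on_ln assms(1)])
     (use assms in auto)

lemma smooth_fst: "smooth_on U k \<Longrightarrow> smooth_on \<Omega> (\<lambda>p. k (fst p))"
  by (rule smooth_on_comp_linear[OF open_\<Omega> open_U bounded_linear_fst]) (auto simp: \<Omega>_def)

lemma smooth_a: "smooth_on U a" and smooth_mu: "smooth_on U mu"
  unfolding a_def mu_def d_z_wirt
  using smooth_on_wirt[OF open_U smooth_ln[OF smooth_H H_pos], of "-\<i>" 1 \<i>]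
    smooth_on_wirt[OF open_U smooth_ln[OF smooth_g g_pos], of "-\<i>" 1 \<i>]
  by (simp_all add: d_z_wirt[abs_def])

lemma dz_log:
  assumes "smooth_on U k" "\<And>z. z \<in> U \<Longrightarrow> k z > 0" and z: "z \<in> U"
  shows "d_z (\<lambda>\<xi>. complex_of_real (k \<xi>)) z = d_z (\<lambda>\<xi>. complex_of_real (ln (k \<xi>))) z * k z"
    and "d_zbar (\<lambda>\<xi>. complex_of_real (k \<xi>)) z = cnj (d_z (\<lambda>\<xi>. complex_of_real (ln (k \<xi>))) z) * k z"
    and "d_zbar (\<lambda>\<xi>. complex_of_real (ln (k \<xi>))) z = cnj (d_z (\<lambda>\<xi>. complex_of_real (ln (k \<xi>))) z)"
proof -
  have k: "k differentiable (at z)" using assms smooth_on_imp_differentiable by blast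
  have 1: "(ln has_real_derivative inverse (k z)) (at (k z))"
    using assms by (auto intro!: derivative_eq_intros simp: field_simps)
  have nz: "complex_of_real (k z) \<noteq> 0" using assms(2)[OF z] by auto
  show "d_z (\<lambda>\<xi>. complex_of_real (k \<xi>)) z = d_z (\<lambda>\<xi>. complex_of_real (ln (k \<xi>))) z * k z"
    unfolding d_z_wirt wirt_of_real_comp[OF 1 k] using nz by simp
  have 2: "(\<lambda>\<xi>. complex_of_real (ln (k \<xi>))) differentiable (at z)"
    using smooth_ln[OF assms(1,2)] z smooth_on_imp_differentiable by blast
  show 3: "d_zbar (\<lambda>\<xi>. complex_of_real (ln (k \<xi>))) z = cnj (d_z (\<lambda>\<xi>. complex_of_real (ln (k \<xi>))) z)"
    using wirt_cnj[OF 2, of \<i> 1 \<i>] by (simp add: d_z_wirt d_zbar_wirt)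
  show "d_zbar (\<lambda>\<xi>. complex_of_real (k \<xi>)) z = cnj (d_z (\<lambda>\<xi>. complex_of_real (ln (k \<xi>))) z) * k z"
    unfolding 3[symmetric] d_zbar_wirt wirt_of_real_comp[OF 1 k] using nz by simp
qed

lemma dz_cnj:
  assumes "smooth_on U F" "z \<in> U"
  shows "d_z (\<lambda>\<xi>. cnj (F \<xi>)) z = cnj (d_zbar F z)" "d_zbar (\<lambda>\<xi>. cnj (F \<xi>)) z = cnj (d_z F z)"
  using wirt_cnj[OF smooth_on_imp_differentiable[OF assms]] by (simp_all add: d_z_wirt d_zbar_wirt)

text \<open>The hypotheses concern \<open>d_z\<close> of \<open>d_zbar\<close>, in the opposite
  order. No symmetry of second derivatives is used: as \<open>ln k\<close> is real,
  \<open>d_zbar\<close> of it is the conjugate of \<open>d_z\<close> of it, so the two mixed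
  derivatives are conjugate, and the prescribed values are real.\<close>

lemma dz_a:
  assumes z: "z \<in> U"
  shows "d_zbar a z = g z" "d_zbar mu z = 2 * g z"
proof -
  have *: "d_zbar (d_z (\<lambda>\<xi>. complex_of_real (ln (k \<xi>)))) z =
      cnj (d_z (d_zbar (\<lambda>\<xi>. complex_of_real (ln (k \<xi>)))) z)"
    if k: "smooth_on U k" "\<And>z. z \<in> U \<Longrightarrow> k z > 0" for k
  proof -
    let ?l = "\<lambda>\<xi>. complex_of_real (ln (k \<xi>))"
    have "d_z (d_zbar ?l) z = d_z (\<lambda>\<xi>. cnj (d_z ?l \<xi>)) z"
      unfolding d_z_wirt by (rule wirt_cong[OF open_U z]) (simp add: dz_log[OF k] flip: d_z_wirt)
    also have "\<dots> = cnj (d_zbar (d_z ?l) z)"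
      using smooth_on_wirt[OF open_U smooth_ln[OF k], of "-\<i>" 1 \<i>]
      by (intro dz_cnj z) (simp add: d_z_wirt[abs_def])
    finally show ?thesis by simp
  qed
  show "d_zbar a z = g z" "d_zbar mu z = 2 * g z"
    unfolding a_def mu_def using *[OF smooth_H H_pos] *[OF smooth_g g_pos] curv[OF z] ric[OF z]
    by simp_all
qed

context
  fixes q assumes q: "q \<in> \<Omega>"
begin

lemma fst_q: "fst q \<in> U" using q by (auto simp: \<Omega>_def)

lemma wd_of_base: "smooth_on U F \<Longrightarrow> wd (\<lambda>p. F (fst p)) q (d_z F (fst q)) 0 (d_zbar F (fst q)) 0"
  using wd_fst_comp smooth_on_imp_differentiable fst_q by blast

lemma wd_g: "wd (\<lambda>p. complex_of_real (g (fst p))) q (mu (fst q) * g (fst q)) 0 (cnj (mu (fst q)) * g (fst q)) 0"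
  using wd_of_base[OF smooth_on_of_real[OF open_U smooth_g]] dz_log[OF smooth_g g_pos fst_q]
  by (simp add: mu_def)

lemma wd_H: "wd (\<lambda>p. complex_of_real (H (fst p))) q (a (fst q) * H (fst q)) 0 (cnj (a (fst q)) * H (fst q)) 0"
  using wd_of_base[OF smooth_on_of_real[OF open_U smooth_H]] dz_log[OF smooth_H H_pos fst_q]
  by (simp add: a_def)

lemma wd_a: "wd (\<lambda>p. a (fst p)) q (d_z a (fst q)) 0 (g (fst q)) 0"
  using wd_of_base[OF smooth_a] dz_a[OF fst_q] by simp

lemma wd_mu: "wd (\<lambda>p. mu (fst p)) q (d_z mu (fst q)) 0 (2 * g (fst q)) 0"
  using wd_of_base[OF smooth_mu] dz_a[OF fst_q] by simp

lemma wd_r: "wd (\<lambda>p. complex_of_real (r p)) q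
   (a (fst q) * r q) (cnj (snd q) * H (fst q)) (cnj (a (fst q)) * r q) (snd q * H (fst q))"
  unfolding r_complex
  by (rule wd_eq, rule wd_mult[OF wd_mult[OF wd_snd] wd_H]) (simp_all add: algebra_simps)

end

lemma smooth_r: "smooth_on \<Omega> r"
proof -
  have "smooth_on \<Omega> (\<lambda>p. Re (snd p * cnj (snd p) * of_real (H (fst p))))"
    by (intro smooth_on_linear_comp[OF _ bounded_linear_Re] smooth_on_mult smooth_on_cnj
        smooth_on_bounded_linear bounded_linear_snd smooth_on_of_real smooth_fst smooth_H open_\<Omega>)
  then show ?thesis by (simp flip: r_complex)
qed

lemma continuous_r: "continuous_on \<Omega> r"
  using smooth_r smooth_on_imp_continuous_on by blast

end

section \<open>The metric, its Chern connection and its second Chern form\<close>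

locale calabi_potential = calabi_local + potential
begin

definition \<Omega>J :: "c2 set" where "\<Omega>J = {q \<in> \<Omega>. r q \<in> J}"

lemma open_\<Omega>J: "open \<Omega>J"
proof -
  have "\<Omega>J = \<Omega> \<inter> r -` J" by (auto simp: \<Omega>J_def)
  then show ?thesis using continuous_open_preimage[OF continuous_r open_\<Omega> open_J] by (simp add: Int_def vimage_def)
qed

definition Gm :: "c2 \<Rightarrow> complex^2^2" where
  "Gm q = (\<chi> k l. if k = 1
     then if l = 1 then of_real (g (fst q)) * of_real (P (r q)) + a (fst q) * cnj (a (fst q)) * of_real (r q) * of_real (Q (r q))
          else snd q * of_real (H (fst q)) * a (fst q) * of_real (Q (r q))
     else if l = 1 then cnj (snd q) * of_real (H (fst q)) * cnj (a (fst q)) * of_real (Q (r q))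
          else of_real (H (fst q)) * of_real (Q (r q)))"

lemma wd_real_r:
  fixes q :: c2
  assumes "q \<in> \<Omega>J" "(\<Phi> has_real_derivative D) (at (r q))"
  shows "wd (\<lambda>p. complex_of_real (\<Phi> (r p))) q
   (of_real D * (a (fst q) * of_real (r q))) (of_real D * (cnj (snd q) * of_real (H (fst q))))
   (of_real D * (cnj (a (fst q)) * of_real (r q))) (of_real D * (snd q * of_real (H (fst q))))"
proof -
  have q: "q \<in> \<Omega>" using assms by (auto simp: \<Omega>J_def)
  show ?thesis
    by (rule wd_of_real_comp[OF wd_r[OF q] smooth_on_imp_differentiable[OF smooth_r q] assms(2)])
qed

lemma \<Omega>JD: "q \<in> \<Omega>J \<Longrightarrow> q \<in> \<Omega>" "q \<in> \<Omega>J \<Longrightarrow> r q \<in> J"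
  by (auto simp: \<Omega>J_def)

lemma delbar_F:
  fixes q :: c2
  assumes "q \<in> \<Omega>J"
  shows "delbar 1 (\<lambda>p. complex_of_real (F (r p))) q = of_real (F1 (r q)) * cnj (a (fst q)) * of_real (r q)"
    "delbar 2 (\<lambda>p. complex_of_real (F (r p))) q = of_real (F1 (r q)) * snd q * of_real (H (fst q))"
  using wd_real_r[OF assms F_deriv(1)] \<Omega>JD[OF assms] unfolding wd_def by simp_all

context
  fixes q :: c2 assumes q: "q \<in> \<Omega>J"
begin

lemmas qO = \<Omega>JD(1)[OF q] and qJ = \<Omega>JD(2)[OF q]
lemmas wd_G = wd_g[OF qO] wd_H[OF qO] wd_a[OF qO] wd_mu[OF qO] wd_snd wd_cnj[OF wd_a[OF qO]] wd_r[OF qO]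
  wd_real_r[OF q PQ_deriv(1)[OF qJ]] wd_real_r[OF q PQ_deriv(2)[OF qJ]]
  wd_real_r[OF q PQ_deriv(4)[OF qJ]] wd_real_r[OF q PQ_deriv(5)[OF qJ]]

text \<open>The summand 1 of \<open>P\<close> accounts for the pulled back base form, hence the
  subtraction in the corner entry. The rest of \<open>P\<close> arises because differentiating
  \<open>cnj a\<close> by \<open>del 1\<close> gives \<open>g\<close>.\<close>

lemma ddbar_F:
  "del k (delbar l (\<lambda>p. complex_of_real (F (r p)))) q =
     Gm q $ k $ l - (if k = 1 \<and> l = 1 then of_real (g (fst q)) else 0)"
proof -
  note F1 = wd_real_r[OF q F_deriv(2)[OF qJ]]
  have c: "wirt c x y (delbar l (\<lambda>p. complex_of_real (F (r p)))) q =
      wirt c x y (\<lambda>p. if l = 1 then of_real (F1 (r p)) * cnj (a (fst p)) * of_real (r p)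
         else of_real (F1 (r p)) * snd p * of_real (H (fst p))) q" for c x y
    using exhaust_2[of l] by (intro wirt_cong[OF open_\<Omega>J q]) (auto simp: delbar_F)
  show ?thesis using exhaust_2[of l] exhaust_2[of k]
      wd_mult[OF wd_mult[OF F1 wd_G(7)] wd_G(8)] wd_mult[OF wd_mult[OF F1 wd_snd(1)] wd_G(2)]
    unfolding del_wirt c unfolding del_wirt[symmetric]
    by (auto simp: wd_def Gm_def P_def Q_def algebra_simps r_complex)
qed

lemma Gm_simps:
  "(\<lambda>p. Gm p $ 1 $ 1) = (\<lambda>p. of_real (g (fst p)) * of_real (P (r p)) + a (fst p) * cnj (a (fst p)) * of_real (r p) * of_real (Q (r p)))"
  "(\<lambda>p. Gm p $ 1 $ 2) = (\<lambda>p. snd p * of_real (H (fst p)) * a (fst p) * of_real (Q (r p)))"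
  "(\<lambda>p. Gm p $ 2 $ 1) = (\<lambda>p. cnj (snd p) * of_real (H (fst p)) * cnj (a (fst p)) * of_real (Q (r p)))"
  "(\<lambda>p. Gm p $ 2 $ 2) = (\<lambda>p. of_real (H (fst p)) * of_real (Q (r p)))"
  by (auto simp: Gm_def)

lemmas wd_Gm = 
  wd_add[OF wd_mult[OF wd_G(1) wd_G(9)] wd_mult[OF wd_mult[OF wd_mult[OF wd_G(3) wd_G(7)] wd_G(8)] wd_G(10)]]
  wd_mult[OF wd_mult[OF wd_mult[OF wd_snd(1) wd_G(2)] wd_G(3)] wd_G(10)]
  wd_mult[OF wd_mult[OF wd_mult[OF wd_snd(2) wd_G(2)] wd_G(7)] wd_G(10)]
  wd_mult[OF wd_G(2) wd_G(10)]

lemma Gm_closed: "del j (\<lambda>p. Gm p $ k $ l) q = del k (\<lambda>p. Gm p $ j $ l) q"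
  using exhaust_2[of l] exhaust_2[of k] exhaust_2[of j] wd_Gm
  by (auto simp: Gm_simps wd_def algebra_simps r_complex)

lemma Gm_hermitian: "Gm q $ l $ k = cnj (Gm q $ k $ l)"
  using exhaust_2[of l] exhaust_2[of k] by (auto simp: Gm_def)

text \<open>Completing the square with \<open>e = a w v_1 + v_2\<close>, the value of the coframe
  element \<open>dw + a w dz\<close> on \<open>v\<close>, leaves a diagonal form with the positive
  weights \<open>g P\<close> and \<open>H Q\<close>.\<close>

lemma Gm_positive:
  assumes "v \<noteq> 0"
  shows "0 < Re (\<Sum>k\<in>UNIV. \<Sum>l\<in>UNIV. Gm q $ k $ l * v $ k * cnj (v $ l))"
proof -
  let ?z = "fst q" and ?w = "snd q"
  define e where "e = a ?z * ?w * v $ 1 + v $ 2"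
  have "(\<Sum>k\<in>UNIV. \<Sum>l\<in>UNIV. Gm q $ k $ l * v $ k * cnj (v $ l)) =
     of_real (g ?z * P (r q)) * (v $ 1 * cnj (v $ 1)) + of_real (H ?z * Q (r q)) * (e * cnj e)"
    by (simp add: sum_2 Gm_def e_def algebra_simps r_complex)
  also have "\<dots> = of_real (g ?z * P (r q) * (cmod (v $ 1))\<^sup>2 + H ?z * Q (r q) * (cmod e)\<^sup>2)"
    unfolding of_real_add of_real_mult[of _ "(cmod _)\<^sup>2"] complex_norm_square ..
  finally have *: "Re (\<Sum>k\<in>UNIV. \<Sum>l\<in>UNIV. Gm q $ k $ l * v $ k * cnj (v $ l)) =
     g ?z * P (r q) * (cmod (v $ 1))\<^sup>2 + H ?z * Q (r q) * (cmod e)\<^sup>2" by simp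
  have pos: "g ?z * P (r q) > 0" "H ?z * Q (r q) > 0"
    using g_pos H_pos P_pos Q_pos qJ fst_q[OF qO] by auto
  have "v $ 1 \<noteq> 0 \<or> e \<noteq> 0" using assms by (auto simp: e_def vec_eq_iff forall_2)
  then show ?thesis
  proof
    assume "v $ 1 \<noteq> 0"
    then show ?thesis unfolding * using pos by (intro add_pos_nonneg) simp_all
  next
    assume "e \<noteq> 0"
    then show ?thesis unfolding * using pos by (intro add_nonneg_pos) simp_all
  qed
qed

end

text \<open>The connection \<open>H\<^sup>-\<^sup>1 \<partial>H\<close> of \<open>Gm\<close>; it is verified by multiplying with \<open>Gm\<close>, so that no inverse
  has to be computed.\<close>

definition th :: "2 \<Rightarrow> c2 \<Rightarrow> complex^2^2" where
  "th k q = (\<chi> i j. if k = 1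
     then if i = 1
       then if j = 1 then mu (fst q) + 2 * a (fst q) * of_real (r q) * of_real (E (r q))
            else cnj (snd q) * of_real (H (fst q)) * of_real (E (r q))
       else if j = 1
            then snd q * (d_z a (fst q) + a (fst q) * (a (fst q) + a (fst q) * of_real (r q) * of_real (Z (r q))
                   - mu (fst q) - a (fst q) * of_real (r q) * of_real (E (r q)))
                   - a (fst q) * a (fst q) * of_real (r q) * of_real (E (r q)))
            else a (fst q) * (1 + of_real (r q) * of_real (Z (r q)) - of_real (r q) * of_real (E (r q)))
     else if i = 1
       then if j = 1 then cnj (snd q) * of_real (H (fst q)) * of_real (E (r q)) else 0
       else if j = 1 then a (fst q) * (1 + of_real (r q) * of_real (Z (r q)) - of_real (r q) * of_real (E (r q)))
            else cnj (snd q) * of_real (H (fst q)) * of_real (Z (r q)))"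

text \<open>Derivatives are local, so agreement of \<open>G\<close> with \<open>Gm\<close> on the
  open set \<open>\<Omega>J\<close> suffices. The global forms coincide with the closed formula only
  there.\<close>

lemma connection_Gm:
  fixes q :: c2
  assumes q: "q \<in> \<Omega>J" and G: "\<And>p. p \<in> \<Omega>J \<Longrightarrow> G p = Gm p"
  shows "connection G k q = th k q"
proof -
  let ?T = "transpose (Gm q)"
  note qJ = \<Omega>JD(2)[OF q]
  \<comment> \<open>Expressing \<open>Q\<close> and \<open>Q1\<close> through \<open>P\<close>,
    \<open>E\<close> and \<open>Z\<close> removes all quotients and makes the matrix identity
    polynomial.\<close>
  have QE: "of_real (Q (r q)) = (of_real (E (r q)) * of_real (P (r q)) :: complex)"
    "of_real (Q1 (r q)) = (of_real (Z (r q)) * of_real (E (r q)) * of_real (P (r q)) :: complex)"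
    using P_pos[OF qJ] Q_pos[OF qJ] by (simp_all add: E_def Z_def)
  have c: "wirt c x y (\<lambda>p. transpose (G p) $ i $ j) q = wirt c x y (\<lambda>p. Gm p $ j $ i) q" for c x y i j
    by (intro wirt_cong[OF open_\<Omega>J q]) (simp add: G transpose_def)
  have "(\<chi> i j. del k (\<lambda>p. transpose (G p) $ i $ j) q) = ?T ** th k q"
    unfolding del_wirt c unfolding del_wirt[symmetric] using exhaust_2[of k] wd_Gm[OF q]
    by (auto simp: vec_eq_iff forall_2 matrix_matrix_mult_def sum_2 Gm_simps wd_def transpose_def
        th_def Gm_def QE r_complex algebra_simps)
  moreover have "invertible ?T"
  proof -
    have "det ?T = of_real (g (fst q) * P (r q) * H (fst q) * Q (r q))"
      by (simp add: det_2 transpose_def Gm_def algebra_simps r_complex)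
    also have "\<dots> \<noteq> 0"
      using g_pos H_pos P_pos Q_pos qJ fst_q[OF \<Omega>JD(1)[OF q]] by (metis less_irrefl mult_pos_pos of_real_eq_0_iff)
    finally show ?thesis by (simp add: invertible_det_nz)
  qed
  then have "matrix_inv ?T ** ?T = mat 1"
    unfolding invertible_def matrix_inv_def by (rule someI2_ex) auto
  ultimately show ?thesis unfolding connection_def G[OF q] by (simp add: matrix_mul_assoc)
qed

text \<open>\<open>\<Theta>\<^sub>1\<^sub>2\<close> is a multiple of \<open>dz\<close>, so the second derivatives of \<open>a\<close> in the \<open>dz\<close> components of
  \<open>\<Theta>\<^sub>2\<^sub>1\<close> do not contribute.\<close>

lemma chern_Gm:
  fixes q :: c2
  assumes q: "q \<in> \<Omega>J" and G: "\<And>p. p \<in> \<Omega>J \<Longrightarrow> G b p = Gm p"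
  shows "chern2 G b q = complex_of_real (2 * g (fst q) * H (fst q) * W1 (r q) / (2 * pi)\<^sup>2)"
proof -
  note qO = \<Omega>JD(1)[OF q]
  have Th: "Theta (G b) q i j $ k $ l = - delbar l (\<lambda>p. th k p $ i $ j) q" for i j k l
    unfolding Theta_def delbar_wirt
    by (simp del: dir_simps) (rule wirt_cong[OF open_\<Omega>J q], simp add: connection_Gm[OF _ G])
  note w = wd_G[OF q]
  note mE = wd_mult[OF w(8) w(11)] and mZ = wd_mult[OF w(8) w(12)]
  note 11 = wd_add[OF w(4) wd_mult[OF wd_mult[OF wd_mult[OF wd_const[of 2] w(3)] w(8)] w(11)]]
  \<comment> \<open>This fact serves \<open>th 1 $ 1 $ 2\<close> and \<open>th 2 $ 1 $ 1\<close>,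
    and \<open>22\<close> serves \<open>th 1 $ 2 $ 2\<close> and \<open>th 2 $ 2 $ 1\<close>. These
    coincidences express that the Chern connection of a Kaehler metric is torsion-free.\<close>
  note 12 = wd_mult[OF wd_mult[OF w(6) w(2)] w(11)]
  note 22 = wd_mult[OF w(3) wd_diff[OF wd_add[OF wd_const[of 1] mZ] mE]]
  note 222 = wd_mult[OF wd_mult[OF w(6) w(2)] w(12)]
  let ?z = "fst q" and ?w = "snd q"
  let ?H = "complex_of_real (H ?z)" and ?r = "complex_of_real (r q)" and ?g = "complex_of_real (g ?z)"
    and ?E = "complex_of_real (E (r q))" and ?E1 = "complex_of_real (E1 (r q))"
    and ?Z = "complex_of_real (Z (r q))" and ?Z1 = "complex_of_real (Z1 (r q))"
  let ?R1 = "?E + ?r * ?E1" and ?V1 = "?Z + ?r * ?Z1"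
  have T11: "Theta (G b) q 1 1 $ 1 $ 1 = - (2 * ?g + 2 * ?g * ?r * ?E + 2 * a ?z * cnj (a ?z) * ?r * ?R1)"
    "Theta (G b) q 1 1 $ 1 $ 2 = - (2 * a ?z * ?w * ?H * ?R1)"
    using 11 by (simp_all add: Th th_def wd_def algebra_simps)
  have T11': "Theta (G b) q 1 1 $ 2 $ 1 = - (cnj ?w * cnj (a ?z) * ?H * ?R1)"
    "Theta (G b) q 1 1 $ 2 $ 2 = - (?H * ?R1)"
    using 12 by (simp_all add: Th th_def wd_def algebra_simps)
       (simp_all add: r_complex)
  have T12: "Theta (G b) q 1 2 $ 1 $ 1 = - (cnj ?w * cnj (a ?z) * ?H * ?R1)"
    "Theta (G b) q 1 2 $ 1 $ 2 = - (?H * ?R1)"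
    using 12 by (simp_all add: Th th_def wd_def algebra_simps)
       (simp_all add: r_complex)
  have T12': "Theta (G b) q 1 2 $ 2 $ 1 = 0" "Theta (G b) q 1 2 $ 2 $ 2 = 0"
    by (simp_all add: Th th_def delbar_wirt)
  have T22: "Theta (G b) q 2 2 $ 1 $ 1 =
      - (?g * (1 + ?r * ?Z - ?r * ?E) + a ?z * cnj (a ?z) * ?r * (?V1 - ?R1))"
    "Theta (G b) q 2 2 $ 1 $ 2 = - (a ?z * ?w * ?H * (?V1 - ?R1))"
    using 22 by (simp_all add: Th th_def wd_def algebra_simps)
  have T21: "Theta (G b) q 2 1 $ 2 $ 1 =
      - (?g * (1 + ?r * ?Z - ?r * ?E) + a ?z * cnj (a ?z) * ?r * (?V1 - ?R1))"
    "Theta (G b) q 2 1 $ 2 $ 2 = - (a ?z * ?w * ?H * (?V1 - ?R1))"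
    using 22 by (simp_all add: Th th_def wd_def algebra_simps)
  have T22': "Theta (G b) q 2 2 $ 2 $ 1 = - (cnj ?w * cnj (a ?z) * ?H * ?V1)"
    "Theta (G b) q 2 2 $ 2 $ 2 = - (?H * ?V1)"
    using 222 by (simp_all add: Th th_def wd_def algebra_simps)
       (simp_all add: r_complex)
  \<comment> \<open>All terms with \<open>a\<close> cancel, as expected: a change of frame can make
    \<open>a\<close> vanish at a given point, and \<open>c_2\<close> does not depend on the
    frame.\<close>
  have "wedge (Theta (G b) q 1 1) (Theta (G b) q 2 2) - wedge (Theta (G b) q 1 2) (Theta (G b) q 2 1) =
     2 * ?g * ?H * ((1 + ?r * ?E) * ?V1 + ?R1 * (1 + ?r * ?Z - ?r * ?E))"
    unfolding wedge_def T11 T11' T12 T12' T22 T22' T21 r_complex by (simp add: algebra_simps)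
  also have "\<dots> = complex_of_real (2 * g (fst q) * H (fst q) * W1 (r q))" by (simp add: W1_def)
  finally have "wedge (Theta (G b) q 1 1) (Theta (G b) q 2 2) - wedge (Theta (G b) q 1 2) (Theta (G b) q 2 1)
    = complex_of_real (2 * g (fst q) * H (fst q) * W1 (r q))" .
  then show ?thesis unfolding chern2_def by simp
qed

lemma wedge_Gm: "wedge (Gm q) (Gm q) = of_real (2 * g (fst q) * P (r q) * H (fst q) * Q (r q))"
  by (simp add: wedge_def Gm_def algebra_simps r_complex)

text \<open>The coefficient of the volume form is a positive real and that of \<open>c_2\<close> is
  real, so the definite description of the higher scalar curvature has exactly one solution, and
  multiplying back returns \<open>c_2\<close>.\<close>

lemma hsc_Gm:
  fixes q :: c2
  assumes q: "q \<in> \<Omega>J" and G: "\<And>p. p \<in> \<Omega>J \<Longrightarrow> G b p = Gm p"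
  shows "hsc_form G b q = chern2 G b q"
proof -
  define d where "d = 2 * g (fst q) * P (r q) * H (fst q) * Q (r q)"
  have pos: "d > 0"
    using g_pos H_pos P_pos Q_pos \<Omega>JD(2)[OF q] fst_q[OF \<Omega>JD(1)[OF q]] by (auto simp: d_def)
  obtain c where c: "chern2 G b q = complex_of_real c" using chern_Gm[of q G b, OF q G] by blast
  have w: "wedge (G b q) (G b q) = of_real d" using wedge_Gm G[OF q] by (simp add: d_def)
  have "higher_scalar_curvature G b q = 2 * (2 * pi)\<^sup>2 * c / d"
    unfolding higher_scalar_curvature_def c w of_real_mult[symmetric] of_real_eq_iff
    by (rule the_equality) (use pos in \<open>auto simp: field_simps\<close>)
  then show ?thesis
    unfolding hsc_form_def c w of_real_mult[symmetric] of_real_eq_iff using pos by simp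
qed

end

section \<open>The momentum profile\<close>

lemma bounded_of_continuous_on_Icc:
  fixes u :: "real \<Rightarrow> real"
  assumes "continuous_on {a..b} u"
  shows "\<exists>C>0. \<forall>x\<in>{a..b}. \<bar>u x\<bar> \<le> C"
proof -
  have "bounded (u ` {a..b})"
    using assms compact_continuous_image compact_imp_bounded compact_Icc by blast
  then show ?thesis unfolding bounded_pos by auto
qed

text \<open>Here \<open>\<beta>\<close> is the slope of the profile at the end
  \<open>\<gamma> = 1\<close>, that is, at the zero divisor.\<close>

locale profile =
  fixes f \<phi> :: "real \<Rightarrow> real" and m \<beta> :: real
  assumes m_pos: "m > 0" and \<beta>_pos: "\<beta> > 0"
    and f_smooth: "smooth_on UNIV f"
    and f_convex: "strictly_convex f"
    and f_lims: "(deriv f \<longlongrightarrow> 0) at_bot" "(deriv f \<longlongrightarrow> m) at_top"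
    and profile_eq: "\<And>s. \<phi> (1 + deriv f s) = deriv (deriv f) s"
    and profile_smooth: "smooth_on_interval 1 (m + 1) \<phi>"
    and profile_pos: "\<And>\<gamma>. \<gamma> \<in> {1<..<m + 1} \<Longrightarrow> \<phi> \<gamma> > 0"
    and profile_1: "\<phi> 1 = 0"
    and profile_deriv_1: "(\<phi> has_real_derivative \<beta>) (at 1 within {1..m + 1})"
begin

text \<open>With \<open>\<gamma> = 1 + t 0 s\<close> the momentum, \<open>t 1 s = \<phi> \<gamma>\<close>, and the higher \<open>t n s\<close> are multiples of
  \<open>\<phi> \<gamma>\<close> by smooth functions of \<open>\<gamma>\<close>.\<close>

definition t :: "nat \<Rightarrow> real \<Rightarrow> real" where "t n = (deriv ^^ Suc n) f"

lemma smooth_t: "smooth_on UNIV (t n)"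
proof -
  have "smooth_on UNIV ((deriv ^^ k) f)" for k
    by (induction k) (auto intro: f_smooth smooth_on_deriv)
  then show ?thesis by (simp add: t_def del: funpow.simps)
qed

lemma t_deriv: "(t n has_real_derivative t (Suc n) x) (at x)"
  using smooth_on_has_deriv[OF smooth_t] by (simp add: t_def)

lemma f_deriv: "(f has_real_derivative t 0 x) (at x)"
  using smooth_on_has_deriv[OF f_smooth] by (simp add: t_def)

lemma t_cont: "isCont (t n) x"
  using t_deriv DERIV_isCont by blast

lemma t1_eq: "t 1 s = \<phi> (1 + t 0 s)"
  using profile_eq by (simp add: t_def)

text \<open>The tangents at \<open>x\<close> and \<open>y\<close> give weak monotonicity. Strictness
  comes from the midpoint, where the strict convexity inequality is combined with the tangent at
  \<open>x\<close>.\<close>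

lemma t0_less:
  assumes "x < y"
  shows "t 0 x < t 0 y"
proof -
  have "convex_on UNIV f"
  proof (rule convex_onI)
    fix s :: real and x y assume "0 < s" "s < 1"
    then show "f ((1 - s) *\<^sub>R x + s *\<^sub>R y) \<le> (1 - s) * f x + s * f y"
    proof (cases "x = y")
      case True
      have "(1 - s) * y + s * y = y" "(1 - s) * f y + s * f y = f y" by (simp_all add: algebra_simps)
      then show ?thesis using True by simp
    next
      case False
      then show ?thesis
        using f_convex[unfolded strictly_convex_def, rule_format, of x y s] \<open>0 < s\<close> \<open>s < 1\<close> by simp
    qed
  qed simp
  then have tan: "f b - f a \<ge> t 0 a * (b - a)" for a b
    using convex_on_imp_above_tangent[of UNIV f a b] f_deriv by simp
  have half: "f ((x + y) / 2) < (f x + f y) / 2"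
    using f_convex[unfolded strictly_convex_def, rule_format, of x y "1 / 2"] assms
    by (simp add: field_simps)
  have "t 0 x * (y - x) \<le> f y - f x" "f y - f x \<le> t 0 y * (y - x)"
    using tan[of x y] tan[of y x] by (simp_all add: algebra_simps)
  moreover have "t 0 x * ((y - x) / 2) \<le> f ((x + y) / 2) - f x"
    using tan[of x "(x + y) / 2"] by (simp add: field_simps)
  ultimately have "t 0 x * (y - x) < f y - f x" using half by (simp add: field_simps)
  with \<open>f y - f x \<le> t 0 y * (y - x)\<close> have "t 0 x * (y - x) < t 0 y * (y - x)" by simp
  then show ?thesis using assms by simp
qed

lemma t0_range: "0 < t 0 s" "t 0 s < m"
proof -
  have l: "(t 0 \<longlongrightarrow> 0) at_bot" "(t 0 \<longlongrightarrow> m) at_top"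
    using f_lims by (simp_all add: t_def)
  have "0 \<le> t 0 s" for s by (rule tendsto_upperbound[OF l(1)])
       (auto intro!: eventually_mono[OF eventually_le_at_bot[of s]] simp: le_less t0_less)
  from this[of "s - 1"] t0_less[of "s - 1" s] show "0 < t 0 s" by simp
  have "t 0 s \<le> m" for s by (rule tendsto_lowerbound[OF l(2)])
       (auto intro!: eventually_mono[OF eventually_ge_at_top[of s]] simp: le_less t0_less)
  from this[of "s + 1"] t0_less[of s "s + 1"] show "t 0 s < m" by simp
qed

text \<open>Strict convexity alone would allow zeros of \<open>f''\<close>; positivity comes from
  the profile, because the momentum stays in the open interval.\<close>

lemma t1_pos: "t 1 s > 0"
  unfolding t1_eq using profile_pos t0_range by simp

text \<open>One fixed sequence of derivatives of \<open>\<phi>\<close>, one-sided at the end points;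
  \<open>deriv\<close> would not be meaningful at 1, where the limits are taken.\<close>

definition d :: "nat \<Rightarrow> real \<Rightarrow> real" where
  "d = (SOME d. d 0 = \<phi> \<and>
     (\<forall>n. \<forall>x\<in>{1..m + 1}. (d n has_real_derivative d (Suc n) x) (at x within {1..m + 1})))"

lemma d_0: "d 0 = \<phi>"
  and d_deriv: "x \<in> {1..m + 1} \<Longrightarrow> (d n has_real_derivative d (Suc n) x) (at x within {1..m + 1})"
  using someI_ex[OF profile_smooth[unfolded smooth_on_interval_def]] unfolding d_def[symmetric]
  by blast+

lemma d_cont: "continuous_on {1..m + 1} (d n)"
  using d_deriv DERIV_continuous_on by blast

lemma d_1: "d 1 1 = \<beta>"
proof -
  have "at (1::real) within {1..m + 1} \<noteq> bot"
    using m_pos by (simp add: at_within_Icc_at_right)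
  then show ?thesis using d_deriv[of 1 0] profile_deriv_1 m_pos unfolding d_0
    by (auto simp: has_field_derivative_iff intro: tendsto_unique)
qed

text \<open>The momentum lies in the interior of the interval, so the derivative within the interval
  is an ordinary derivative and the chain rule applies.\<close>

lemma d_t_deriv: "((\<lambda>y. d n (1 + t 0 y)) has_real_derivative d (Suc n) (1 + t 0 y) * t 1 y) (at y)"
proof -
  have "1 + t 0 y \<in> interior {1..m + 1}" using t0_range[of y] by (simp add: interior_atLeastAtMost_real)
  then have "(d n has_real_derivative d (Suc n) (1 + t 0 y)) (at (1 + t 0 y))"
    using d_deriv[of "1 + t 0 y" n] at_within_interior interior_subset by (metis subsetD)
  moreover have "((\<lambda>y. 1 + t 0 y) has_real_derivative t 1 y) (at y)"
    using t_deriv[of 0 y] by (auto intro!: derivative_eq_intros)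
  ultimately show ?thesis by (rule DERIV_chain2)
qed

lemma t_eqs:
  "t 2 y = d 1 (1 + t 0 y) * t 1 y"
  "t 3 y = (d 2 (1 + t 0 y) * t 1 y + d 1 (1 + t 0 y) * d 1 (1 + t 0 y)) * t 1 y"
proof -
  have 1: "t 1 = (\<lambda>y. d 0 (1 + t 0 y))" using t1_eq by (auto simp: d_0)
  have t2: "t 2 y = d 1 (1 + t 0 y) * t 1 y" for y
  proof -
    have "(t 1 has_real_derivative d 1 (1 + t 0 y) * t 1 y) (at y)"
      by (subst 1) (use d_t_deriv[of 0 y] in simp)
    from DERIV_unique[OF t_deriv[of 1 y] this] show ?thesis by (simp add: numeral_2_eq_2)
  qed
  then show "t 2 y = d 1 (1 + t 0 y) * t 1 y" .
  have "t 2 = (\<lambda>y. d 1 (1 + t 0 y) * t 1 y)" using t2 by auto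
  moreover have "((\<lambda>y. d 1 (1 + t 0 y) * t 1 y) has_real_derivative
      d 2 (1 + t 0 y) * t 1 y * t 1 y + t 2 y * d 1 (1 + t 0 y)) (at y)"
    using DERIV_mult[OF d_t_deriv[of 1 y] t_deriv[of 1 y]] by (simp add: numeral_2_eq_2)
  ultimately have "t 3 y = d 2 (1 + t 0 y) * t 1 y * t 1 y + t 2 y * d 1 (1 + t 0 y)"
    using DERIV_unique[OF t_deriv[of 2 y]] by (simp add: numeral_3_eq_3 numeral_2_eq_2)
  then show "t 3 y = (d 2 (1 + t 0 y) * t 1 y + d 1 (1 + t 0 y) * d 1 (1 + t 0 y)) * t 1 y"
    using t2 by (simp add: algebra_simps)
qed

lemma d_bound: "\<exists>C>0. \<forall>y. \<bar>d n (1 + t 0 y)\<bar> \<le> C"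
proof -
  obtain C where "C > 0" "\<forall>x\<in>{1..m+1}. \<bar>d n x\<bar> \<le> C"
    using bounded_of_continuous_on_Icc[OF d_cont] by blast
  then show ?thesis using t0_range by (intro exI[of _ C]) (auto simp: less_imp_le)
qed

text \<open>All the \<open>t n\<close> are comparable with \<open>t 0 = \<gamma> - 1\<close> near the zero divisor because \<open>\<phi>\<close> has a simple
  zero at \<open>1\<close>; this is where \<open>\<beta> > 0\<close> is needed.\<close>

lemma t_bounds: "\<exists>C\<ge>1. \<forall>y\<le>y0. t 0 y \<le> C * t 1 y \<and> t 1 y \<le> C * t 0 y \<and> \<bar>t 2 y\<bar> \<le> C * t 0 y \<and> \<bar>t 3 y\<bar> \<le> C * t 0 y"
proof -
  \<comment> \<open>The cut-off \<open>y \<le> y0\<close> confines \<open>\<gamma>\<close> to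
    \<open>{1..1 + b}\<close>. Because \<open>b < m\<close>, positivity of \<open>\<phi>\<close> is
    available up to and including the right end point.\<close>
  define b where "b = t 0 y0"
  have b: "0 < b" "b < m" using t0_range by (auto simp: b_def)
  \<comment> \<open>The quotient \<open>\<phi> \<gamma> / (\<gamma> - 1)\<close> extends
    continuously by the slope \<open>\<beta> > 0\<close>. As a positive continuous function on a
    compact interval it is bounded above and away from 0, which gives both comparisons of
    \<open>t 0\<close> and \<open>t 1\<close>.\<close>
  define q where "q \<gamma> = (if \<gamma> = 1 then \<beta> else \<phi> \<gamma> / (\<gamma> - 1))" for \<gamma>
  have "continuous_on {1..1+b} q" unfolding continuous_on_def
  proof
    fix x assume x: "x \<in> {1..1 + b}"
    show "(q \<longlongrightarrow> q x) (at x within {1..1+b})"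
    proof (cases "x = 1")
      case True
      have "((\<lambda>y. (\<phi> y - \<phi> 1) / (y - 1)) \<longlongrightarrow> \<beta>) (at 1 within {1..m+1})"
        using profile_deriv_1 by (simp add: has_field_derivative_iff)
      then have "((\<lambda>y. (\<phi> y - \<phi> 1) / (y - 1)) \<longlongrightarrow> \<beta>) (at 1 within {1..1+b})"
        by (rule tendsto_within_subset) (use b in auto)
      then have "(q \<longlongrightarrow> \<beta>) (at 1 within {1..1+b})"
        by (rule Lim_transform_within[of _ _ _ _ 1]) (auto simp: q_def profile_1)
      then show ?thesis by (simp add: True q_def)
    next
      case False
      have "(\<phi> \<longlongrightarrow> \<phi> x) (at x within {1..m+1})"
        using d_cont[of 0] x b unfolding d_0 continuous_on_def by simp
      then have c: "(\<phi> \<longlongrightarrow> \<phi> x) (at x within {1..1+b})"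
        by (rule tendsto_within_subset) (use b in auto)
      have "((\<lambda>y. \<phi> y / (y - 1)) \<longlongrightarrow> \<phi> x / (x - 1)) (at x within {1..1+b})"
        by (intro tendsto_intros c) (use False in auto)
      moreover have "eventually (\<lambda>y. \<phi> y / (y - 1) = q y) (at x within {1..1+b})"
      proof -
        have "eventually (\<lambda>y. y \<noteq> 1) (at x within {1..1+b})"
          by (rule eventually_neq_at_within)
        then show ?thesis by eventually_elim (simp add: q_def)
      qed
      ultimately show ?thesis using False tendsto_cong by (fastforce simp: q_def)
    qed
  qed
  moreover have qpos: "q x > 0" if "x \<in> {1..1+b}" for x
    using that \<beta>_pos profile_pos[of x] b by (auto simp: q_def)
  ultimately have ic: "continuous_on {1..1+b} (\<lambda>x. inverse (q x))" "continuous_on {1..1+b} q"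
    by (auto intro!: continuous_intros simp: less_imp_neq[symmetric] dest: qpos)
  obtain C1 where C1: "C1 > 0" "\<forall>x\<in>{1..1+b}. \<bar>q x\<bar> \<le> C1"
    using bounded_of_continuous_on_Icc[OF ic(2)] by blast
  obtain C2 where C2: "C2 > 0" "\<forall>x\<in>{1..1+b}. \<bar>inverse (q x)\<bar> \<le> C2"
    using bounded_of_continuous_on_Icc[OF ic(1)] by blast
  obtain D0 where D0: "D0 > 0" "\<forall>y. \<bar>t 1 y\<bar> \<le> D0"
    using d_bound[of 0] by (auto simp: d_0 simp flip: t1_eq)
  obtain D1 where D1: "D1 > 0" "\<forall>y. \<bar>d 1 (1 + t 0 y)\<bar> \<le> D1" using d_bound by blast
  obtain D2 where D2: "D2 > 0" "\<forall>y. \<bar>d 2 (1 + t 0 y)\<bar> \<le> D2" using d_bound by blast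
  define C where "C = 1 + C1 + C2 + D1 * C1 + (D2 * D0 + D1 * D1) * C1"
  have Cge: "1 \<le> C" "C1 \<le> C" "C2 \<le> C" "D1 * C1 \<le> C" "(D2 * D0 + D1 * D1) * C1 \<le> C"
    using C1 C2 D0 D1 D2 by (simp_all add: C_def)
  show ?thesis
  proof (intro exI conjI allI impI)
    show "C \<ge> 1" by fact
    fix y assume y: "y \<le> y0"
    have ty: "0 < t 0 y" "t 0 y \<le> b"
      using t0_range y t0_less[of y y0] by (auto simp: b_def le_less)
    have qy: "t 1 y = q (1 + t 0 y) * t 0 y" using ty by (simp add: q_def t1_eq[unfolded One_nat_def])
    have in1: "1 + t 0 y \<in> {1..1+b}" using ty by auto
    have "q (1 + t 0 y) \<le> C1" using order_trans[OF abs_ge_self C1(2)[rule_format, OF in1]] .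
    then have a1: "t 1 y \<le> C1 * t 0 y" unfolding qy using ty by simp
    also have "\<dots> \<le> C * t 0 y" using Cge ty by simp
    finally show "t 1 y \<le> C * t 0 y" .
    have "inverse (q (1 + t 0 y)) \<le> C2" 
      using order_trans[OF abs_ge_self C2(2)[rule_format, OF in1]] .
    then have "t 0 y \<le> C2 * t 1 y" unfolding qy using ty qpos[OF in1] by (simp add: field_simps)
    also have "\<dots> \<le> C * t 1 y" using Cge t1_pos[of y] by simp
    finally show "t 0 y \<le> C * t 1 y" .
    have "\<bar>t 2 y\<bar> \<le> D1 * t 1 y"
      unfolding t_eqs abs_mult using D1 t1_pos[of y] by (intro mult_mono) auto
    also have "\<dots> \<le> D1 * (C1 * t 0 y)" using a1 D1 by simp
    also have "\<dots> \<le> C * t 0 y" using Cge ty by (simp flip: mult.assoc)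
    finally show "\<bar>t 2 y\<bar> \<le> C * t 0 y" .
    have "\<bar>d 2 (1 + t 0 y) * t 1 y + d 1 (1 + t 0 y) * d 1 (1 + t 0 y)\<bar> \<le> D2 * D0 + D1 * D1"
      using D0 D1 D2 by (intro order_trans[OF abs_triangle_ineq] add_mono; unfold abs_mult)
         (intro mult_mono; simp add: less_imp_le)+
    then have "\<bar>t 3 y\<bar> \<le> (D2 * D0 + D1 * D1) * t 1 y"
      unfolding t_eqs(2) abs_mult using t1_pos[of y] by (intro mult_mono) auto
    also have "\<dots> \<le> (D2 * D0 + D1 * D1) * (C1 * t 0 y)" using a1 D0 D1 D2 by (intro mult_left_mono) auto
    also have "\<dots> \<le> C * t 0 y" using Cge ty by (simp flip: mult.assoc)
    finally show "\<bar>t 3 y\<bar> \<le> C * t 0 y" .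
  qed
qed

subsection \<open>The regularized potentials\<close>

text \<open>\<open>F0\<close> is the potential as a function of \<open>x = e\<^sup>s\<close>, followed by its derivatives; replacing \<open>\<omega>\<close> by
  \<open>\<omega>\<^sub>\<epsilon>\<close> amounts to the shift \<open>F0 (x + \<delta>)\<close> with \<open>\<delta> = \<epsilon>\<^sup>2\<close>.\<close>

definition F0 :: "real \<Rightarrow> real" where "F0 x = f (ln x)"
definition F1 :: "real \<Rightarrow> real" where "F1 x = t 0 (ln x) / x"
definition F2 :: "real \<Rightarrow> real" where "F2 x = (t 1 (ln x) - t 0 (ln x)) / x ^ 2"
definition F3 :: "real \<Rightarrow> real" where "F3 x = (t 2 (ln x) - 3 * t 1 (ln x) + 2 * t 0 (ln x)) / x ^ 3"
definition F4 :: "real \<Rightarrow> real" where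
  "F4 x = (t 3 (ln x) - 6 * t 2 (ln x) + 11 * t 1 (ln x) - 6 * t 0 (ln x)) / x ^ 4"

text \<open>With \<open>D = x d/dx\<close> one has
  \<open>x^n (d/dx)^n = D (D - 1) ... (D - n + 1)\<close>, so the coefficients in \<open>F1\<close>
  to \<open>F4\<close> are signed Stirling numbers of the first kind.\<close>

lemma F_derivs:
  assumes "x > 0"
  shows "(F0 has_real_derivative F1 x) (at x)" "(F1 has_real_derivative F2 x) (at x)"
    "(F2 has_real_derivative F3 x) (at x)" "(F3 has_real_derivative F4 x) (at x)"
proof -
  have ln: "(ln has_real_derivative 1 / x) (at x)"
    using assms by (auto intro!: derivative_eq_intros)
  have tl: "((\<lambda>x. t n (ln x)) has_real_derivative t (Suc n) (ln x) * (1 / x)) (at x)" for n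
    using DERIV_chain2[OF t_deriv ln] .
  note tl' = tl[of 0, simplified] tl[of 1, simplified] tl[of 2, simplified]
  have 3: "Suc 2 = 3" "Suc (Suc 0) = 2" by simp_all
  show "(F0 has_real_derivative F1 x) (at x)"
    unfolding F0_def[abs_def] F1_def using DERIV_chain2[OF f_deriv ln] by simp
  \<comment> \<open>This is one factor \<open>D - n\<close> of that product.\<close>
  have quot: "((\<lambda>x. u x / x ^ n) has_real_derivative (v - n * u x) / x ^ Suc n) (at x)"
    if "(u has_real_derivative v * (1 / x)) (at x)" for u v n
  proof -
    have "((\<lambda>x. u x * inverse x ^ n) has_real_derivative
        v * (1 / x) * inverse x ^ n + (n * inverse x ^ (n - 1) * - (inverse x * inverse x)) * u x) (at x)"
      using assms that by (auto intro!: derivative_eq_intros simp: power2_eq_square)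
    moreover have "v * (1 / x) * inverse x ^ n + (n * inverse x ^ (n - 1) * - (inverse x * inverse x)) * u x
        = (v - n * u x) / x ^ Suc n" using assms by (cases n) (simp_all add: field_simps)
    ultimately show ?thesis by (simp add: divide_inverse power_inverse)
  qed
  have u2: "((\<lambda>x. t 1 (ln x) - t 0 (ln x)) has_real_derivative (t 2 (ln x) - t 1 (ln x)) * (1 / x)) (at x)"
    using DERIV_diff[OF tl' (2,1)] by (simp add: 3 left_diff_distrib diff_divide_distrib)
  have u3: "((\<lambda>x. t 2 (ln x) - 3 * t 1 (ln x) + 2 * t 0 (ln x)) has_real_derivative
      (t 3 (ln x) - 3 * t 2 (ln x) + 2 * t 1 (ln x)) * (1 / x)) (at x)"
    using DERIV_add[OF DERIV_diff[OF tl'(3) DERIV_cmult[OF tl'(2), of 3]] DERIV_cmult[OF tl'(1), of 2]]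
    by (simp add: 3 algebra_simps add_divide_distrib diff_divide_distrib)
  show "(F1 has_real_derivative F2 x) (at x)"
    unfolding F1_def[abs_def] F2_def using quot[of "\<lambda>x. t 0 (ln x)" "t 1 (ln x)" 1] tl[of 0]
    by (simp add: power2_eq_square)
  show "(F2 has_real_derivative F3 x) (at x)"
    unfolding F2_def[abs_def] F3_def using quot[OF u2, of 2]
    by (simp add: algebra_simps numeral_3_eq_3)
  show "(F3 has_real_derivative F4 x) (at x)"
    unfolding F3_def[abs_def] F4_def using quot[OF u3, of 3]
    by (simp add: algebra_simps eval_nat_numeral)
qed

text \<open>An open set of \<open>x\<close>, also containing \<open>x = 0\<close> when \<open>\<delta> > 0\<close>, on which \<open>F0 (x + \<delta>)\<close> is the potential
  of a metric.\<close>

definition Jd :: "real \<Rightarrow> real set" where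
  "Jd \<delta> = {x. x + \<delta> > 0 \<and> 1 + x * F1 (x + \<delta>) > 0 \<and> F1 (x + \<delta>) + x * F2 (x + \<delta>) > 0}"

text \<open>Multiplied by \<open>x + \<delta>\<close>, the fibre coefficient is a convex combination
  of the positive quantities \<open>t 0\<close> and \<open>t 1\<close> with weight
  \<open>x / (x + \<delta>)\<close>. On the zero section only \<open>t 0\<close> remains, for
  \<open>\<delta> = 0\<close> only \<open>t 1\<close>.\<close>

lemma F_pos:
  assumes "\<delta> \<ge> 0" "x \<ge> 0" "x + \<delta> > 0"
  shows "x * F1 (x + \<delta>) \<ge> 0" "F1 (x + \<delta>) + x * F2 (x + \<delta>) > 0"
    "(x + \<delta>) * (F1 (x + \<delta>) + x * F2 (x + \<delta>)) =
       (1 - x / (x + \<delta>)) * t 0 (ln (x + \<delta>)) + x / (x + \<delta>) * t 1 (ln (x + \<delta>))"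
proof -
  let ?y = "ln (x + \<delta>)"
  show "x * F1 (x + \<delta>) \<ge> 0" using assms t0_range(1)[of ?y] by (simp add: F1_def)
  show *: "(x + \<delta>) * (F1 (x + \<delta>) + x * F2 (x + \<delta>)) = (1 - x / (x + \<delta>)) * t 0 ?y + x / (x + \<delta>) * t 1 ?y"
  proof -
    have "\<rho> * (A / \<rho> + x * ((B - A) / \<rho> ^ 2)) = (1 - x / \<rho>) * A + x / \<rho> * B" if "\<rho> > 0" for \<rho> A B :: real
      using that by (simp add: field_simps power2_eq_square)
    then show ?thesis using assms(3) unfolding F1_def F2_def by blast
  qed
  have "\<dots> > 0"
  proof (cases "x = 0")
    case False
    then have "x / (x + \<delta>) * t 1 ?y > 0" using assms t1_pos[of ?y] by simp
    moreover have "(1 - x / (x + \<delta>)) * t 0 ?y \<ge> 0" using assms t0_range(1)[of ?y] by (simp add: field_simps)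
    ultimately show ?thesis by simp
  qed (use t0_range in simp)
  then show "F1 (x + \<delta>) + x * F2 (x + \<delta>) > 0"
    using assms(3) unfolding *[symmetric] by (simp add: zero_less_mult_iff)
qed

lemma mem_Jd: "\<delta> \<ge> 0 \<Longrightarrow> x \<ge> 0 \<Longrightarrow> x + \<delta> > 0 \<Longrightarrow> x \<in> Jd \<delta>"
  using F_pos by (fastforce simp: Jd_def)

lemma smooth_F: "smooth_on {0<..} F1" "smooth_on {0<..} F2" "smooth_on {0<..} F3" "smooth_on {0<..} F4"
proof -
  have l: "smooth_on {0<..} (\<lambda>x. t n (ln x))" for n
    by (rule smooth_on_real_comp[OF _ _ _ smooth_t smooth_on_ln]) auto
  show "smooth_on {0<..} F1" "smooth_on {0<..} F2" "smooth_on {0<..} F3" "smooth_on {0<..} F4"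
    unfolding F1_def[abs_def] F2_def[abs_def] F3_def[abs_def] F4_def[abs_def]
    by (intro smooth_on_divide smooth_on_add smooth_on_diff smooth_on_mult smooth_on_const l
        smooth_on_power smooth_on_bounded_linear bounded_linear_ident; simp)+
qed

text \<open>The parameter may vary with the point: a constant \<open>v\<close> gives openness of
  \<open>Jd \<delta>\<close>, a constant \<open>u\<close> openness in \<open>\<delta>\<close>, and
  two coordinates openness in both variables jointly.\<close>

lemma open_Jd_preimage:
  fixes u v :: "'v::real_normed_vector \<Rightarrow> real"
  assumes X: "open X" and u: "continuous_on X u" and v: "continuous_on X v"
  shows "open {p \<in> X. u p \<in> Jd (v p)}"
proof -
  have c: "continuous_on {0<..} F1" "continuous_on {0<..} F2"
    using smooth_F smooth_on_imp_continuous_on by blast+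
  define Y where "Y = X \<inter> (\<lambda>p. u p + v p) -` {0<..}"
  have Y: "open Y" unfolding Y_def
    by (rule continuous_open_preimage) (auto intro!: continuous_intros X u v)
  have uY: "continuous_on Y u" "continuous_on Y v"
    using u v continuous_on_subset[of X _ Y] by (auto simp: Y_def)
  have FY: "continuous_on Y (\<lambda>p. F1 (u p + v p))" "continuous_on Y (\<lambda>p. F2 (u p + v p))"
    by (rule continuous_on_compose2[OF c(1)], auto intro!: continuous_intros uY, simp add: Y_def)
       (rule continuous_on_compose2[OF c(2)], auto intro!: continuous_intros uY, simp add: Y_def)
  have "open (Y \<inter> (\<lambda>p. 1 + u p * F1 (u p + v p)) -` {0<..} \<inter>
     (Y \<inter> (\<lambda>p. F1 (u p + v p) + u p * F2 (u p + v p)) -` {0<..}))"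
    by (intro open_Int continuous_open_preimage continuous_intros Y uY FY open_greaterThan)
  moreover have "{p \<in> X. u p \<in> Jd (v p)} = Y \<inter> (\<lambda>p. 1 + u p * F1 (u p + v p)) -` {0<..} \<inter>
     (Y \<inter> (\<lambda>p. F1 (u p + v p) + u p * F2 (u p + v p)) -` {0<..})"
    by (auto simp: Y_def Jd_def)
  ultimately show ?thesis by simp
qed

lemma potential_Jd:
  "potential (Jd \<delta>) (\<lambda>x. F0 (x + \<delta>)) (\<lambda>x. F1 (x + \<delta>)) (\<lambda>x. F2 (x + \<delta>)) (\<lambda>x. F3 (x + \<delta>)) (\<lambda>x. F4 (x + \<delta>))"
proof
  show "open (Jd \<delta>)"
    using open_Jd_preimage[of UNIV "\<lambda>x. x" "\<lambda>_. \<delta>"] by simp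
  fix x assume "x \<in> Jd \<delta>"
  then have x: "x + \<delta> > 0" and "1 + x * F1 (x + \<delta>) > 0" "F1 (x + \<delta>) + x * F2 (x + \<delta>) > 0"
    by (auto simp: Jd_def)
  then show "1 + x * F1 (x + \<delta>) > 0" "F1 (x + \<delta>) + x * F2 (x + \<delta>) > 0" by auto
  show "((\<lambda>x. F0 (x + \<delta>)) has_real_derivative F1 (x + \<delta>)) (at x)"
    "((\<lambda>x. F1 (x + \<delta>)) has_real_derivative F2 (x + \<delta>)) (at x)"
    "((\<lambda>x. F2 (x + \<delta>)) has_real_derivative F3 (x + \<delta>)) (at x)"
    "((\<lambda>x. F3 (x + \<delta>)) has_real_derivative F4 (x + \<delta>)) (at x)"
    using F_derivs[OF x] unfolding DERIV_shift by simp_all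
qed

interpretation pot: potential "Jd \<delta>" "\<lambda>x. F0 (x + \<delta>)" "\<lambda>x. F1 (x + \<delta>)" "\<lambda>x. F2 (x + \<delta>)"
    "\<lambda>x. F3 (x + \<delta>)" "\<lambda>x. F4 (x + \<delta>)" for \<delta>
  by (rule potential_Jd)

section \<open>The function W of the regularized potentials and its limits\<close>

definition W1 :: "real \<Rightarrow> real \<Rightarrow> real" where "W1 \<delta> = pot.W1 \<delta>"
definition W :: "real \<Rightarrow> real \<Rightarrow> real" where
  "W \<delta> x = (1 + x * pot.E \<delta> x) * (1 + x * pot.Z \<delta> x) - (x * pot.E \<delta> x)\<^sup>2 / 2"

lemma W_deriv: "x \<in> Jd \<delta> \<Longrightarrow> (W \<delta> has_real_derivative W1 \<delta> x) (at x)"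
  unfolding W_def[abs_def] W1_def by (rule pot.W_deriv)

text \<open>Both functions are rational in \<open>u\<close> and the \<open>F1\<close> to
  \<open>F4\<close> at \<open>u + v\<close>; the only denominators are powers of \<open>P\<close>
  and \<open>Q\<close>, which do not vanish on \<open>Jd\<close>. Having \<open>v\<close> as a
  function makes the parameter one of the smooth variables.\<close>

lemma smooth_W:
  fixes u v :: "'v::real_normed_vector \<Rightarrow> real"
  assumes X: "open X" and u: "smooth_on X u" and v: "smooth_on X v"
    and J: "\<And>p. p \<in> X \<Longrightarrow> u p \<in> Jd (v p)"
  shows "smooth_on X (\<lambda>p. W1 (v p) (u p))" "smooth_on X (\<lambda>p. W (v p) (u p))"
proof -
  have F: "smooth_on X (\<lambda>p. k (u p + v p))" if "smooth_on {0<..} k" for k :: "real \<Rightarrow> real"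
    by (rule smooth_on_real_comp[OF X _ _ that smooth_on_add[OF X u v]]) (use J in \<open>auto simp: Jd_def\<close>)
  note F' = F[OF smooth_F(1)] F[OF smooth_F(2)] F[OF smooth_F(3)] F[OF smooth_F(4)]
  have nz: "1 + u p * F1 (u p + v p) \<noteq> 0" "F1 (u p + v p) + u p * F2 (u p + v p) \<noteq> 0" if "p \<in> X" for p
    using J[OF that] by (auto simp: Jd_def)
  show "smooth_on X (\<lambda>p. W1 (v p) (u p))" "smooth_on X (\<lambda>p. W (v p) (u p))"
    unfolding W1_def W_def pot.W1_def pot.E_def pot.Z_def pot.E1_def pot.Z1_def pot.P_def pot.Q_def
      pot.Q1_def pot.Q2_def
    by (intro smooth_on_divide smooth_on_add smooth_on_diff smooth_on_mult smooth_on_const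
        smooth_on_power F' u X nz; simp)+
qed

lemma W1_isCont: "x \<in> Jd \<delta> \<Longrightarrow> isCont (W1 \<delta>) x"
  using smooth_on_imp_continuous_on[OF smooth_W(1)[of "Jd \<delta>" "\<lambda>x. x" "\<lambda>_. \<delta>"]] pot.open_J
  by (auto simp: smooth_on_bounded_linear continuous_on_eq_continuous_at)

text \<open>For fixed \<open>x > 0\<close> the admissible parameters form an open set containing 0,
  so the one-sided limit is plain continuity at \<open>\<delta> = 0\<close>.\<close>

lemma W_tendsto:
  assumes "x > 0"
  shows "((\<lambda>\<delta>. W \<delta> x) \<longlongrightarrow> W 0 x) (at_right 0)" "((\<lambda>\<delta>. W1 \<delta> x) \<longlongrightarrow> W1 0 x) (at_right 0)"
proof -
  have o: "open {\<delta>. x \<in> Jd \<delta>}"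
    using open_Jd_preimage[of UNIV "\<lambda>_. x" "\<lambda>\<delta>. \<delta>"] by simp
  have "0 \<in> {\<delta>. x \<in> Jd \<delta>}" using assms mem_Jd by simp
  moreover have "continuous_on {\<delta>. x \<in> Jd \<delta>} (\<lambda>\<delta>. W \<delta> x)" "continuous_on {\<delta>. x \<in> Jd \<delta>} (\<lambda>\<delta>. W1 \<delta> x)"
    by (rule smooth_on_imp_continuous_on, rule smooth_W[OF o]; auto intro: smooth_on_bounded_linear o)+
  ultimately have "isCont (\<lambda>\<delta>. W \<delta> x) 0" "isCont (\<lambda>\<delta>. W1 \<delta> x) 0"
    using o by (auto simp: continuous_on_eq_continuous_at)
  then show "((\<lambda>\<delta>. W \<delta> x) \<longlongrightarrow> W 0 x) (at_right 0)" "((\<lambda>\<delta>. W1 \<delta> x) \<longlongrightarrow> W1 0 x) (at_right 0)"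
    unfolding isCont_def by (auto intro: tendsto_mono at_le)
qed

text \<open>Under \<open>x = \<sigma> \<rho>\<close>, \<open>\<rho> = x + \<delta>\<close>, \<open>0 \<le> \<sigma> \<le> 1\<close>, every quantity is a polynomial in \<open>\<sigma>\<close> and the
  \<open>t n (ln \<rho>)\<close>, divided by a power of \<open>\<rho>\<close>; hence the uniformity in \<open>\<delta>\<close>.\<close>

lemma W1_bound: "\<exists>C>0. \<forall>\<delta>\<in>{0..1}. \<forall>x\<in>{0<..x0}. \<bar>W1 \<delta> x\<bar> \<le> C / x"
proof -
  obtain C where C: "C \<ge> 1"
    and tb: "\<And>y. y \<le> ln (x0 + 1) \<Longrightarrow> t 0 y \<le> C * t 1 y \<and> t 1 y \<le> C * t 0 y \<and>
      \<bar>t 2 y\<bar> \<le> C * t 0 y \<and> \<bar>t 3 y\<bar> \<le> C * t 0 y"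
    using t_bounds[of "ln (x0 + 1)"] by blast
  \<comment> \<open>\<open>K0\<close> bounds \<open>x Q\<close>, while \<open>K1\<close> and
    \<open>K2\<close> bound \<open>x \<bar>Q1\<bar> / Q\<close> and
    \<open>x^2 \<bar>Q2\<bar> / Q\<close>. Their inner sums add the absolute values of the
    coefficients of the \<open>t n\<close>, each weighted by \<open>C\<close> for
    \<open>n > 0\<close>; the last factor \<open>C\<close> converts \<open>t 0\<close> into
    \<open>\<rho> Q\<close>. \<open>B\<close> estimates \<open>x W1\<close> term by term.\<close>
  define K0 where "K0 = C * m"
  define K1 where "K1 = (2 * (1 + C) + (C + 3 * C + 2)) * C"
  define K2 where "K2 = (3 * (C + 3 * C + 2) + (C + 6 * C + 11 * C + 6)) * C"
  have Kpos: "K0 > 0" "K1 > 0" "K2 > 0"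
    using C m_pos by (auto simp: K0_def K1_def K2_def intro!: mult_pos_pos add_pos_pos)
  define B where "B = (1 + K0) * (K1 + (K2 + K1\<^sup>2)) + (K0 + (K1 * K0 + K0\<^sup>2)) * (1 + K1 + K0)"
  have "\<bar>W1 \<delta> x\<bar> \<le> B / x" if \<delta>: "\<delta> \<in> {0..1}" and x: "x \<in> {0<..x0}" for \<delta> x
  proof -
    define \<rho> \<sigma> where "\<rho> = x + \<delta>" and "\<sigma> = x / \<rho>"
    define y where "y = ln \<rho>"
    have \<rho>: "\<rho> > 0" "\<rho> \<ge> x" "\<rho> \<le> x0 + 1" "x > 0" using \<delta> x by (auto simp: \<rho>_def)
    have \<sigma>: "0 < \<sigma>" "\<sigma> \<le> 1" using \<rho> by (auto simp: \<sigma>_def)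
    have xs: "x = \<sigma> * \<rho>" using \<rho> by (simp add: \<sigma>_def)
    have "y \<le> ln (x0 + 1)" unfolding y_def using \<rho> by simp
    note tb = tb[OF this]
    have t0: "0 < t 0 y" "t 0 y < m" "0 < t 1 y" using t0_range t1_pos by auto
    have Ct0: "t 0 y \<le> C * t 0 y" using C t0 by simp
    define Q where "Q = pot.Q \<delta> x"
    have Q: "\<rho> * Q = (1 - \<sigma>) * t 0 y + \<sigma> * t 1 y"
      using F_pos(3)[of \<delta> x] \<delta> \<rho> unfolding Q_def pot.Q_def \<sigma>_def y_def \<rho>_def by simp
    have Q1: "\<rho>\<^sup>2 * pot.Q1 \<delta> x = 2 * (t 1 y - t 0 y) + \<sigma> * (t 2 y - 3 * t 1 y + 2 * t 0 y)"
    proof -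
      have "\<rho>\<^sup>2 * (2 * (p / \<rho>\<^sup>2) + x * (q / \<rho> ^ 3)) = 2 * p + \<sigma> * q" for p q
        using \<rho>(1) by (simp add: \<sigma>_def field_simps power2_eq_square power3_eq_cube)
      then show ?thesis
        unfolding pot.Q1_def unfolding F2_def F3_def \<rho>_def[symmetric] y_def[symmetric] by blast
    qed
    have Q2: "\<rho> ^ 3 * pot.Q2 \<delta> x = 3 * (t 2 y - 3 * t 1 y + 2 * t 0 y) +
        \<sigma> * (t 3 y - 6 * t 2 y + 11 * t 1 y - 6 * t 0 y)"
    proof -
      have "\<rho> ^ 3 * (3 * (p / \<rho> ^ 3) + x * (q / \<rho> ^ 4)) = 3 * p + \<sigma> * q" for p q
        using \<rho>(1) by (simp add: \<sigma>_def field_simps eval_nat_numeral)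
      then show ?thesis
        unfolding pot.Q2_def unfolding F3_def F4_def \<rho>_def[symmetric] y_def[symmetric] by blast
    qed
    \<comment> \<open>The lower bound for \<open>Q\<close>, required because \<open>Q1\<close> and
      \<open>Q2\<close> are divided by it. Here \<open>t 0 \<le> C t 1\<close> enters, hence the
      simple zero of the profile.\<close>
    have "C * (\<rho> * Q) \<ge> (1 - \<sigma>) * t 0 y + \<sigma> * t 0 y"
    proof -
      have "(1 - \<sigma>) * t 0 y \<le> (1 - \<sigma>) * (C * t 0 y)" "\<sigma> * t 0 y \<le> \<sigma> * (C * t 1 y)"
        using tb Ct0 \<sigma> by (auto intro!: mult_left_mono)
      then show ?thesis unfolding Q by (simp add: algebra_simps)
    qed
    then have t0Q: "t 0 y \<le> C * (\<rho> * Q)" by (simp add: algebra_simps)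
    have Qpos: "Q > 0" using F_pos(2)[of \<delta> x] \<delta> \<rho> by (simp add: Q_def pot.Q_def)
    have "\<rho> * Q \<le> (1 - \<sigma>) * (C * t 0 y) + \<sigma> * (C * t 0 y)"
      unfolding Q using tb Ct0 \<sigma> by (intro add_mono mult_left_mono) auto
    also have "\<dots> = C * t 0 y" by (simp add: algebra_simps)
    also have "\<dots> \<le> K0" unfolding K0_def using C t0 by simp
    finally have QK0: "\<rho> * Q \<le> K0" .
    define u where "u = C * t 0 y"
    have tu: "0 < t 0 y" "0 < t 1 y" "t 1 y \<le> u" "\<bar>t 2 y\<bar> \<le> u" "\<bar>t 3 y\<bar> \<le> u"
      using tb t0 by (auto simp: u_def)
    have ub: "\<bar>t 1 y - t 0 y\<bar> \<le> u + t 0 y" "\<bar>t 2 y - 3 * t 1 y + 2 * t 0 y\<bar> \<le> 4 * u + 2 * t 0 y"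
      "\<bar>t 3 y - 6 * t 2 y + 11 * t 1 y - 6 * t 0 y\<bar> \<le> 18 * u + 6 * t 0 y"
      using tu unfolding abs_le_iff by linarith+
    have s3: "\<bar>\<sigma> * q\<bar> \<le> \<bar>q\<bar>" for q using \<sigma> by (simp add: abs_mult mult_left_le_one_le)
    have "\<bar>\<rho>\<^sup>2 * pot.Q1 \<delta> x\<bar> \<le> 2 * \<bar>t 1 y - t 0 y\<bar> + \<bar>t 2 y - 3 * t 1 y + 2 * t 0 y\<bar>"
      unfolding Q1 by (rule order_trans[OF abs_triangle_ineq add_mono[OF _ s3]])
        (simp only: abs_mult abs_numeral order.refl)
    also have "\<dots> \<le> 4 * t 0 y + 6 * u"
      using add_mono[OF mult_left_mono[OF ub(1), of 2] ub(2)] by simp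
    also have "\<dots> = (2 * (1 + C) + (C + 3 * C + 2)) * t 0 y" by (simp add: u_def algebra_simps)
    also have "\<dots> \<le> (2 * (1 + C) + (C + 3 * C + 2)) * (C * (\<rho> * Q))"
      using t0Q C by (intro mult_left_mono) auto
    finally have "\<bar>\<rho>\<^sup>2 * pot.Q1 \<delta> x\<bar> \<le> K1 * (\<rho> * Q)" by (simp add: K1_def mult.assoc)
    then have Q1b: "\<rho> * \<bar>pot.Q1 \<delta> x\<bar> \<le> K1 * Q"
      using \<rho> by (simp add: abs_mult power2_eq_square mult.left_commute mult.assoc)
    have "\<bar>\<rho> ^ 3 * pot.Q2 \<delta> x\<bar> \<le> 3 * \<bar>t 2 y - 3 * t 1 y + 2 * t 0 y\<bar> + \<bar>t 3 y - 6 * t 2 y + 11 * t 1 y - 6 * t 0 y\<bar>"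
      unfolding Q2 by (rule order_trans[OF abs_triangle_ineq add_mono[OF _ s3]])
        (simp only: abs_mult abs_numeral order.refl)
    also have "\<dots> \<le> 12 * t 0 y + 30 * u"
      using add_mono[OF mult_left_mono[OF ub(2), of 3] ub(3)] by simp
    also have "\<dots> = (3 * (C + 3 * C + 2) + (C + 6 * C + 11 * C + 6)) * t 0 y"
      by (simp add: u_def algebra_simps)
    also have "\<dots> \<le> (3 * (C + 3 * C + 2) + (C + 6 * C + 11 * C + 6)) * (C * (\<rho> * Q))"
      using t0Q C by (intro mult_left_mono) auto
    finally have "\<bar>\<rho> ^ 3 * pot.Q2 \<delta> x\<bar> \<le> K2 * (\<rho> * Q)" by (simp add: K2_def mult.assoc)
    then have Q2b: "\<rho>\<^sup>2 * \<bar>pot.Q2 \<delta> x\<bar> \<le> K2 * Q"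
      using \<rho> by (simp add: abs_mult power2_eq_square power3_eq_cube mult.left_commute mult.assoc)
    have xQ1: "x * \<bar>pot.Q1 \<delta> x\<bar> \<le> K1 * Q"
      using Q1b mult_right_mono[OF \<rho>(2), of "\<bar>pot.Q1 \<delta> x\<bar>"] by linarith
    have "x\<^sup>2 \<le> \<rho>\<^sup>2" using \<rho> by (intro power_mono) auto
    then have xQ2: "x\<^sup>2 * \<bar>pot.Q2 \<delta> x\<bar> \<le> K2 * Q"
      using Q2b mult_right_mono[of "x\<^sup>2" "\<rho>\<^sup>2" "\<bar>pot.Q2 \<delta> x\<bar>"] by linarith
    have xQ: "x * Q \<le> K0" using QK0 mult_right_mono[OF \<rho>(2), of Q] Qpos by linarith
    have P: "pot.P \<delta> x \<ge> 1"
      using F_pos(1)[of \<delta> x] \<delta> \<rho> by (simp add: pot.P_def)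
    have QP: "0 \<le> Q / pot.P \<delta> x" "Q / pot.P \<delta> x \<le> Q"
      using P Qpos by (auto simp: divide_le_eq)
    have xE: "0 \<le> x * pot.E \<delta> x" "x * pot.E \<delta> x \<le> K0"
    proof -
      show "0 \<le> x * pot.E \<delta> x"
        using mult_nonneg_nonneg[OF less_imp_le[OF \<rho>(4)] QP(1)] unfolding pot.E_def Q_def .
      have "x * pot.E \<delta> x \<le> x * Q" using mult_left_mono[OF QP(2) less_imp_le[OF \<rho>(4)]] unfolding pot.E_def Q_def .
      then show "x * pot.E \<delta> x \<le> K0" using xQ by simp
    qed
    have xZ: "\<bar>x * pot.Z \<delta> x\<bar> \<le> K1"
      using xQ1 Qpos \<rho> by (simp add: pot.Z_def Q_def[symmetric] abs_mult divide_le_eq)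
    have xZ1: "\<bar>x\<^sup>2 * pot.Z1 \<delta> x\<bar> \<le> K2 + K1\<^sup>2"
    proof -
      have "x\<^sup>2 * pot.Z1 \<delta> x = x\<^sup>2 * pot.Q2 \<delta> x / Q - (x * pot.Z \<delta> x)\<^sup>2"
        by (simp add: pot.Z1_def pot.Z_def Q_def[symmetric] algebra_simps power_mult_distrib power_divide)
      moreover have "\<bar>x\<^sup>2 * pot.Q2 \<delta> x / Q\<bar> \<le> K2"
        using xQ2 Qpos by (simp add: abs_mult divide_le_eq)
      moreover have "(x * pot.Z \<delta> x)\<^sup>2 \<le> K1\<^sup>2"
        using power_mono[OF xZ, of 2] by simp
      ultimately show ?thesis using zero_le_power2[of "x * pot.Z \<delta> x"] by linarith
    qed
    have xE1: "\<bar>x\<^sup>2 * pot.E1 \<delta> x\<bar> \<le> K1 * K0 + K0\<^sup>2"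
    proof -
      have "x\<^sup>2 * pot.E1 \<delta> x = x\<^sup>2 * pot.Q1 \<delta> x / pot.P \<delta> x - (x * pot.E \<delta> x)\<^sup>2"
        by (simp add: pot.E1_def pot.E_def algebra_simps power_mult_distrib power_divide)
      moreover have "\<bar>x\<^sup>2 * pot.Q1 \<delta> x / pot.P \<delta> x\<bar> \<le> K1 * K0"
      proof -
        have "\<bar>x\<^sup>2 * pot.Q1 \<delta> x / pot.P \<delta> x\<bar> \<le> \<bar>x\<^sup>2 * pot.Q1 \<delta> x\<bar>"
          using P by (simp add: divide_le_eq mult_left_le_one_le mult_le_cancel_left1)
        also have "\<dots> = x * (x * \<bar>pot.Q1 \<delta> x\<bar>)" using \<rho> by (simp add: abs_mult power2_eq_square)
        also have "\<dots> \<le> x * (K1 * Q)" using xQ1 \<rho> by (intro mult_left_mono) auto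
        also have "\<dots> = K1 * (x * Q)" by simp
        also have "\<dots> \<le> K1 * K0" using xQ Kpos by (intro mult_left_mono) auto
        finally show ?thesis .
      qed
      moreover have "(x * pot.E \<delta> x)\<^sup>2 \<le> K0\<^sup>2" using xE by (intro power_mono) auto
      ultimately show ?thesis using zero_le_power2[of "x * pot.E \<delta> x"] by linarith
    qed
    have "x * W1 \<delta> x = (1 + x * pot.E \<delta> x) * (x * pot.Z \<delta> x + x\<^sup>2 * pot.Z1 \<delta> x) +
        (x * pot.E \<delta> x + x\<^sup>2 * pot.E1 \<delta> x) * (1 + x * pot.Z \<delta> x - x * pot.E \<delta> x)"
      unfolding W1_def pot.W1_def by (simp add: algebra_simps power2_eq_square)
    also have "\<bar>\<dots>\<bar> \<le> B"
    proof -
      have "\<bar>1 + x * pot.E \<delta> x\<bar> \<le> 1 + K0" "\<bar>1 + x * pot.Z \<delta> x - x * pot.E \<delta> x\<bar> \<le> 1 + K1 + K0"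
        "\<bar>x * pot.Z \<delta> x + x\<^sup>2 * pot.Z1 \<delta> x\<bar> \<le> K1 + (K2 + K1\<^sup>2)"
        "\<bar>x * pot.E \<delta> x + x\<^sup>2 * pot.E1 \<delta> x\<bar> \<le> K0 + (K1 * K0 + K0\<^sup>2)"
        using xE xZ xZ1 xE1 by linarith+
      note * = mult_mono[OF this(1,3)] mult_mono[OF this(4,2)]
      show ?thesis unfolding B_def
        by (rule order_trans[OF abs_triangle_ineq add_mono], unfold abs_mult)
           (rule *; use Kpos in simp)+
    qed
    finally have "\<bar>x * W1 \<delta> x\<bar> \<le> B" .
    then show ?thesis using \<rho>(4) by (simp add: abs_mult pos_le_divide_eq mult.commute)
  qed
  moreover have "B > 0" unfolding B_def using Kpos by (intro add_pos_pos mult_pos_pos) auto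
  ultimately show ?thesis by blast
qed

text \<open>In the momentum variable \<open>R = \<phi> / \<gamma>\<close> and
  \<open>1 + V = \<phi>'\<close>. Thus \<open>W 0\<close> is a function of \<open>\<gamma>\<close>
  that is smooth up to \<open>\<gamma> = 1\<close>, although \<open>F0\<close> need not be smooth at
  \<open>x = 0\<close>.\<close>

lemma W_eq0:
  assumes "x > 0"
  shows "W 0 x = (1 + \<phi> (1 + t 0 (ln x)) / (1 + t 0 (ln x))) * d 1 (1 + t 0 (ln x)) -
    (\<phi> (1 + t 0 (ln x)) / (1 + t 0 (ln x)))\<^sup>2 / 2"
proof -
  let ?y = "ln x"
  have P: "pot.P 0 x = 1 + t 0 ?y" unfolding pot.P_def using assms by (simp add: F1_def)
  have Q: "pot.Q 0 x = t 1 ?y / x"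
    unfolding pot.Q_def using assms by (simp add: F1_def F2_def field_simps power2_eq_square)
  have E: "x * pot.E 0 x = \<phi> (1 + t 0 ?y) / (1 + t 0 ?y)"
    unfolding pot.E_def P Q t1_eq using assms by simp
  have Q1: "pot.Q1 0 x = (t 2 ?y - t 1 ?y) / x\<^sup>2" unfolding pot.Q1_def
    using assms by (simp add: F2_def F3_def field_simps power2_eq_square power3_eq_cube)
  have "1 + x * pot.Z 0 x = d 1 (1 + t 0 ?y)" unfolding pot.Z_def Q Q1 t_eqs
    using assms t1_pos[of ?y] by (simp add: field_simps power2_eq_square)
  with E show ?thesis unfolding W_def by simp
qed

lemma t0_ln_tendsto: "((\<lambda>x. t 0 (ln x)) \<longlongrightarrow> 0) (at_right 0)"
  using filterlim_compose[OF f_lims(1) ln_at_0] by (simp add: t_def)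

text \<open>As \<open>\<gamma>\<close> tends to 1 the terms with \<open>\<phi>\<close> vanish and
  the slope \<open>\<phi>'\<close> tends to \<open>\<beta>\<close>.\<close>

lemma W0_tendsto: "(W 0 \<longlongrightarrow> \<beta>) (at_right 0)"
proof -
  have c: "((\<lambda>x. d n (1 + t 0 (ln x))) \<longlongrightarrow> d n 1) (at_right 0)" for n
  proof (rule filterlim_compose[of "d n" _ "at 1 within {1..m+1}"])
    show "(d n \<longlongrightarrow> d n 1) (at 1 within {1..m + 1})"
      using d_cont[of n] m_pos unfolding continuous_on_def by simp
    show "filterlim (\<lambda>x. 1 + t 0 (ln x)) (at 1 within {1..m+1}) (at_right 0)"
      unfolding filterlim_at using t0_range tendsto_add[OF tendsto_const t0_ln_tendsto, of 1]
      by (auto simp: less_imp_le intro!: always_eventually simp: less_imp_neq[symmetric])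
  qed
  have "((\<lambda>x. (1 + \<phi> (1 + t 0 (ln x)) / (1 + t 0 (ln x))) * d 1 (1 + t 0 (ln x)) -
    (\<phi> (1 + t 0 (ln x)) / (1 + t 0 (ln x)))\<^sup>2 / 2) \<longlongrightarrow> (1 + \<phi> 1 / (1 + 0)) * \<beta> - (\<phi> 1 / (1 + 0))\<^sup>2 / 2) (at_right 0)"
    using c[of 0] c[of 1] unfolding d_0 d_1 by (intro tendsto_intros t0_ln_tendsto) auto
  moreover have "eventually (\<lambda>x::real. x > 0) (at_right 0)" by (simp add: eventually_at_right_less)
  ultimately show ?thesis by (simp add: profile_1)
       (erule Lim_transform_eventually, erule eventually_mono, simp add: W_eq0)
qed

text \<open>\<open>\<omega>\<close> is the derivative of \<open>W 0\<close> with respect to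
  \<open>\<gamma>\<close>, continuous on the closed interval, and \<open>t 1 (ln x) / x\<close> is
  the derivative of \<open>\<gamma>\<close> with respect to \<open>x\<close>. Unlike
  \<open>C / x\<close>, this majorant is integrable at 0.\<close>

lemma W1_0_bound: "\<exists>C>0. \<forall>x>0. \<bar>W1 0 x\<bar> \<le> C * (t 1 (ln x) / x)"
proof -
  define \<omega> where "\<omega> \<gamma> = (d 1 \<gamma> / \<gamma> - d 0 \<gamma> / \<gamma>\<^sup>2) * d 1 \<gamma> + (1 + d 0 \<gamma> / \<gamma>) * d 2 \<gamma>
      - d 0 \<gamma> / \<gamma> * (d 1 \<gamma> / \<gamma> - d 0 \<gamma> / \<gamma>\<^sup>2)" for \<gamma>
  have "continuous_on {1..m+1} \<omega>"
    unfolding \<omega>_def by (intro continuous_intros d_cont) auto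
  then obtain C where C: "C > 0" "\<forall>x\<in>{1..m+1}. \<bar>\<omega> x\<bar> \<le> C"
    using bounded_of_continuous_on_Icc by blast
  have "W1 0 x = \<omega> (1 + t 0 (ln x)) * (t 1 (ln x) / x)" if x: "x > 0" for x
  proof -
    have ln: "(ln has_real_derivative 1 / x) (at x)" using x by (auto intro!: derivative_eq_intros)
    have D: "((\<lambda>x. d n (1 + t 0 (ln x))) has_real_derivative d (Suc n) (1 + t 0 (ln x)) * t 1 (ln x) * (1 / x)) (at x)" for n
      using DERIV_chain2[OF d_t_deriv ln] .
    have T: "((\<lambda>x. t 0 (ln x)) has_real_derivative t 1 (ln x) * (1 / x)) (at x)"
      using DERIV_chain2[OF t_deriv ln, of 0] by simp
    have D01: "((\<lambda>x. d 0 (1 + t 0 (ln x))) has_real_derivative d 1 (1 + t 0 (ln x)) * t 1 (ln x) * (1 / x)) (at x)"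
      "((\<lambda>x. d 1 (1 + t 0 (ln x))) has_real_derivative d 2 (1 + t 0 (ln x)) * t 1 (ln x) * (1 / x)) (at x)"
      using D[of 0] D[of 1] by (simp_all add: numeral_2_eq_2)
    let ?\<gamma> = "1 + t 0 (ln x)" and ?q = "t 1 (ln x) * (1 / x)"
    have nz: "?\<gamma> \<noteq> 0" using t0_range(1)[of "ln x"] by linarith
    define D0' where "D0' = (d 1 ?\<gamma> * ?q * ?\<gamma> - d 0 ?\<gamma> * ?q) / (?\<gamma> * ?\<gamma>)"
    have A: "((\<lambda>x. d 0 (1 + t 0 (ln x)) / (1 + t 0 (ln x))) has_real_derivative D0') (at x)"
      using DERIV_divide[OF D01(1) DERIV_add[OF DERIV_const[of 1] T] nz] by (simp add: D0'_def)
    have D0': "D0' = (d 1 ?\<gamma> / ?\<gamma> - d 0 ?\<gamma> / ?\<gamma>\<^sup>2) * ?q"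
      unfolding D0'_def using nz by (simp add: divide_simps power2_eq_square) (simp add: algebra_simps)
    have "((\<lambda>x. (1 + d 0 (1 + t 0 (ln x)) / (1 + t 0 (ln x))) * d 1 (1 + t 0 (ln x)) -
        (d 0 (1 + t 0 (ln x)) / (1 + t 0 (ln x)))\<^sup>2 / 2) has_real_derivative
        D0' * d 1 ?\<gamma> + d 2 ?\<gamma> * ?q * (1 + d 0 ?\<gamma> / ?\<gamma>) - d 0 ?\<gamma> / ?\<gamma> * D0') (at x)"
    proof (rule DERIV_cong[OF DERIV_diff[OF DERIV_mult[OF DERIV_add[OF DERIV_const[of 1] A] D01(2)]
          DERIV_cdivide[OF DERIV_power[OF A, of 2], of 2]]])
      have "of_nat 2 * (D0' * (p ^ (2 - Suc 0))) / 2 = p * D0'" for p :: real by simp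
      then show "(0 + D0') * d 1 ?\<gamma> + d 2 ?\<gamma> * t 1 (ln x) * (1 / x) * (1 + d 0 ?\<gamma> / ?\<gamma>) -
          of_nat 2 * (D0' * (d 0 ?\<gamma> / ?\<gamma>) ^ (2 - Suc 0)) / 2 =
          D0' * d 1 ?\<gamma> + d 2 ?\<gamma> * ?q * (1 + d 0 ?\<gamma> / ?\<gamma>) - d 0 ?\<gamma> / ?\<gamma> * D0'"
        by (simp only: add_0_left mult.assoc)
    qed
    then have "(W 0 has_real_derivative
        D0' * d 1 ?\<gamma> + d 2 ?\<gamma> * ?q * (1 + d 0 ?\<gamma> / ?\<gamma>) - d 0 ?\<gamma> / ?\<gamma> * D0') (at x)"
      by (rule has_field_derivative_transform_within_open[of _ _ _ "{0<..}"])
         (use x in \<open>auto simp: W_eq0 d_0\<close>)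
    moreover have "(W 0 has_real_derivative W1 0 x) (at x)" using W_deriv mem_Jd[of 0 x] x by simp
    ultimately have "W1 0 x = D0' * d 1 ?\<gamma> + d 2 ?\<gamma> * ?q * (1 + d 0 ?\<gamma> / ?\<gamma>) - d 0 ?\<gamma> / ?\<gamma> * D0'"
      using DERIV_unique by blast
    moreover have "p * q * a + b * q * (1 + v) - v * (p * q) = (p * a + (1 + v) * b - v * p) * q"
      for p q a b v :: real by (simp add: algebra_simps)
    moreover have "t 1 (ln x) / x = ?q" by simp
    ultimately show ?thesis unfolding D0' \<omega>_def by metis
  qed
  moreover have "\<bar>\<omega> (1 + t 0 (ln x))\<bar> \<le> C" for x
    using C t0_range[of "ln x"] by (auto simp: less_imp_le)
  ultimately have "\<bar>W1 0 x\<bar> \<le> C * (t 1 (ln x) / x)" if "x > 0" for x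
    using that t1_pos[of "ln x"] by (simp add: abs_mult divide_right_mono mult_right_mono)
  then show ?thesis using C by blast
qed

text \<open>The fundamental theorem of calculus on the open interval, with the limit of
  \<open>W \<delta>\<close> at 0 as lower boundary value: for \<open>\<delta> > 0\<close> it is 1,
  since \<open>E\<close> and \<open>Z\<close> occur only with a factor \<open>x\<close>. For
  \<open>\<delta> = 0\<close> integrability follows by comparison with the derivative of the bounded
  increasing function \<open>t 0 (ln x)\<close>.\<close>

lemma W1_integral:
  assumes x0: "x0 > 0" and \<delta>: "\<delta> \<ge> 0"
  shows "set_integrable lborel {0<..<x0} (W1 \<delta>)"
    "set_lebesgue_integral lborel {0<..<x0} (W1 \<delta>) = W \<delta> x0 - (if \<delta> = 0 then \<beta> else 1)"
proof -
  have J: "x \<in> Jd \<delta>" if "x > 0" for x using mem_Jd that \<delta> by simp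
  have lim0: "(W \<delta> \<longlongrightarrow> (if \<delta> = 0 then \<beta> else 1)) (at_right 0)"
  proof (cases "\<delta> = 0")
    case False
    have "isCont (W \<delta>) 0" by (rule DERIV_isCont[OF W_deriv[OF mem_Jd]]) (use False \<delta> in auto)
    moreover have "W \<delta> 0 = 1" by (simp add: W_def)
    ultimately show ?thesis using False unfolding isCont_def by (auto intro: tendsto_mono at_le)
  qed (use W0_tendsto in simp)
  have limx0: "(W \<delta> \<longlongrightarrow> W \<delta> x0) (at_left x0)"
    using DERIV_isCont[OF W_deriv[OF J[OF x0]]] unfolding isCont_def by (auto intro: tendsto_mono at_le)
  show si: "set_integrable lborel {0<..<x0} (W1 \<delta>)"
  proof (cases "\<delta> = 0")
    case False
    have "continuous_on {0..x0} (W1 \<delta>)"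
      by (intro continuous_at_imp_continuous_on ballI W1_isCont mem_Jd) (use False \<delta> in auto)
    then have "set_integrable lborel {0..x0} (W1 \<delta>)"
      unfolding set_integrable_def using borel_integrable_compact[OF compact_Icc] by blast
    then show ?thesis by (rule set_integrable_subset) auto
  next
    case True
    obtain C where C: "C > 0" "\<And>x. x > 0 \<Longrightarrow> \<bar>W1 0 x\<bar> \<le> C * (t 1 (ln x) / x)"
      using W1_0_bound by blast
    have lt: "((\<lambda>x. t 0 (ln x)) has_real_derivative t 1 (ln x) / x) (at x)" if "x > 0" for x
    proof -
      have ln: "(ln has_real_derivative 1 / x) (at x)"
        using that by (auto intro!: derivative_eq_intros)
      show ?thesis using DERIV_chain2[OF t_deriv ln, of 0] by simp
    qed
    have ct: "isCont (\<lambda>x. t 1 (ln x) / x) x" if "x > 0" for x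
      using that by (intro continuous_intros isCont_o2[of _ ln] t_cont) auto
    have "set_integrable lborel (einterval (ereal 0) (ereal x0)) (\<lambda>x. t 1 (ln x) / x)"
    proof (rule interval_integral_FTC_nonneg)
      show "(((\<lambda>x. t 0 (ln x)) \<circ> real_of_ereal) \<longlongrightarrow> 0) (at_right (ereal 0))"
        using t0_ln_tendsto by (simp add: ereal_tendsto_simps)
      have "((\<lambda>x. t 0 (ln x)) \<longlongrightarrow> t 0 (ln x0)) (at_left x0)"
        using DERIV_isCont[OF lt[OF x0]] unfolding isCont_def by (auto intro: tendsto_mono at_le)
      then show "(((\<lambda>x. t 0 (ln x)) \<circ> real_of_ereal) \<longlongrightarrow> t 0 (ln x0)) (at_left (ereal x0))"
        by (simp add: ereal_tendsto_simps)
    qed (use x0 lt ct t1_pos in \<open>auto simp: less_imp_le intro!: always_eventually divide_nonneg_pos\<close>)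
    then have "set_integrable lborel {0<..<x0} (\<lambda>x. C * (t 1 (ln x) / x))"
      by (intro set_integrable_mult_right) simp
    then show ?thesis
    proof (rule set_integrable_bound)
      have "continuous_on {0<..<x0} (W1 \<delta>)"
        by (intro continuous_at_imp_continuous_on ballI W1_isCont J) auto
      then show "set_borel_measurable lborel {0<..<x0} (W1 \<delta>)"
        unfolding set_borel_measurable_def
        using borel_measurable_continuous_on_indicator[of "{0<..<x0}" "W1 \<delta>"] by simp
    qed (use C True in \<open>auto intro!: always_eventually order_trans[OF C(2)] divide_right_mono\<close>)
  qed
  have "(LBINT x=ereal 0..ereal x0. W1 \<delta> x) = W \<delta> x0 - (if \<delta> = 0 then \<beta> else 1)"
    by (rule interval_integral_FTC_integrable[where F = "W \<delta>"])
       (use x0 J W_deriv W1_isCont si lim0 limx0 in \<open>auto simp: ereal_tendsto_simps 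
           simp flip: has_real_derivative_iff_has_vector_derivative\<close>)
  then show "set_lebesgue_integral lborel {0<..<x0} (W1 \<delta>) = W \<delta> x0 - (if \<delta> = 0 then \<beta> else 1)"
    using x0 by (simp add: interval_lebesgue_integral_def)
qed

end

section \<open>Integration over the fibres\<close>

text \<open>The pushforward of Lebesgue measure on \<open>\<complex>\<close> under \<open>w \<mapsto> c \<bar>w\<bar>\<^sup>2\<close> is \<open>\<pi> / c\<close> times Lebesgue
  measure, since discs have area \<open>\<pi> R\<^sup>2\<close>; this replaces polar coordinates.\<close>

lemma distr_norm_square:
  fixes c x0 :: real
  assumes c: "c > 0" and x0: "x0 > 0"
  defines "D \<equiv> {w::complex. w \<noteq> 0 \<and> (cmod w)\<^sup>2 * c < x0}"
  shows "distr (density lborel (\<lambda>w. ennreal (indicator D w))) borel (\<lambda>w. (cmod w)\<^sup>2 * c) =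
     density lborel (\<lambda>x. ennreal (pi / c * indicator {0<..<x0} x))" (is "?M = ?N")
    and "D \<in> sets lborel"
proof -
  have Dm: "{w::complex. (cmod w)\<^sup>2 * c < x0} \<in> sets lborel" by measurable
  have "D = {w::complex. (cmod w)\<^sup>2 * c < x0} - {0}" by (auto simp: D_def)
  with Dm show [measurable]: "D \<in> sets lborel" by auto
  \<comment> \<open>Half-lines suffice to identify the two measures. Their preimages are annuli,
    whose area is a difference of two disc areas; \<open>max x 0\<close> covers negative
    \<open>x\<close>.\<close>
  have M: "emeasure ?M {x<..} = ennreal (pi * (x0 - max x 0) / c)" if "max x 0 < x0" for x
  proof -
    define y where "y = max x 0"
    have y: "0 \<le> y" "y < x0" using that by (auto simp: y_def)
    have lt: "(cmod w)\<^sup>2 * c < z \<longleftrightarrow> cmod w < sqrt (z / c)" for w z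
    proof -
      have "cmod w < sqrt (z / c) \<longleftrightarrow> sqrt ((cmod w)\<^sup>2) < sqrt (z / c)" by simp
      also have "\<dots> \<longleftrightarrow> (cmod w)\<^sup>2 < z / c" by (rule real_sqrt_less_iff)
      finally show ?thesis by (simp only: pos_less_divide_eq[OF c])
    qed
    have le: "(cmod w)\<^sup>2 * c \<le> y \<longleftrightarrow> cmod w \<le> sqrt (y / c)" for w
    proof -
      have "cmod w \<le> sqrt (y / c) \<longleftrightarrow> sqrt ((cmod w)\<^sup>2) \<le> sqrt (y / c)" by simp
      also have "\<dots> \<longleftrightarrow> (cmod w)\<^sup>2 \<le> y / c" by (rule real_sqrt_le_iff)
      finally show ?thesis by (simp only: pos_le_divide_eq[OF c])
    qed
    have "emeasure ?M {x<..} = emeasure (density lborel (\<lambda>w. ennreal (indicator D w))) {w. x < (cmod w)\<^sup>2 * c}"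
      by (subst emeasure_distr) (auto simp: vimage_def)
    also have "\<dots> = (\<integral>\<^sup>+ w. indicator (ball (0::complex) (sqrt (x0 / c)) - cball 0 (sqrt (y / c))) w \<partial>lborel)"
    proof (subst emeasure_density)
      have "ennreal (indicator D w) * indicator {w. x < (cmod w)\<^sup>2 * c} w =
        indicator (ball 0 (sqrt (x0 / c)) - cball 0 (sqrt (y / c))) w" for w :: complex
      proof -
        have "w \<in> ball 0 (sqrt (x0 / c)) - cball 0 (sqrt (y / c)) \<longleftrightarrow> (cmod w)\<^sup>2 * c < x0 \<and> \<not> (cmod w)\<^sup>2 * c \<le> y"
          using lt[of w x0] le[of w] by simp
        also have "\<dots> \<longleftrightarrow> w \<in> D \<and> x < (cmod w)\<^sup>2 * c"
          using c by (auto simp: D_def y_def not_le max_less_iff_conj zero_less_mult_iff)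
        finally show ?thesis by (auto simp: indicator_def)
      qed
      then show "(\<integral>\<^sup>+ w. ennreal (indicator D w) * indicator {w. x < (cmod w)\<^sup>2 * c} w \<partial>lborel) =
        (\<integral>\<^sup>+ w. indicator (ball (0::complex) (sqrt (x0 / c)) - cball 0 (sqrt (y / c))) w \<partial>lborel)" by simp
    qed auto
    also have "\<dots> = emeasure lborel (ball 0 (sqrt (x0 / c)) - cball (0::complex) (sqrt (y / c)))"
      by (rule nn_integral_indicator) auto
    also have "\<dots> = emeasure lborel (ball (0::complex) (sqrt (x0 / c))) - emeasure lborel (cball (0::complex) (sqrt (y / c)))"
    proof (rule emeasure_Diff)
      show "emeasure lborel (cball (0::complex) (sqrt (y / c))) \<noteq> \<infinity>"
        using y c by (subst emeasure_cball) auto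
      have "sqrt (y / c) < sqrt (x0 / c)" using y c by (simp add: divide_strict_right_mono)
      then show "cball (0::complex) (sqrt (y / c)) \<subseteq> ball 0 (sqrt (x0 / c))"
        unfolding subset_iff mem_cball mem_ball using le_less_trans by blast
    qed auto
    also have "\<dots> = ennreal (pi * (x0 / c)) - ennreal (pi * (y / c))"
      using y c x0 by (simp add: emeasure_ball emeasure_cball unit_ball_vol_2)
    also have "\<dots> = ennreal (pi * (x0 / c) - pi * (y / c))"
      using y c by (intro ennreal_minus) auto
    also have "pi * (x0 / c) - pi * (y / c) = pi * (x0 - max x 0) / c"
      by (simp add: y_def algebra_simps diff_divide_distrib)
    finally show ?thesis .
  qed
  have M0: "emeasure ?M {x<..} = 0" if "max x 0 \<ge> x0" for x
  proof -
    have "emeasure ?M {x<..} = emeasure (density lborel (\<lambda>w. ennreal (indicator D w))) {w. x < (cmod w)\<^sup>2 * c}"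
      by (subst emeasure_distr) (auto simp: vimage_def)
    also have "\<dots> = (\<integral>\<^sup>+ w. 0 \<partial>(lborel::complex measure))"
    proof (subst emeasure_density)
      have "ennreal (indicator D w) * indicator {w. x < (cmod w)\<^sup>2 * c} w = 0" for w :: complex
        using that x0 by (auto simp: D_def indicator_def)
      then show "(\<integral>\<^sup>+ w. ennreal (indicator D w) * indicator {w. x < (cmod w)\<^sup>2 * c} w \<partial>lborel) = (\<integral>\<^sup>+ w. 0 \<partial>(lborel :: complex measure))"
        by (intro nn_integral_cong)
    qed auto
    finally show ?thesis by simp
  qed
  have N: "emeasure ?N {x<..} = ennreal (pi * (x0 - max x 0) / c)" for x
  proof -
    have "emeasure ?N {x<..} = (\<integral>\<^sup>+ z. ennreal (pi / c) * indicator {max x 0<..<x0} z \<partial>lborel)"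
      by (subst emeasure_density) (auto intro!: nn_integral_cong simp: indicator_def)
    also have "\<dots> = ennreal (pi / c) * emeasure lborel {max x 0<..<x0}"
      by (rule nn_integral_cmult_indicator) simp
    also have "\<dots> = ennreal (pi * (x0 - max x 0) / c)"
    proof (cases "max x 0 \<le> x0")
      case True
      then show ?thesis using c by (simp add: ennreal_mult[symmetric] del: max.bounded_iff)
    next
      case False
      then have "pi * (x0 - max x 0) / c \<le> 0" "{max x 0<..<x0} = {}"
        using c by (auto intro!: divide_nonpos_pos mult_nonneg_nonpos)
      then show ?thesis by (simp only: ennreal_neg) simp
    qed
    finally show ?thesis .
  qed
  show "?M = ?N"
  proof (rule measure_eqI_lessThan)
    fix x
    have *: "emeasure ?M {x<..} = ennreal (pi * (x0 - max x 0) / c)"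
    proof (cases "max x 0 < x0")
      case False
      then have "pi * (x0 - max x 0) / c \<le> 0"
        using c by (intro divide_nonpos_pos mult_nonneg_nonpos) auto
      then show ?thesis using M0[of x] False by (simp add: ennreal_neg)
    qed (use M in simp)
    then show "emeasure ?M {x<..} = emeasure ?N {x<..}" by (simp only: N)
    show "emeasure ?M {x<..} < \<infinity>" unfolding * by simp
  qed auto
qed

text \<open>The factor \<open>c\<close> of the integrand cancels the \<open>1 / c\<close> of the
  push-forward. With \<open>c = H z\<close> the integral therefore has the same value on every
  fibre.\<close>

lemma radial_integral:
  fixes c x0 :: real and k :: "real \<Rightarrow> real"
  assumes c: "c > 0" and x0: "x0 > 0" and k: "k \<in> borel_measurable borel"
    and int: "set_integrable lborel {0<..<x0} k"
  shows "set_integrable lborel {w::complex. w \<noteq> 0 \<and> (cmod w)\<^sup>2 * c < x0} (\<lambda>w. c * k ((cmod w)\<^sup>2 * c))"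
    and "(LINT w:{w::complex. w \<noteq> 0 \<and> (cmod w)\<^sup>2 * c < x0}|lborel. c * k ((cmod w)\<^sup>2 * c)) =
      pi * set_lebesgue_integral lborel {0<..<x0} k"
proof -
  let ?D = "{w::complex. w \<noteq> 0 \<and> (cmod w)\<^sup>2 * c < x0}"
  note [measurable] = distr_norm_square(2)[OF c x0] k
  let ?M = "distr (density lborel (\<lambda>w. ennreal (indicator ?D w))) borel (\<lambda>w. (cmod w)\<^sup>2 * c)"
    and ?N = "density lborel (\<lambda>x. ennreal (pi / c * indicator {0<..<x0} x))"
  have MN: "?M = ?N" by (rule distr_norm_square(1)[OF c x0])
  have ck: "(\<lambda>x. c * k x) \<in> borel_measurable borel" by measurable
  have "integrable lborel (\<lambda>x. (pi / c * indicator {0<..<x0} x) *\<^sub>R (c * k x))"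
    using integrable_mult_right[OF int[unfolded set_integrable_def], of pi] c
    by (rule_tac Bochner_Integration.integrable_cong[THEN iffD1, rotated 2]) auto
  then have "integrable ?N (\<lambda>x. c * k x)" by (subst integrable_density) (use c in auto)
  then have 1: "integrable (density lborel (\<lambda>w. ennreal (indicator ?D w))) (\<lambda>w. c * k ((cmod w)\<^sup>2 * c))"
    unfolding MN[symmetric] by (subst (asm) integrable_distr_eq) auto
  then show "set_integrable lborel ?D (\<lambda>w. c * k ((cmod w)\<^sup>2 * c))"
    unfolding set_integrable_def by (subst (asm) integrable_density) auto
  have "set_lebesgue_integral lborel ?D (\<lambda>w. c * k ((cmod w)\<^sup>2 * c)) =
     integral\<^sup>L (density lborel (\<lambda>w. ennreal (indicator ?D w))) (\<lambda>w. c * k ((cmod w)\<^sup>2 * c))"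
    unfolding set_lebesgue_integral_def by (subst integral_density) auto
  also have "\<dots> = integral\<^sup>L ?M (\<lambda>x. c * k x)" by (subst integral_distr) auto
  also have "\<dots> = integral\<^sup>L lborel (\<lambda>x. (pi / c * indicator {0<..<x0} x) *\<^sub>R (c * k x))"
    unfolding MN by (subst integral_density) (use c in auto)
  also have "\<dots> = integral\<^sup>L lborel (\<lambda>x. pi * (indicator {0<..<x0} x *\<^sub>R k x))"
    using c by (intro Bochner_Integration.integral_cong) auto
  also have "\<dots> = pi * set_lebesgue_integral lborel {0<..<x0} k"
    unfolding set_lebesgue_integral_def by simp
  finally show "set_lebesgue_integral lborel ?D (\<lambda>w. c * k ((cmod w)\<^sup>2 * c)) =
      pi * set_lebesgue_integral lborel {0<..<x0} k" .
qed

text \<open>The radial case \<open>k x = 1 / sqrt x\<close> with \<open>c = 1\<close>, where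
  \<open>2 sqrt x\<close> is a primitive. It provides the majorant for dominated
  convergence.\<close>

lemma integrable_inverse_norm:
  fixes M :: real
  assumes "M > 0"
  shows "set_integrable lborel {w::complex. w \<noteq> 0 \<and> cmod w < M} (\<lambda>w. 1 / cmod w)"
proof -
  have "set_integrable lborel (einterval (ereal 0) (ereal (M\<^sup>2))) (\<lambda>x. 1 / sqrt x)"
  proof (rule interval_integral_FTC_nonneg)
    show "(((\<lambda>x. 2 * sqrt x) \<circ> real_of_ereal) \<longlongrightarrow> 2 * sqrt 0) (at_right (ereal 0))"
      unfolding ereal_tendsto_simps by (intro tendsto_intros)
    show "(((\<lambda>x. 2 * sqrt x) \<circ> real_of_ereal) \<longlongrightarrow> 2 * sqrt (M\<^sup>2)) (at_left (ereal (M\<^sup>2)))"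
      unfolding ereal_tendsto_simps by (intro tendsto_intros)
    fix x assume "ereal 0 < ereal x"
    then have "x > 0" by simp
    then show "((\<lambda>x. 2 * sqrt x) has_real_derivative 1 / sqrt x) (at x)" "isCont (\<lambda>x. 1 / sqrt x) x"
      by (auto intro!: derivative_eq_intros continuous_intros simp: field_simps)
  qed (use assms in \<open>auto intro!: always_eventually\<close>)
  then have "set_integrable lborel {0<..<M\<^sup>2} (\<lambda>x. 1 / sqrt x)" by simp
  from radial_integral(1)[OF zero_less_one _ _ this] assms
  have "set_integrable lborel {w::complex. w \<noteq> 0 \<and> (cmod w)\<^sup>2 < M\<^sup>2} (\<lambda>w. 1 / cmod w)"
    by simp
  moreover have "(cmod w)\<^sup>2 < M\<^sup>2 \<longleftrightarrow> cmod w < M" for w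
    using assms by (auto intro: power2_less_imp_less power_strict_mono)
  ultimately show ?thesis by simp
qed

lemma integrable_lborel_prodI:
  fixes F :: "complex \<times> complex \<Rightarrow> 'b::{banach, second_countable_topology}"
  assumes F: "F \<in> borel_measurable lborel"
    and z: "integrable lborel k"
    and w: "\<And>z. integrable lborel (\<lambda>w. F (z, w))"
    and n: "\<And>z. (\<integral>w. norm (F (z, w)) \<partial>lborel) \<le> k z"
  shows "integrable lborel F" unfolding lborel_prod[symmetric]
proof (rule lborel_pair.Fubini_integrable)
  show F': "F \<in> borel_measurable (lborel \<Otimes>\<^sub>M lborel)" using F by (simp add: lborel_prod)
  show "integrable lborel (\<lambda>z. \<integral>w. norm (F (z, w)) \<partial>lborel)"
  proof (rule Bochner_Integration.integrable_bound[OF z])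
    show "(\<lambda>z. \<integral>w. norm (F (z, w)) \<partial>lborel) \<in> borel_measurable lborel"
      using F' by measurable
    show "AE z in lborel. norm (\<integral>w. norm (F (z, w)) \<partial>lborel) \<le> norm (k z)"
    proof (intro always_eventually allI)
      fix z
      have "0 \<le> (\<integral>w. norm (F (z, w)) \<partial>lborel)" by simp
      then show "norm (\<integral>w. norm (F (z, w)) \<partial>lborel) \<le> norm (k z)" using n[of z] by simp
    qed
  qed
qed (use w in auto)

text \<open>The situation over one piece of the base seen in a chart: \<open>B\<close> is the piece,
  \<open>Kc\<close> a compact set containing it, on which the data of the chart are bounded, and
  \<open>r < r0\<close> a tube around the zero section.\<close>

locale calabi_weak = calabi_local U g H + profile f \<phi> m \<beta>
  for U g H f \<phi> m \<beta> +
  fixes B Kc :: "complex set" and r0 :: real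
  assumes Kc: "compact Kc" "Kc \<subseteq> U" and B: "B \<in> sets borel" "B \<subseteq> Kc" and r0: "r0 > 0"
begin

text \<open>The zero section is cut out because the conical form is meaningful only off it; as a
  null set it does not affect the integrals.\<close>

definition TB :: "c2 set" where "TB = {q. fst q \<in> B \<and> snd q \<noteq> 0 \<and> r q < r0}"

lemma S_open: "open {q\<in>\<Omega>. snd q \<noteq> 0}"
proof -
  have "{q\<in>\<Omega>. snd q \<noteq> 0} = \<Omega> \<inter> snd -` (- {0})" by auto
  then show ?thesis using open_\<Omega> by (auto intro!: open_Int open_vimage_snd)
qed

lemma measurable_on_S:
  fixes F :: "c2 \<Rightarrow> 'b::{banach, second_countable_topology}"
  assumes "continuous_on {q\<in>\<Omega>. snd q \<noteq> 0} F" "T \<in> sets borel" "T \<subseteq> {q\<in>\<Omega>. snd q \<noteq> 0}"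
  shows "set_borel_measurable lborel T F"
proof (rule set_borel_measurable_subset[OF _ _ assms(3)])
  show "set_borel_measurable lborel {q\<in>\<Omega>. snd q \<noteq> 0} F"
    unfolding set_borel_measurable_def
    using borel_measurable_continuous_on_indicator[OF _ assms(1)] S_open by simp
qed (use assms in simp)

lemma B_U: "z \<in> B \<Longrightarrow> z \<in> U" using B Kc by blast

lemma TB_sub: "TB \<subseteq> {q\<in>\<Omega>. snd q \<noteq> 0}"
  using B_U by (auto simp: TB_def \<Omega>_def)

lemma r_pos: "q \<in> \<Omega> \<Longrightarrow> snd q \<noteq> 0 \<Longrightarrow> r q > 0"
  using H_pos by (auto simp: r_def \<Omega>_def)

lemma TB_sets: "TB \<in> sets borel"
proof -
  have "open ({q\<in>\<Omega>. snd q \<noteq> 0} \<inter> r -` {..<r0})"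
    by (rule continuous_open_preimage[OF continuous_on_subset[OF continuous_r] S_open]) auto
  moreover have "B \<times> UNIV \<in> sets (borel :: c2 measure)"
    using B by (simp add: borel_prod[symmetric])
  moreover have "TB = ({q\<in>\<Omega>. snd q \<noteq> 0} \<inter> r -` {..<r0}) \<inter> (B \<times> UNIV)"
    using B_U by (auto simp: TB_def \<Omega>_def)
  ultimately show ?thesis by auto
qed

lemma continuous_W1_r: "\<delta> \<ge> 0 \<Longrightarrow> continuous_on {q\<in>\<Omega>. snd q \<noteq> 0} (\<lambda>q. W1 \<delta> (r q))"
  by (rule continuous_on_compose2[of "{0<..}" "W1 \<delta>"])
     (auto intro!: continuous_at_imp_continuous_on[of "{0<..}"] W1_isCont mem_Jd r_pos
        continuous_on_subset[OF continuous_r])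

lemma continuous_fst_S: "continuous_on U A \<Longrightarrow> continuous_on {q\<in>\<Omega>. snd q \<noteq> 0} (\<lambda>q. A (fst q))"
  by (rule continuous_on_compose2[of U A]) (auto intro!: continuous_intros simp: \<Omega>_def)

lemma continuous_H: "continuous_on U H" and continuous_g: "continuous_on U g"
  using smooth_H smooth_g smooth_on_imp_continuous_on by blast+

lemma set_integrable_B:
  fixes A :: "complex \<Rightarrow> 'b::euclidean_space"
  assumes "continuous_on U A"
  shows "set_integrable lborel B A"
proof -
  have "continuous_on Kc A" using assms Kc continuous_on_subset by blast
  from borel_integrable_compact[OF Kc(1) this]
  have "set_integrable lborel Kc A" unfolding set_integrable_def by simp
  then show ?thesis by (rule set_integrable_subset) (use B in auto)
qed

text \<open>Since \<open>W1 \<delta>\<close> is the derivative of \<open>W \<delta>\<close>, the integral over a fibre is a boundary term; the limit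
  of \<open>W \<delta>\<close> at the zero section jumps from \<open>1\<close> to \<open>\<beta>\<close> at \<open>\<delta> = 0\<close>.\<close>

lemma fibre_integral:
  fixes A :: "complex \<Rightarrow> complex"
  assumes A: "continuous_on U A" and \<delta>: "\<delta> \<ge> 0"
  shows "set_integrable lborel TB (\<lambda>q. A (fst q) * complex_of_real (H (fst q) * W1 \<delta> (r q)))"
    and "(LINT q:TB|lborel. A (fst q) * complex_of_real (H (fst q) * W1 \<delta> (r q))) =
      complex_of_real (pi * (W \<delta> r0 - (if \<delta> = 0 then \<beta> else 1))) * set_lebesgue_integral lborel B A"
proof -
  define k where "k x = indicator {0<..} x *\<^sub>R W1 \<delta> x" for x
  have "continuous_on {0<..} (W1 \<delta>)"
    by (intro continuous_at_imp_continuous_on ballI W1_isCont mem_Jd \<delta>) (use \<delta> in auto)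
  then have k: "k \<in> borel_measurable borel"
    unfolding k_def[abs_def] by (intro borel_measurable_continuous_on_indicator) auto
  have W: "set_lebesgue_integral lborel {0<..<r0} k = W \<delta> r0 - (if \<delta> = 0 then \<beta> else 1)"
    unfolding W1_integral(2)[OF r0 \<delta>, symmetric]
    by (intro set_lebesgue_integral_cong) (auto simp: k_def)
  have ki: "set_integrable lborel {0<..<r0} k"
    using W1_integral(1)[OF r0 \<delta>] by (rule set_integrable_cong[THEN iffD1, rotated -1]) (auto simp: k_def)
  have kai: "set_integrable lborel {0<..<r0} (\<lambda>x. \<bar>k x\<bar>)"
    using set_integrable_abs[OF ki] .
  have ka: "(\<lambda>x. \<bar>k x\<bar>) \<in> borel_measurable borel" using k by measurable
  define Ka where "Ka = pi * (LINT x:{0<..<r0}|lborel. \<bar>k x\<bar>)"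
  define F where "F q = indicator TB q *\<^sub>R (A (fst q) * complex_of_real (H (fst q) * W1 \<delta> (r q)))" for q
  have Feq: "F (z, w) = (indicator B z *\<^sub>R A z) * of_real (indicator {w. w \<noteq> 0 \<and> (cmod w)\<^sup>2 * H z < r0} w *\<^sub>R
      (H z * k ((cmod w)\<^sup>2 * H z)))" for z w
    using H_pos[OF B_U, of z] by (auto simp: F_def TB_def k_def r_def indicator_def)
  have Fn: "norm (F (z, w)) = norm (indicator B z *\<^sub>R A z) * (indicator {w. w \<noteq> 0 \<and> (cmod w)\<^sup>2 * H z < r0} w *\<^sub>R
      (H z * \<bar>k ((cmod w)\<^sup>2 * H z)\<bar>))" for z w
    unfolding Feq norm_mult using H_pos[OF B_U, of z] by (auto simp: indicator_def norm_mult abs_mult)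
  note ri = radial_integral[OF H_pos[OF B_U] r0 k ki, unfolded set_integrable_def set_lebesgue_integral_def]
  note ra = radial_integral[OF H_pos[OF B_U] r0 ka kai, unfolded set_integrable_def set_lebesgue_integral_def]
  have Fi: "integrable lborel F"
  proof (rule integrable_lborel_prodI)
    have "set_borel_measurable lborel TB (\<lambda>q. A (fst q) * complex_of_real (H (fst q) * W1 \<delta> (r q)))"
      by (intro measurable_on_S TB_sets TB_sub continuous_intros continuous_fst_S A continuous_W1_r \<delta> continuous_H)
    then show "F \<in> borel_measurable lborel" unfolding set_borel_measurable_def F_def[abs_def] .
    show "integrable lborel (\<lambda>z. norm (indicator B z *\<^sub>R A z) * Ka)"
      using set_integrable_B[OF A] unfolding set_integrable_def
      by (intro integrable_mult_left integrable_norm)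
    fix z
    show "integrable lborel (\<lambda>w. F (z, w))"
    proof (cases "z \<in> B")
      case True
      show ?thesis unfolding Feq by (intro integrable_mult_right integrable_of_real ri(1) True)
    qed (simp add: Feq)
    show "(\<integral>w. norm (F (z, w)) \<partial>lborel) \<le> norm (indicator B z *\<^sub>R A z) * Ka"
    proof (cases "z \<in> B")
      case True
      show ?thesis unfolding Fn Ka_def set_lebesgue_integral_def using ra(2)[OF True] by simp
    qed (simp add: Feq)
  qed
  then show "set_integrable lborel TB (\<lambda>q. A (fst q) * complex_of_real (H (fst q) * W1 \<delta> (r q)))"
    unfolding set_integrable_def F_def .
  have "(LINT q:TB|lborel. A (fst q) * complex_of_real (H (fst q) * W1 \<delta> (r q))) =
      (\<integral>z. (\<integral>w. F (z, w) \<partial>lborel) \<partial>lborel)"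
    using lborel_pair.integral_fst'[of F] Fi
    unfolding set_lebesgue_integral_def F_def[symmetric] by (simp add: lborel_prod)
  also have "\<dots> = (\<integral>z. (indicator B z *\<^sub>R A z) *
      complex_of_real (pi * (W \<delta> r0 - (if \<delta> = 0 then \<beta> else 1))) \<partial>lborel)"
  proof (rule Bochner_Integration.integral_cong)
    fix z
    show "(\<integral>w. F (z, w) \<partial>lborel) = (indicator B z *\<^sub>R A z) *
      complex_of_real (pi * (W \<delta> r0 - (if \<delta> = 0 then \<beta> else 1)))"
    proof (cases "z \<in> B")
      case True
      show ?thesis unfolding Feq W[symmetric] set_lebesgue_integral_def ri(2)[OF True, symmetric]
        by (simp only: integral_mult_right_zero integral_complex_of_real)
    qed (simp add: Feq)
  qed simp
  finally show "(LINT q:TB|lborel. A (fst q) * complex_of_real (H (fst q) * W1 \<delta> (r q))) =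
      complex_of_real (pi * (W \<delta> r0 - (if \<delta> = 0 then \<beta> else 1))) * set_lebesgue_integral lborel B A"
    unfolding set_lebesgue_integral_def integral_mult_left_zero by (simp only: mult.commute)
qed

end

lemma bounded_on_compact:
  fixes u :: "'a::topological_space \<Rightarrow> 'b::real_normed_vector"
  assumes "compact K" "continuous_on K u"
  shows "\<exists>C>0. \<forall>x\<in>K. norm (u x) \<le> C"
  using compact_imp_bounded[OF compact_continuous_image[OF assms(2,1)]] unfolding bounded_pos by auto

context calabi_weak
begin

text \<open>The coefficient of \<open>c_2\<close> found in \<open>chern_Gm\<close>;
  \<open>\<delta>\<close> stands for \<open>\<epsilon>^2\<close>, and \<open>\<delta> = 0\<close> is
  the conical metric.\<close>

definition N :: "real \<Rightarrow> c2 \<Rightarrow> complex" where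
  "N \<delta> q = complex_of_real (2 * g (fst q) * H (fst q) * W1 \<delta> (r q) / (2 * pi)\<^sup>2)"

lemma N_integrable: "\<delta> \<ge> 0 \<Longrightarrow> set_integrable lborel TB (N \<delta>)"
proof -
  assume \<delta>: "\<delta> \<ge> 0"
  have "continuous_on U (\<lambda>z. complex_of_real (2 * g z / (2 * pi)\<^sup>2))"
    by (intro continuous_intros continuous_g) auto
  note fibre_integral(1)[OF this \<delta>]
  moreover have "(\<lambda>q. complex_of_real (2 * g (fst q) / (2 * pi)\<^sup>2) * complex_of_real (H (fst q) * W1 \<delta> (r q))) = N \<delta>"
    by (simp add: N_def fun_eq_iff)
  ultimately show ?thesis by (simp only:)
qed

lemma TB_norm_bound: "\<exists>M>0. \<forall>q\<in>TB. cmod (snd q) < M"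
proof -
  have "continuous_on Kc (\<lambda>z. inverse (H z))"
    using continuous_on_subset[OF continuous_H Kc(2)]
  proof (rule continuous_on_inverse)
    show "\<forall>z\<in>Kc. H z \<noteq> 0" using H_pos Kc by (metis less_irrefl subsetD)
  qed
  then obtain C where C: "C > 0" "\<forall>z\<in>Kc. norm (inverse (H z)) \<le> C"
    using bounded_on_compact Kc by blast
  \<comment> \<open>Adding 1 yields a strict bound without a square root, because
    \<open>(x + 1)^2 > x\<close> for \<open>x \<ge> 0\<close>.\<close>
  have "cmod (snd q) < r0 * C + 1" if q: "q \<in> TB" for q
  proof -
    have z: "fst q \<in> Kc" "H (fst q) > 0" using q B H_pos B_U by (auto simp: TB_def)
    have "(cmod (snd q))\<^sup>2 = r q * inverse (H (fst q))" using z by (simp add: r_def)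
    also have "\<dots> \<le> r0 * C" using q z C r0 by (intro mult_mono) (auto simp: TB_def)
    finally have "(cmod (snd q))\<^sup>2 \<le> r0 * C" .
    moreover have "(r0 * C + 1)\<^sup>2 > r0 * C"
      using C r0 by (simp add: power2_eq_square algebra_simps add_pos_nonneg)
    ultimately show ?thesis using C r0 by (intro power2_less_imp_less[of "cmod (snd q)"]) auto
  qed
  then show ?thesis using C r0 by (intro exI[of _ "r0 * C + 1"]) (auto intro: add_pos_pos)
qed

end

section \<open>The weak limit over one piece, against a test function\<close>

locale calabi_test = calabi_weak U g H f \<phi> m \<beta> B Kc r0
  for U g H f \<phi> m \<beta> B Kc r0 +
  fixes \<psi> :: "c2 \<Rightarrow> complex"
  assumes smooth_\<psi>: "smooth_on \<Omega> \<psi>"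
    and supp_\<psi>: "\<And>q. q \<in> \<Omega> \<Longrightarrow> r q \<ge> r0 \<Longrightarrow> \<psi> q = 0"
begin

text \<open>The derivatives in the fibre directions \<open>1\<close> and \<open>\<i>\<close> are
  bounded on a compact set, and each disc \<open>cball 0 M\<close> is convex, so the mean value
  inequality gives a constant uniform in the base point.\<close>

lemma \<psi>_lipschitz: "\<exists>C>0. \<forall>z\<in>Kc. \<forall>w. cmod w \<le> M \<longrightarrow> cmod (\<psi> (z, w) - \<psi> (z, 0)) \<le> C * cmod w"
proof -
  let ?D = "\<lambda>v q. frechet_derivative \<psi> (at q) (0, v)"
  have sub: "Kc \<times> cball 0 M \<subseteq> \<Omega>" using Kc by (auto simp: \<Omega>_def)
  have cpt: "compact (Kc \<times> cball (0::complex) M)" using Kc by (intro compact_Times) auto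
  have cont: "continuous_on (Kc \<times> cball 0 M) (?D v)" for v
    using smooth_on_imp_continuous_on[OF smooth_on_frechet[OF smooth_\<psi>]] continuous_on_subset sub by blast
  obtain C1 where C1: "C1 > 0" "\<forall>q\<in>Kc \<times> cball 0 M. norm (?D 1 q) \<le> C1"
    using bounded_on_compact[OF cpt cont] by blast
  obtain C2 where C2: "C2 > 0" "\<forall>q\<in>Kc \<times> cball 0 M. norm (?D \<i> q) \<le> C2"
    using bounded_on_compact[OF cpt cont] by blast
  have "cmod (\<psi> (z, w) - \<psi> (z, 0)) \<le> (C1 + C2) * cmod w" if z: "z \<in> Kc" and w: "cmod w \<le> M" for z w
  proof -
    have M: "M \<ge> 0" using w norm_ge_zero order_trans by blast
    have "norm (\<psi> (z, w) - \<psi> (z, 0)) \<le> (C1 + C2) * norm (w - 0)"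
    proof (rule differentiable_bound[of "cball 0 M" "\<lambda>w. \<psi> (z, w)" "\<lambda>y v. ?D v (z, y)"])
      fix y :: complex assume y: "y \<in> cball 0 M"
      then have dif: "\<psi> differentiable (at (z, y))"
        using smooth_on_imp_differentiable[OF smooth_\<psi>] z subsetD[OF sub, of "(z, y)"] by simp
      have "((\<lambda>w. (z, w)) has_derivative (\<lambda>v. (0, v))) (at y)"
        by (auto intro!: derivative_eq_intros)
      from diff_chain_at[OF this, of \<psi> "frechet_derivative \<psi> (at (z, y))"] dif
      have D: "((\<lambda>w. \<psi> (z, w)) has_derivative (\<lambda>v. ?D v (z, y))) (at y)"
        by (simp add: comp_def frechet_derivative_works)
      then show "((\<lambda>w. \<psi> (z, w)) has_derivative (\<lambda>v. ?D v (z, y))) (at y within cball 0 M)"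
        by (rule has_derivative_at_withinI)
      have lin: "linear (\<lambda>v. ?D v (z, y))" using D has_derivative_linear by blast
      show "onorm (\<lambda>v. ?D v (z, y)) \<le> C1 + C2"
      proof (rule onorm_le)
        fix v :: complex
        have "v = Re v *\<^sub>R 1 + Im v *\<^sub>R \<i>" by (simp add: complex_eq_iff)
        then have "?D v (z, y) = ?D (Re v *\<^sub>R 1 + Im v *\<^sub>R \<i>) (z, y)" by simp
        also have "\<dots> = Re v *\<^sub>R ?D 1 (z, y) + Im v *\<^sub>R ?D \<i> (z, y)"
          unfolding linear_add[OF lin] linear_scale[OF lin] ..
        also have "norm \<dots> \<le> \<bar>Re v\<bar> * C1 + \<bar>Im v\<bar> * C2"
          using C1 C2 z y by (intro order_trans[OF norm_triangle_ineq] add_mono) (auto intro!: mult_left_mono)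
        also have "\<dots> \<le> cmod v * C1 + cmod v * C2"
          using C1 C2 by (intro add_mono mult_right_mono abs_Re_le_cmod abs_Im_le_cmod) auto
        finally show "norm (?D v (z, y)) \<le> (C1 + C2) * norm v" by (simp add: algebra_simps)
      qed
    qed (use w M in auto)
    then show ?thesis by simp
  qed
  then show ?thesis using C1 C2 by (intro exI[of _ "C1 + C2"]) auto
qed

lemma continuous_\<psi>: "continuous_on \<Omega> \<psi>"
  using smooth_\<psi> smooth_on_imp_continuous_on by blast

lemma continuous_\<psi>0: "continuous_on U (\<lambda>z. \<psi> (z, 0))"
  by (rule continuous_on_compose2[OF continuous_\<psi>]) (auto intro!: continuous_intros simp: \<Omega>_def)

lemma continuous_N: "\<delta> \<ge> 0 \<Longrightarrow> continuous_on {q\<in>\<Omega>. snd q \<noteq> 0} (N \<delta>)"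
  unfolding N_def[abs_def]
  by (intro continuous_intros continuous_fst_S continuous_g continuous_H continuous_W1_r) auto

lemma continuous_N_pos: "\<delta> > 0 \<Longrightarrow> continuous_on \<Omega> (N \<delta>)"
proof -
  assume \<delta>: "\<delta> > 0"
  have 1: "continuous_on \<Omega> (\<lambda>q. W1 \<delta> (r q))"
    by (rule continuous_on_compose2[of "{0..}" "W1 \<delta>"])
       (use \<delta> in \<open>auto intro!: continuous_at_imp_continuous_on[of "{0..}"] W1_isCont mem_Jd r_nonneg continuous_r\<close>)
  have 2: "continuous_on \<Omega> (\<lambda>q. A (fst q))" if "continuous_on U A" for A :: "complex \<Rightarrow> real"
    by (rule continuous_on_compose2[OF that]) (auto intro!: continuous_intros simp: \<Omega>_def)
  show ?thesis unfolding N_def[abs_def]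
    by (intro continuous_intros 1 2 continuous_g continuous_H) auto
qed

text \<open>The factor \<open>\<bar>w\<bar>\<close> gained by subtracting the value at \<open>w = 0\<close> turns the bound \<open>C / \<bar>w\<bar>\<^sup>2\<close>, which
  is uniform in \<open>\<delta>\<close> but not integrable, into an integrable one.\<close>

lemma error_bound:
  "\<exists>G. set_integrable lborel TB G \<and>
     (\<forall>\<delta>\<in>{0..1}. \<forall>q\<in>TB. norm (4 * ((\<psi> q - \<psi> (fst q, 0)) * N \<delta> q)) \<le> G q)"
proof -
  obtain M where M: "M > 0" "\<forall>q\<in>TB. cmod (snd q) < M" using TB_norm_bound by blast
  obtain C where C: "C > 0" "\<forall>z\<in>Kc. \<forall>w. cmod w \<le> M \<longrightarrow> cmod (\<psi> (z, w) - \<psi> (z, 0)) \<le> C * cmod w"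
    using \<psi>_lipschitz by blast
  obtain Cg where Cg: "Cg > 0" "\<forall>z\<in>Kc. norm (g z) \<le> Cg"
    using bounded_on_compact[OF Kc(1) continuous_on_subset[OF continuous_g Kc(2)]] by blast
  obtain CW where CW: "CW > 0" "\<forall>\<delta>\<in>{0..1}. \<forall>x\<in>{0<..r0}. \<bar>W1 \<delta> x\<bar> \<le> CW / x"
    using W1_bound by blast
  define K where "K = 4 * C * (2 * Cg * CW / (2 * pi)\<^sup>2)"
  define D where "D = {w::complex. w \<noteq> 0 \<and> cmod w < M}"
  define F where "F q = indicator B (fst q) *\<^sub>R (indicator D (snd q) *\<^sub>R (1 / cmod (snd q)))" for q :: c2
  have Di: "integrable lborel (\<lambda>w. indicator D w *\<^sub>R (1 / cmod w))"
    using integrable_inverse_norm[OF M(1)] unfolding D_def set_integrable_def .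
  define I where "I = (\<integral>w. indicator D w *\<^sub>R (1 / cmod w) \<partial>lborel)"
  have "integrable lborel F"
  proof (rule integrable_lborel_prodI)
    have [measurable]: "B \<in> sets borel" using B by blast
    have "D = {w. cmod w < M} - {0}" by (auto simp: D_def)
    then have [measurable]: "D \<in> sets borel" by simp
    have [measurable]: "(\<lambda>w. indicator D w *\<^sub>R (1 / cmod w)) \<in> borel_measurable lborel"
      by measurable
    show "F \<in> borel_measurable lborel"
      unfolding F_def[abs_def] lborel_prod[symmetric] by measurable
    show "integrable lborel (\<lambda>z. (indicator B z *\<^sub>R 1) * I)"
      using set_integrable_B[of "\<lambda>_. 1::real"] unfolding set_integrable_def
      by (intro integrable_mult_left) auto
    fix z
    show "integrable lborel (\<lambda>w. F (z, w))"
      unfolding F_def fst_conv snd_conv by (intro integrable_scaleR_right Di)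
    have "norm (F (z, w)) = indicator B z * (indicator D w *\<^sub>R (1 / cmod w))" for w
      by (simp add: F_def indicator_def)
    then show "(\<integral>w. norm (F (z, w)) \<partial>lborel) \<le> (indicator B z *\<^sub>R 1) * I"
      unfolding I_def by (simp only: integral_mult_right_zero real_scaleR_def mult_1_right order.refl)
  qed
  then have "integrable lborel (\<lambda>q. K * F q)" by simp
  then have "set_integrable lborel TB (\<lambda>q. K * F q)"
    unfolding set_integrable_def real_scaleR_def
    using integrable_mult_indicator[of TB lborel "\<lambda>q. K * F q"] TB_sets by simp
  moreover have "norm (4 * ((\<psi> q - \<psi> (fst q, 0)) * N \<delta> q)) \<le> K * F q" if \<delta>: "\<delta> \<in> {0..1}" and q: "q \<in> TB" for \<delta> q
  proof -
    let ?z = "fst q" and ?w = "snd q"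
    have z: "?z \<in> B" "?z \<in> Kc" "?z \<in> U" using q B B_U by (auto simp: TB_def)
    have w: "?w \<noteq> 0" "cmod ?w < M" using M(2)[rule_format, OF q] q by (auto simp: TB_def)
    have r: "0 < r q" "r q < r0" using subsetD[OF TB_sub q] q r_pos[of q] by (auto simp: TB_def)
    have Hp: "H ?z > 0" "g ?z > 0" using H_pos g_pos z by auto
    have 1: "cmod (\<psi> q - \<psi> (?z, 0)) \<le> C * cmod ?w"
      using C(2) z w by (metis less_imp_le prod.collapse)
    have "\<bar>W1 \<delta> (r q)\<bar> \<le> CW / r q" using CW \<delta> r by auto
    then have "H ?z * \<bar>W1 \<delta> (r q)\<bar> \<le> H ?z * (CW / r q)" using Hp by (intro mult_left_mono) auto
    also have "\<dots> = CW / (cmod ?w)\<^sup>2" using Hp by (simp add: r_def)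
    finally have 2: "H ?z * \<bar>W1 \<delta> (r q)\<bar> \<le> CW / (cmod ?w)\<^sup>2" .
    have "norm (N \<delta> q) = 2 * g ?z * (H ?z * \<bar>W1 \<delta> (r q)\<bar>) / (2 * pi)\<^sup>2"
      unfolding N_def norm_of_real using Hp by (simp add: abs_mult)
    also have "\<dots> \<le> 2 * Cg * (CW / (cmod ?w)\<^sup>2) / (2 * pi)\<^sup>2"
    proof (intro divide_right_mono mult_mono 2)
      show "g ?z \<le> Cg" using Cg z Hp by fastforce
    qed (use Hp Cg in auto)
    finally have 3: "norm (N \<delta> q) \<le> 2 * Cg * (CW / (cmod ?w)\<^sup>2) / (2 * pi)\<^sup>2" .
    have "norm (4 * ((\<psi> q - \<psi> (?z, 0)) * N \<delta> q)) \<le> 4 * ((C * cmod ?w) * (2 * Cg * (CW / (cmod ?w)\<^sup>2) / (2 * pi)\<^sup>2))"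
      unfolding norm_mult using 1 3 C by (intro mult_mono) auto
    also have "\<dots> = K * F q"
      using w z by (simp add: K_def F_def D_def power2_eq_square field_simps)
    finally show ?thesis .
  qed
  ultimately show ?thesis by blast
qed

lemma error_integrable:
  assumes "\<delta> \<in> {0..1}"
  shows "set_integrable lborel TB (\<lambda>q. 4 * ((\<psi> q - \<psi> (fst q, 0)) * N \<delta> q))"
proof -
  obtain G where G: "set_integrable lborel TB G"
     "\<forall>\<delta>\<in>{0..1}. \<forall>q\<in>TB. norm (4 * ((\<psi> q - \<psi> (fst q, 0)) * N \<delta> q)) \<le> G q"
    using error_bound by blast
  show ?thesis
  proof (rule set_integrable_bound[OF G(1)])
    show "set_borel_measurable lborel TB (\<lambda>q. 4 * ((\<psi> q - \<psi> (fst q, 0)) * N \<delta> q))"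
      by (intro measurable_on_S TB_sets TB_sub continuous_intros continuous_N continuous_fst_S continuous_\<psi>0
          continuous_on_subset[OF continuous_\<psi>]) (use assms in auto)
  qed (use G(2) assms in \<open>auto intro!: always_eventually order_trans[OF _ abs_ge_self]\<close>)
qed

text \<open>Dominated convergence along sequences in \<open>(0, 1)\<close>, which determine the
  limit from the right. Pointwise convergence holds because \<open>r q > 0\<close> on
  \<open>TB\<close>.\<close>

lemma error_tendsto:
  "((\<lambda>\<delta>. (LINT q:TB|lborel. 4 * ((\<psi> q - \<psi> (fst q, 0)) * N \<delta> q))) \<longlongrightarrow>
     (LINT q:TB|lborel. 4 * ((\<psi> q - \<psi> (fst q, 0)) * N 0 q))) (at_right 0)"
proof -
  obtain G where G: "set_integrable lborel TB G"
     "\<forall>\<delta>\<in>{0..1}. \<forall>q\<in>TB. norm (4 * ((\<psi> q - \<psi> (fst q, 0)) * N \<delta> q)) \<le> G q"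
    using error_bound by blast
  show ?thesis
  proof (rule tendsto_at_right_sequentially[of 0 1])
    fix S :: "nat \<Rightarrow> real"
    assume S: "\<And>n. 0 < S n" "\<And>n. S n < 1" "S \<longlonglongrightarrow> 0"
    have Sr: "filterlim S (at_right 0) sequentially"
      unfolding filterlim_at using S by (auto intro!: always_eventually simp: less_imp_neq[symmetric])
    show "(\<lambda>n. (LINT q:TB|lborel. 4 * ((\<psi> q - \<psi> (fst q, 0)) * N (S n) q))) \<longlonglongrightarrow>
       (LINT q:TB|lborel. 4 * ((\<psi> q - \<psi> (fst q, 0)) * N 0 q))"
      unfolding set_lebesgue_integral_def
    proof (rule integral_dominated_convergence)
      show "(\<lambda>q. indicator TB q *\<^sub>R (4 * ((\<psi> q - \<psi> (fst q, 0)) * N 0 q))) \<in> borel_measurable lborel"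
        using error_integrable[of 0] unfolding set_integrable_def by auto
      show "(\<lambda>q. indicator TB q *\<^sub>R (4 * ((\<psi> q - \<psi> (fst q, 0)) * N (S n) q))) \<in> borel_measurable lborel" for n
        using error_integrable[of "S n"] S(1,2)[of n] unfolding set_integrable_def by auto
      show "integrable lborel (\<lambda>q. indicator TB q *\<^sub>R G q)"
        using G(1) unfolding set_integrable_def .
      show "AE q in lborel. norm (indicator TB q *\<^sub>R (4 * ((\<psi> q - \<psi> (fst q, 0)) * N (S n) q))) \<le> indicator TB q *\<^sub>R G q" for n
        using G(2) S(1,2)[of n] by (auto intro!: always_eventually simp: indicator_def less_imp_le)
      show "AE q in lborel. (\<lambda>n. indicator TB q *\<^sub>R (4 * ((\<psi> q - \<psi> (fst q, 0)) * N (S n) q))) \<longlonglongrightarrow>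
          indicator TB q *\<^sub>R (4 * ((\<psi> q - \<psi> (fst q, 0)) * N 0 q))"
      proof (intro always_eventually allI)
        fix q
        show "(\<lambda>n. indicator TB q *\<^sub>R (4 * ((\<psi> q - \<psi> (fst q, 0)) * N (S n) q))) \<longlonglongrightarrow>
          indicator TB q *\<^sub>R (4 * ((\<psi> q - \<psi> (fst q, 0)) * N 0 q))"
        proof (cases "q \<in> TB")
          case True
          then have "r q > 0" using subsetD[OF TB_sub True] by (simp add: r_pos)
          from filterlim_compose[OF W_tendsto(2)[OF this] Sr]
          have "(\<lambda>n. W1 (S n) (r q)) \<longlonglongrightarrow> W1 0 (r q)" .
          then show ?thesis unfolding N_def by (intro tendsto_intros) auto
        qed simp
      qed
    qed
  qed simp
qed

text \<open>Let \<open>X \<delta>\<close> be the error integral and \<open>Y\<close> the integral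
  over the divisor. For \<open>\<delta> > 0\<close> the integral is
  \<open>X \<delta> + (W \<delta> r0 - 1) Y / pi\<close>, at \<open>\<delta> = 0\<close> it is
  \<open>X 0 + (W 0 r0 - \<beta>) Y / pi\<close>. Since \<open>X\<close> and \<open>W\<close> at
  \<open>r0\<close> converge, the defect is \<open>(\<beta> - 1) Y / pi\<close>, independent of
  \<open>r0\<close>.\<close>

lemma weak_limit:
  "((\<lambda>\<delta>. (LINT q:B \<times> UNIV|lborel. 4 * (\<psi> q * N \<delta> q))) \<longlongrightarrow>
     (LINT q:{q \<in> B \<times> UNIV. snd q \<noteq> 0}|lborel. 4 * (\<psi> q * N 0 q))
     + complex_of_real ((\<beta> - 1) / pi) * (LINT z:B|lborel. 2 * (\<psi> (z, 0) * complex_of_real (g z))))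
   (at_right 0)"
proof -
  define A where "A z = 4 * \<psi> (z, 0) * complex_of_real (2 * g z / (2 * pi)\<^sup>2)" for z
  define Y where "Y = (LINT z:B|lborel. 2 * (\<psi> (z, 0) * complex_of_real (g z)))"
  define X where "X \<delta> = (LINT q:TB|lborel. 4 * ((\<psi> q - \<psi> (fst q, 0)) * N \<delta> q))" for \<delta>
  have A: "continuous_on U A"
    unfolding A_def by (intro continuous_intros continuous_\<psi>0 continuous_g) auto
  \<comment> \<open>The constants combine to \<open>pi * 4 * 2 / (2 pi)^2 = 2 / pi\<close>, and
    \<open>Y\<close> already contains the factor 2.\<close>
  have AY: "complex_of_real pi * set_lebesgue_integral lborel B A = Y / pi"
  proof -
    have "A = (\<lambda>z. (1 / pi\<^sup>2) * (2 * (\<psi> (z, 0) * complex_of_real (g z))))"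
      by (auto simp: A_def fun_eq_iff field_simps power2_eq_square)
    then have "set_lebesgue_integral lborel B A = (1 / pi\<^sup>2) * Y"
      unfolding Y_def by (simp only: set_integral_mult_right)
    then show ?thesis by (simp add: power2_eq_square)
  qed
  have N0: "A (fst q) * complex_of_real (H (fst q) * W1 \<delta> (r q)) = 4 * (\<psi> (fst q, 0) * N \<delta> q)" for \<delta> q
    by (simp add: A_def N_def)
  have TB: "(LINT q:TB|lborel. 4 * (\<psi> q * N \<delta> q)) =
      X \<delta> + of_real (W \<delta> r0 - (if \<delta> = 0 then \<beta> else 1)) * (Y / pi)" if \<delta>: "\<delta> \<in> {0..1}" for \<delta>
  proof -
    note fi = fibre_integral[OF A, of \<delta>, unfolded N0]
    have "(LINT q:TB|lborel. 4 * (\<psi> q * N \<delta> q)) =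
       (LINT q:TB|lborel. 4 * ((\<psi> q - \<psi> (fst q, 0)) * N \<delta> q) + 4 * (\<psi> (fst q, 0) * N \<delta> q))"
      by (simp add: algebra_simps)
    also have "\<dots> = X \<delta> + (LINT q:TB|lborel. 4 * (\<psi> (fst q, 0) * N \<delta> q))"
      unfolding X_def using error_integrable[OF \<delta>] fi(1) \<delta> by (intro set_integral_add) auto
    also have "(LINT q:TB|lborel. 4 * (\<psi> (fst q, 0) * N \<delta> q)) =
        of_real (W \<delta> r0 - (if \<delta> = 0 then \<beta> else 1)) * (complex_of_real pi * set_lebesgue_integral lborel B A)"
      using fi(2) \<delta> by (simp add: mult_ac)
    finally show ?thesis unfolding AY .
  qed
  have sets: "B \<times> UNIV \<in> sets (lborel :: c2 measure)" using B by (simp add: borel_prod[symmetric])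
  have punct: "(LINT q:{q \<in> B \<times> UNIV. snd q \<noteq> 0}|lborel. 4 * (\<psi> q * N \<delta> q)) =
      (LINT q:TB|lborel. 4 * (\<psi> q * N \<delta> q))" for \<delta>
    unfolding set_lebesgue_integral_def by (intro Bochner_Integration.integral_cong)
       (use B_U supp_\<psi> in \<open>auto simp: indicator_def TB_def \<Omega>_def not_less\<close>)
  \<comment> \<open>Here the zero section belongs to the domain on the left. For
    \<open>\<delta> > 0\<close> the form is continuous across it, which gives measurability, and the
    section is a null set.\<close>
  have full: "(LINT q:B \<times> UNIV|lborel. 4 * (\<psi> q * N \<delta> q)) =
      (LINT q:TB|lborel. 4 * (\<psi> q * N \<delta> q))" if \<delta>: "\<delta> > 0" for \<delta>
  proof -
    have "UNIV \<times> {0} \<in> null_sets (lborel :: c2 measure)"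
      unfolding lborel_prod[symmetric] null_sets_def
      by (auto simp: lborel.emeasure_pair_measure_Times)
    then have ae: "AE q in (lborel :: c2 measure). snd q \<noteq> 0" by (rule AE_I') auto
    have "continuous_on \<Omega> (\<lambda>q. 4 * (\<psi> q * N \<delta> q))"
      by (intro continuous_intros continuous_\<psi> continuous_N_pos \<delta>)
    then have "set_borel_measurable lborel \<Omega> (\<lambda>q. 4 * (\<psi> q * N \<delta> q))"
      unfolding set_borel_measurable_def
      using borel_measurable_continuous_on_indicator[of \<Omega>] open_\<Omega> by simp
    then have "set_borel_measurable lborel (B \<times> UNIV) (\<lambda>q. 4 * (\<psi> q * N \<delta> q))"
      by (rule set_borel_measurable_subset) (use sets B_U in \<open>auto simp: \<Omega>_def\<close>)
    note m1 = this[unfolded set_borel_measurable_def]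
    have "set_borel_measurable lborel TB (\<lambda>q. 4 * (\<psi> q * N \<delta> q))"
      by (intro measurable_on_S TB_sets TB_sub continuous_intros continuous_N
          continuous_on_subset[OF continuous_\<psi>]) (use \<delta> in auto)
    note m2 = this[unfolded set_borel_measurable_def]
    show ?thesis unfolding set_lebesgue_integral_def
      by (rule integral_cong_AE[OF m1 m2], rule eventually_mono[OF ae])
         (use B_U supp_\<psi> in \<open>auto simp: indicator_def TB_def \<Omega>_def not_less\<close>)
  qed
  have "((\<lambda>\<delta>. X \<delta> + of_real (W \<delta> r0 - 1) * (Y / pi)) \<longlongrightarrow> X 0 + of_real (W 0 r0 - 1) * (Y / pi)) (at_right 0)"
    by (intro tendsto_intros W_tendsto(1)[OF r0]) (use error_tendsto in \<open>auto simp: X_def\<close>)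
  moreover have "eventually (\<lambda>\<delta>. X \<delta> + of_real (W \<delta> r0 - 1) * (Y / pi) =
      (LINT q:B \<times> UNIV|lborel. 4 * (\<psi> q * N \<delta> q))) (at_right 0)"
  proof (rule eventually_mono[OF eventually_at_right_real[of 0 1]])
    fix \<delta> :: real assume "\<delta> \<in> {0<..<1}"
    then have d: "\<delta> > 0" "\<delta> \<in> {0..1}" "\<delta> \<noteq> 0" by auto
    show "X \<delta> + of_real (W \<delta> r0 - 1) * (Y / pi) =
      (LINT q:B \<times> UNIV|lborel. 4 * (\<psi> q * N \<delta> q))"
      using d(3) unfolding full[OF d(1)] TB[OF d(2)] by simp
  qed simp
  ultimately have lim: "((\<lambda>\<delta>. (LINT q:B \<times> UNIV|lborel. 4 * (\<psi> q * N \<delta> q))) \<longlongrightarrow>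
     X 0 + of_real (W 0 r0 - 1) * (Y / pi)) (at_right 0)" by (rule Lim_transform_eventually)
  have T0: "(LINT q:TB|lborel. 4 * (\<psi> q * N 0 q)) = X 0 + of_real (W 0 r0 - \<beta>) * (Y / pi)"
    using TB[of 0] by (simp only: if_True atLeastAtMost_iff order.refl zero_le_one simp_thms)
  have "X 0 + of_real (W 0 r0 - 1) * (Y / pi) =
     (LINT q:{q \<in> B \<times> UNIV. snd q \<noteq> 0}|lborel. 4 * (\<psi> q * N 0 q)) + complex_of_real ((\<beta> - 1) / pi) * Y"
    unfolding punct T0 by (simp add: algebra_simps add_divide_distrib diff_divide_distrib)
  with lim show ?thesis unfolding Y_def by simp
qed

end

section \<open>Changes of coordinates\<close>

lemma frechet_wirt:
  assumes "F differentiable (at z)"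
  shows "frechet_derivative F (at z) v = d_z F z * v + d_zbar F z * cnj v"
proof -
  let ?D = "frechet_derivative F (at z)"
  have lin: "linear ?D" using linear_frechet_derivative[OF assms] .
  have "v = Re v *\<^sub>R 1 + Im v *\<^sub>R \<i>" by (simp add: complex_eq_iff)
  then have "?D v = ?D (Re v *\<^sub>R 1 + Im v *\<^sub>R \<i>)" by simp
  also have "\<dots> = Re v *\<^sub>R ?D 1 + Im v *\<^sub>R ?D \<i>"
    unfolding linear_add[OF lin] linear_scale[OF lin] ..
  also have "\<dots> = d_z F z * (Re v + \<i> * Im v) + d_zbar F z * (Re v - \<i> * Im v)"
    by (simp add: d_z_def d_zbar_def field_simps scaleR_conv_of_real)
  also have "complex_of_real (Re v) + \<i> * complex_of_real (Im v) = v"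
    by (simp add: complex_eq_iff)
  also have "complex_of_real (Re v) - \<i> * complex_of_real (Im v) = cnj v"
    by (simp add: complex_eq_iff)
  finally show ?thesis .
qed

lemma d_z_holomorphic:
  assumes "(F has_field_derivative D) (at z)"
  shows "d_z F z = D" "d_z (\<lambda>\<xi>. cnj (F \<xi>)) z = 0"
proof -
  have d: "F differentiable (at z)"
    using assms unfolding has_field_derivative_def differentiable_def by blast
  show "d_z F z = D" unfolding d_z_wirt wirt_holomorphic[OF assms] by simp
  show "d_z (\<lambda>\<xi>. cnj (F \<xi>)) z = 0"
    unfolding d_z_wirt wirt_cnj[OF d] wirt_holomorphic[OF assms] by simp
qed

lemma d_z_comp_holomorphic:
  assumes "F differentiable (at (k z))" "(k has_field_derivative k') (at z)"
  shows "d_z (\<lambda>x. F (k x)) z = d_z F (k z) * k'"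
proof -
  have "((\<lambda>x. F (k x)) has_derivative (\<lambda>v. frechet_derivative F (at (k z)) (k' * v))) (at z)"
    using diff_chain_at[OF assms(2)[unfolded has_field_derivative_def] assms(1)[unfolded frechet_derivative_works]]
    by (simp add: comp_def)
  then show ?thesis unfolding d_z_wirt[of "\<lambda>x. F (k x)"] by (subst wirt_eqI, assumption)
       (simp add: frechet_wirt[OF assms(1)] algebra_simps)
qed

locale calabi_change =
  calabi_local U g H + prim: calabi_local U' g' H' for U g H U' g' H' +
  fixes X :: "complex set" and \<zeta> c :: "complex \<Rightarrow> complex"
  assumes X: "open X" "X \<subseteq> U" and \<zeta>: "\<zeta> holomorphic_on X" "\<zeta> ` X \<subseteq> U'"
    and c: "c holomorphic_on X" and c_nz: "\<And>z. z \<in> X \<Longrightarrow> c z \<noteq> 0"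
    and H_change: "\<And>z. z \<in> X \<Longrightarrow> H z = (cmod (c z))\<^sup>2 * H' (\<zeta> z)"
    and g_change: "\<And>z. z \<in> X \<Longrightarrow> g z = (cmod (deriv \<zeta> z))\<^sup>2 * g' (\<zeta> z)"
begin

definition \<tau> :: "c2 \<Rightarrow> c2" where "\<tau> q = (\<zeta> (fst q), c (fst q) * snd q)"

lemma \<tau>_mem: "fst q \<in> X \<Longrightarrow> \<tau> q \<in> prim.\<Omega>"
  using \<zeta> by (auto simp: \<tau>_def prim.\<Omega>_def)

lemma holo_deriv:
  assumes "z \<in> X"
  shows "(\<zeta> has_field_derivative deriv \<zeta> z) (at z)" "(c has_field_derivative deriv c z) (at z)"
  using holomorphic_derivI[OF \<zeta>(1) X(1) assms] holomorphic_derivI[OF c X(1) assms] by auto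

lemma r_change: "fst q \<in> X \<Longrightarrow> r q = prim.r (\<tau> q)"
  by (simp add: r_def prim.r_def \<tau>_def H_change norm_mult power_mult_distrib)

text \<open>This is \<open>\<partial> ln (c cnj c) = c' / c\<close>, obtained by differentiating the
  product formula for \<open>H\<close> and dividing by it, so that no branch of the logarithm of
  \<open>c\<close> is chosen.\<close>

lemma a_change:
  assumes z: "z \<in> X"
  shows "a z = deriv c z / c z + prim.a (\<zeta> z) * deriv \<zeta> z"
proof -
  note d = holo_deriv[OF z]
  have zU: "z \<in> U" "\<zeta> z \<in> U'" using z X \<zeta> by auto
  have Hd: "(\<lambda>\<xi>. complex_of_real (H' \<xi>)) differentiable (at (\<zeta> z))"
    using smooth_on_imp_differentiable[OF smooth_on_of_real[OF prim.open_U prim.smooth_H]] zU by blast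
  have cd: "c differentiable (at z)" and \<zeta>d: "\<zeta> differentiable (at z)"
    using d unfolding has_field_derivative_def differentiable_def by blast+
  have comp: "(\<lambda>x. complex_of_real (H' (\<zeta> x))) differentiable (at z)"
    using differentiable_chain_at[OF \<zeta>d Hd] by (simp add: comp_def)
  have "a z * H z = d_z (\<lambda>\<xi>. complex_of_real (H \<xi>)) z"
    using dz_log(1)[OF smooth_H H_pos zU(1)] by (simp add: a_def)
  also have "\<dots> = d_z (\<lambda>\<xi>. c \<xi> * cnj (c \<xi>) * complex_of_real (H' (\<zeta> \<xi>))) z"
    unfolding d_z_wirt
    by (rule wirt_cong[OF X(1) z]) (simp only: H_change of_real_mult complex_norm_square)
  also have "\<dots> = (d_z c z * cnj (c z) + c z * d_z (\<lambda>\<xi>. cnj (c \<xi>)) z) * H' (\<zeta> z) +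
      c z * cnj (c z) * d_z (\<lambda>\<xi>. complex_of_real (H' (\<zeta> \<xi>))) z"
    unfolding d_z_wirt using cd comp by (simp add: wirt_mult differentiable_cnj differentiable_mult)
  also have "d_z c z = deriv c z" by (rule d_z_holomorphic(1)[OF d(2)])
  also have "d_z (\<lambda>\<xi>. cnj (c \<xi>)) z = 0" by (rule d_z_holomorphic(2)[OF d(2)])
  also have "d_z (\<lambda>\<xi>. complex_of_real (H' (\<zeta> \<xi>))) z = prim.a (\<zeta> z) * H' (\<zeta> z) * deriv \<zeta> z"
    using d_z_comp_holomorphic[OF Hd d(1)] prim.dz_log(1)[OF prim.smooth_H prim.H_pos zU(2)]
    by (simp add: prim.a_def)
  finally have "a z * (c z * cnj (c z) * H' (\<zeta> z)) =
      deriv c z * cnj (c z) * H' (\<zeta> z) + c z * cnj (c z) * (prim.a (\<zeta> z) * H' (\<zeta> z) * deriv \<zeta> z)"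
    unfolding H_change[OF z] of_real_mult complex_norm_square by simp
  then have "(a z * c z - deriv c z - c z * prim.a (\<zeta> z) * deriv \<zeta> z) * (cnj (c z) * H' (\<zeta> z)) = 0"
    by (simp add: algebra_simps)
  moreover have nz: "complex_of_real (H' (\<zeta> z)) \<noteq> 0" "cnj (c z) \<noteq> 0" "c z \<noteq> 0"
    using prim.H_pos[OF zU(2)] c_nz[OF z] by auto
  ultimately have "a z * c z - deriv c z - c z * prim.a (\<zeta> z) * deriv \<zeta> z = 0" by simp
  then show ?thesis using nz by (simp add: field_simps)
qed

lemma del_\<tau>:
  fixes q :: c2
  assumes q: "fst q \<in> X"
  shows "del k (\<lambda>p. coord i (\<tau> p)) q =
     (if i = 1 then if k = 1 then deriv \<zeta> (fst q) else 0
      else if k = 1 then deriv c (fst q) * snd q else c (fst q))"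
proof -
  note d = holo_deriv[OF q]
  have cd: "c differentiable (at (fst q))" and \<zeta>d: "\<zeta> differentiable (at (fst q))"
    using d unfolding has_field_derivative_def differentiable_def by blast+
  have dz: "d_z c (fst q) = deriv c (fst q)" "d_z \<zeta> (fst q) = deriv \<zeta> (fst q)"
    using d_z_holomorphic[OF d(2)] d_z_holomorphic[OF d(1)] by blast+
  show ?thesis
    using exhaust_2[of i] exhaust_2[of k] wd_fst_comp[OF \<zeta>d] wd_mult[OF wd_fst_comp[OF cd] wd_snd(1)]
    by (auto simp: coord_def \<tau>_def wd_def dz)
qed

text \<open>The term \<open>deriv c / c\<close> in the change of \<open>a\<close> is exactly what
  makes \<open>dw + a w dz\<close> transform by the factor \<open>c\<close>. Since \<open>g\<close>
  and \<open>H\<close> absorb \<open>deriv \<zeta>\<close> and \<open>c\<close>, both parts of the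
  metric are invariant, for every potential.\<close>

lemma Gm_change:
  fixes q :: c2 and J F F1 F2 F3 F4
  assumes q: "fst q \<in> X"
    and pot: "potential J F F1 F2 F3 F4"
  shows "calabi_potential.Gm g H F1 F2 q $ k $ l =
     (\<Sum>i\<in>UNIV. \<Sum>j\<in>UNIV. del k (\<lambda>p. coord i (\<tau> p)) q * calabi_potential.Gm g' H' F1 F2 (\<tau> q) $ i $ j
        * cnj (del l (\<lambda>p. coord j (\<tau> p)) q))"
proof -
  interpret pot: potential J F F1 F2 F3 F4 by (rule pot)
  interpret C: calabi_potential U g H J F F1 F2 F3 F4 ..
  interpret C': calabi_potential U' g' H' J F F1 F2 F3 F4 ..
  define k0 where "k0 = deriv c (fst q) / c (fst q)"
  have dc: "deriv c (fst q) = c (fst q) * k0" using c_nz[OF q] by (simp add: k0_def)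
  have az: "a (fst q) = k0 + prim.a (\<zeta> (fst q)) * deriv \<zeta> (fst q)"
    using a_change[OF q] by (simp add: k0_def)
  have Hc: "complex_of_real (H (fst q)) = c (fst q) * cnj (c (fst q)) * H' (\<zeta> (fst q))"
    and gc: "complex_of_real (g (fst q)) = deriv \<zeta> (fst q) * cnj (deriv \<zeta> (fst q)) * g' (\<zeta> (fst q))"
    unfolding H_change[OF q] g_change[OF q] of_real_mult complex_norm_square by simp_all
  have rr: "complex_of_real (prim.r (\<tau> q)) = snd q * cnj (snd q) * (c (fst q) * cnj (c (fst q)) * H' (\<zeta> (fst q)))"
    unfolding r_change[OF q, symmetric] r_complex Hc ..
  have t: "fst (\<tau> q) = \<zeta> (fst q)" "snd (\<tau> q) = c (fst q) * snd q" by (simp_all add: \<tau>_def)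
  show ?thesis unfolding sum_2 del_\<tau>[OF q] dc C.Gm_def C'.Gm_def r_change[OF q] t
    using exhaust_2[of k] exhaust_2[of l] by (auto simp: az Hc gc rr algebra_simps)
qed

end
lemma (in calabi_potential) smooth_Gm:
  assumes "smooth_on J F1" "smooth_on J F2"
  shows "smooth_on \<Omega>J Gm"
proof -
  have P: "smooth_on J P" "smooth_on J Q" unfolding P_def[abs_def] Q_def[abs_def]
    by (intro smooth_on_add smooth_on_mult smooth_on_const smooth_on_bounded_linear bounded_linear_ident
        open_J assms)+
  have sub: "\<Omega>J \<subseteq> \<Omega>" by (auto simp: \<Omega>J_def)
  have r: "smooth_on \<Omega>J (\<lambda>p. complex_of_real (k (r p)))" if "smooth_on J k" for k
    by (intro smooth_on_of_real open_\<Omega>J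
        smooth_on_real_comp[OF open_\<Omega>J open_J _ that smooth_on_subset[OF smooth_r sub]])
       (auto simp: \<Omega>J_def)
  have base: "smooth_on \<Omega>J (\<lambda>p. k (fst p))" if "smooth_on U k" for k :: "complex \<Rightarrow> complex"
    using smooth_on_subset[OF smooth_fst[OF that] sub] .
  note s = r[OF P(1)] r[OF P(2)] r[OF smooth_on_bounded_linear[OF open_J bounded_linear_ident]]
    base[OF smooth_on_of_real[OF open_U smooth_g]] base[OF smooth_on_of_real[OF open_U smooth_H]]
    base[OF smooth_a] base[OF smooth_on_cnj[OF open_U smooth_a]]
    smooth_on_bounded_linear[OF open_\<Omega>J bounded_linear_snd]
    smooth_on_cnj[OF open_\<Omega>J smooth_on_bounded_linear[OF open_\<Omega>J bounded_linear_snd]]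
  show ?thesis
  proof (rule smooth_on_vec2[OF open_\<Omega>J])
    fix k l
    show "smooth_on \<Omega>J (\<lambda>p. Gm p $ k $ l)" using exhaust_2[of k] exhaust_2[of l]
      by (auto simp: Gm_def intro!: smooth_on_add smooth_on_mult s open_\<Omega>J)
  qed
qed

section \<open>The line bundle and its projective completion\<close>

locale calabi_bundle =
  fixes A :: "'a::t2_space chart set" and om :: "'a base_form" and L :: "('a, 'l) line_bundle"
    and h :: "'l \<Rightarrow> real"
  assumes surface: "riemann_surface A"
    and base_metric: "base_kahler A om"
    and ricci: "\<And>\<kappa> \<zeta>. \<kappa> \<in> A \<Longrightarrow> \<zeta> \<in> snd \<kappa> ` fst \<kappa> \<Longrightarrow> ricci om \<kappa> \<zeta> = complex_of_real (- 2 * om \<kappa> \<zeta>)"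
    and line_bundle: "holomorphic_line_bundle A L"
    and metric: "hermitian_metric A L h"
    and curvature: "\<And>b \<zeta>. b \<in> bcharts A L \<Longrightarrow> \<zeta> \<in> bcoord b ` bdom b \<Longrightarrow>
          curvature h b \<zeta> = complex_of_real (- om (fst b) \<zeta>)"
begin

abbreviation UU where "UU b \<equiv> bcoord b ` bdom b"
abbreviation gg where "gg b \<equiv> om (fst b)"
abbreviation HH where "HH b \<equiv> (\<lambda>\<zeta>. h (bframe b \<zeta>))"

lemma base_scale: "base_point L (scale L c l) = base_point L l"
  and scale_1: "scale L 1 l = l"
  and scale_scale: "scale L c (scale L d l) = scale L (c * d) l"
proof -
  note lb = line_bundle[unfolded holomorphic_line_bundle_def]
  show "base_point L (scale L c l) = base_point L l" using lb[THEN conjunct1] by blast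
  show "scale L 1 l = l" using lb[THEN conjunct2, THEN conjunct1] by blast
  show "scale L c (scale L d l) = scale L (c * d) l"
    using lb[THEN conjunct2, THEN conjunct2, THEN conjunct1] by blast
qed

lemma h_scale: "h (scale L c l) = (cmod c)\<^sup>2 * h l"
  and h_pos: "l \<noteq> scale L 0 l \<Longrightarrow> 0 < h l"
  using metric unfolding hermitian_metric_def by blast+

context
  fixes b assumes b: "b \<in> bcharts A L"
begin

lemma chart_A: "fst b \<in> A" and frame_L: "snd b \<in> frames L"
  using b by (auto simp: bcharts_def)

lemma chart_open: "open (fst (fst b))" "open (bcoord b ` fst (fst b))"
  "homeomorphism (fst (fst b)) (bcoord b ` fst (fst b)) (bcoord b) (chart_inv (fst b))"
  using surface chart_A unfolding riemann_surface_def bcoord_def by blast+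

lemma frame_open: "open (fst (snd b))"
  and frame_bij: "x \<in> fst (snd b) \<Longrightarrow>
    bij_betw (\<lambda>c. scale L c (snd (snd b) x)) UNIV {l. base_point L l = x}"
  using line_bundle frame_L unfolding holomorphic_line_bundle_def by (auto simp: case_prod_beta)

lemma bdom_open: "open (bdom b)" and bdom_sub: "bdom b \<subseteq> fst (fst b)"
  using chart_open frame_open by (auto simp: bdom_def)

lemma chart_inv_bcoord: "x \<in> fst (fst b) \<Longrightarrow> chart_inv (fst b) (bcoord b x) = x"
  using chart_open(3) unfolding homeomorphism_def by blast

lemma bcoord_inj: "inj_on (bcoord b) (fst (fst b))"
  using chart_inv_bcoord by (metis inj_onI)

lemma UU_D: "\<zeta> \<in> UU b \<Longrightarrow> chart_inv (fst b) \<zeta> \<in> bdom b \<and> bcoord b (chart_inv (fst b) \<zeta>) = \<zeta>"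
  using chart_inv_bcoord bdom_sub by auto

lemma bcoord_open: "open T \<Longrightarrow> T \<subseteq> fst (fst b) \<Longrightarrow> open (bcoord b ` T)"
proof -
  assume T: "open T" "T \<subseteq> fst (fst b)"
  have "bcoord b ` T = (bcoord b ` fst (fst b)) \<inter> chart_inv (fst b) -` T"
    using T chart_inv_bcoord by force
  moreover have "continuous_on (bcoord b ` fst (fst b)) (chart_inv (fst b))"
    using chart_open(3) unfolding homeomorphism_def by blast
  ultimately show ?thesis using continuous_open_preimage chart_open(2) T(1) by metis
qed

lemma UU_open: "open (UU b)"
  using bcoord_open bdom_open bdom_sub by blast

lemma base_frame: "x \<in> fst (snd b) \<Longrightarrow> base_point L (snd (snd b) x) = x"
proof -
  assume "x \<in> fst (snd b)"
  from bij_betwE[OF frame_bij[OF this]] have "base_point L (scale L 1 (snd (snd b) x)) = x" by blast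
  then show ?thesis by (simp only: scale_1)
qed

lemma base_bframe: "\<zeta> \<in> UU b \<Longrightarrow> base_point L (bframe b \<zeta>) = chart_inv (fst b) \<zeta>"
  using UU_D base_frame by (auto simp: bframe_def bdom_def)

lemma scale_frame_inj:
  assumes "\<zeta> \<in> UU b"
  shows "scale L c (bframe b \<zeta>) = scale L d (bframe b \<zeta>) \<longleftrightarrow> c = d"
proof -
  have "chart_inv (fst b) \<zeta> \<in> fst (snd b)" using UU_D[OF assms] by (auto simp: bdom_def)
  from frame_bij[OF this] show ?thesis unfolding bframe_def bij_betw_def inj_on_def by blast
qed

lemma frame_nz: "\<zeta> \<in> UU b \<Longrightarrow> bframe b \<zeta> \<noteq> scale L 0 (bframe b \<zeta>)"
  using scale_frame_inj[of \<zeta> 1 0] by (simp add: scale_1)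

text \<open>\<open>curvature\<close> and \<open>ricci\<close> are both defined with a minus sign, so
  their values \<open>- om\<close> and \<open>- 2 * om\<close> become the constants 1 and 2 of the
  local model.\<close>

lemma local_data: "calabi_local (UU b) (gg b) (HH b)"
proof
  have sub: "UU b \<subseteq> snd (fst b) ` fst (fst b)" using bdom_sub by (auto simp: bcoord_def)
  have gb: "smooth_on (snd (fst b) ` fst (fst b)) (gg b)" "\<forall>\<zeta>\<in>snd (fst b) ` fst (fst b). 0 < gg b \<zeta>"
    using bspec[OF base_metric[unfolded base_kahler_def, THEN conjunct1] chart_A] by simp_all
  show "open (UU b)" by (rule UU_open)
  show "smooth_on (UU b) (gg b)" using smooth_on_subset[OF gb(1) sub] .
  show "smooth_on (UU b) (HH b)" using metric b unfolding hermitian_metric_def by blast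
  fix z assume z: "z \<in> UU b"
  then show "0 < gg b z" using gb(2) sub by blast
  show "0 < HH b z" using h_pos frame_nz[OF z] by blast
  show "d_z (d_zbar (\<lambda>\<xi>. complex_of_real (ln (HH b \<xi>)))) z = complex_of_real (gg b z)"
    using curvature[OF b z] by (simp add: curvature_def)
  show "d_z (d_zbar (\<lambda>\<xi>. complex_of_real (ln (gg b \<xi>)))) z = complex_of_real (2 * gg b z)"
    using ricci[OF chart_A, of z] z sub by (auto simp: ricci_def)
qed

lemma cdom_\<Omega>: "cdom b = calabi_local.\<Omega> (UU b)"
  by (simp add: cdom_def calabi_local.\<Omega>_def[OF local_data])

end

lemma line_of_inj: "line_of L l 1 = line_of L l' 1 \<longleftrightarrow> l = l'"
proof
  assume *: "line_of L l 1 = line_of L l' 1"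
  have "(scale L 1 l, 1 * 1) \<in> line_of L l 1" unfolding line_of_def by force
  then have "(l, 1) \<in> line_of L l' 1" using * by (simp add: scale_1)
  then obtain c where "l = scale L c l'" "1 = c * 1" unfolding line_of_def by blast
  then show "l = l'" by (simp add: scale_1)
qed simp

lemma line_of_normalize: "t \<noteq> 0 \<Longrightarrow> line_of L l t = line_of L (scale L (1 / t) l) 1"
proof -
  assume t: "t \<noteq> 0"
  have 1: "\<exists>d. (scale L c l, c * t) = (scale L d (scale L (1 / t) l), d * 1) \<and> d \<noteq> 0" if "c \<noteq> 0" for c
    using t that by (intro exI[of _ "c * t"]) (simp add: scale_scale)
  have 2: "\<exists>d. (scale L c (scale L (1 / t) l), c * 1) = (scale L d l, d * t) \<and> d \<noteq> 0" if "c \<noteq> 0" for c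
    using t that by (intro exI[of _ "c / t"]) (simp add: scale_scale)
  show ?thesis unfolding line_of_def using 1 2 by (intro subset_antisym subsetI) blast+
qed

lemma line_of_0_neq: "line_of L l 0 \<noteq> line_of L l' 1"
proof
  assume *: "line_of L l 0 = line_of L l' 1"
  have "(scale L 1 l', 1 * 1) \<in> line_of L l' 1" unfolding line_of_def by force
  then have "(l', 1) \<in> line_of L l 0" using * by (simp add: scale_1)
  then obtain c :: complex where "1 = c * 0" unfolding line_of_def by blast
  then show False by simp
qed

lemma pt_ruled: "pt L b q \<in> ruled_surface L - infinity_divisor L"
  using line_of_0_neq unfolding pt_def ruled_surface_def infinity_divisor_def
  by (auto intro!: exI[of _ "1::complex"]) 

lemma pt_zero_iff:
  assumes b: "b \<in> bcharts A L" and q: "q \<in> cdom b"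
  shows "pt L b q \<in> zero_divisor L \<longleftrightarrow> snd q = 0"
proof
  have z: "fst q \<in> UU b" using q by (auto simp: cdom_def)
  assume "pt L b q \<in> zero_divisor L"
  then obtain l where "scale L (snd q) (bframe b (fst q)) = scale L 0 l"
    unfolding pt_def zero_divisor_def using line_of_inj by auto
  then have "scale L (snd q) (bframe b (fst q)) = scale L 0 (scale L (snd q) (bframe b (fst q)))"
    by (simp add: scale_scale)
  also have "\<dots> = scale L 0 (bframe b (fst q))" by (simp add: scale_scale)
  finally show "snd q = 0" using scale_frame_inj[OF b z] by blast
qed (auto simp: pt_def zero_divisor_def)

lemma coord_part_eqs:
  assumes b: "b \<in> bcharts A L"
  shows "coord_part L (ruled_surface L - infinity_divisor L) b = cdom b"
    "coord_part L (ruled_surface L - (zero_divisor L \<union> infinity_divisor L)) b = {q \<in> cdom b. snd q \<noteq> 0}"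
  using pt_ruled pt_zero_iff[OF b] by (auto simp: coord_part_def)

lemma pt_inj: "b \<in> bcharts A L \<Longrightarrow> inj_on (pt L b) (cdom b)"
proof (rule inj_onI)
  fix q q' assume b: "b \<in> bcharts A L" and q: "q \<in> cdom b" "q' \<in> cdom b" and eq: "pt L b q = pt L b q'"
  have z: "fst q \<in> UU b" "fst q' \<in> UU b" using q by (auto simp: cdom_def)
  have l: "scale L (snd q) (bframe b (fst q)) = scale L (snd q') (bframe b (fst q'))"
    using eq line_of_inj by (simp add: pt_def)
  then have "chart_inv (fst b) (fst q) = chart_inv (fst b) (fst q')"
    using base_bframe[OF b] z base_scale by metis
  then have "fst q = fst q'" using UU_D[OF b] z by metis
  with l show "q = q'" using scale_frame_inj[OF b z(1)] by (simp add: prod_eq_iff)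
qed

lemma h_pt: "b \<in> bcharts A L \<Longrightarrow> h (scale L (snd q) (bframe b (fst q))) = calabi_local.r (HH b) q"
  using calabi_local.r_def[OF local_data] h_scale by auto

lemma log_norm_line: "log_norm L h (line_of L l 1) = ln (h l)"
  unfolding log_norm_def using line_of_inj by (intro the_equality) auto

lemma log_norm_pt: "b \<in> bcharts A L \<Longrightarrow> log_norm L h (pt L b q) = ln (calabi_local.r (HH b) q)"
  unfolding pt_def log_norm_line by (simp add: h_pt)

end

section \<open>Transition maps between bundle charts\<close>

context calabi_bundle
begin

definition overlap where "overlap b b' = bcoord b ` (bdom b \<inter> bdom b')"
definition trans_base where "trans_base b b' = bcoord b' \<circ> chart_inv (fst b)"
definition trans_fibre where "trans_fibre b b' \<zeta> = frame_coeff L (snd (snd b')) (bframe b \<zeta>)"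

context
  fixes b b' assumes b: "b \<in> bcharts A L" and b': "b' \<in> bcharts A L"
begin

lemma overlap_D:
  assumes "\<zeta> \<in> overlap b b'"
  shows "\<zeta> \<in> UU b" "chart_inv (fst b) \<zeta> \<in> bdom b'" "trans_base b b' \<zeta> \<in> UU b'"
    "chart_inv (fst b') (trans_base b b' \<zeta>) = chart_inv (fst b) \<zeta>"
proof -
  show u: "\<zeta> \<in> UU b" using assms by (auto simp: overlap_def)
  obtain x where x: "x \<in> bdom b" "x \<in> bdom b'" "\<zeta> = bcoord b x" using assms by (auto simp: overlap_def)
  have i: "chart_inv (fst b) \<zeta> = x" using chart_inv_bcoord[OF b] bdom_sub[OF b] x by auto
  then show "chart_inv (fst b) \<zeta> \<in> bdom b'" using x by simp
  show "trans_base b b' \<zeta> \<in> UU b'" using x i by (simp add: trans_base_def)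
  show "chart_inv (fst b') (trans_base b b' \<zeta>) = chart_inv (fst b) \<zeta>"
    using chart_inv_bcoord[OF b'] bdom_sub[OF b'] x i by (auto simp: trans_base_def)
qed

lemma frame_change:
  assumes \<zeta>: "\<zeta> \<in> overlap b b'"
  shows "bframe b \<zeta> = scale L (trans_fibre b b' \<zeta>) (bframe b' (trans_base b b' \<zeta>))"
proof -
  let ?x = "chart_inv (fst b) \<zeta>" and ?e = "snd (snd b')"
  note o = overlap_D[OF \<zeta>]
  have base: "base_point L (bframe b \<zeta>) = ?x" using base_bframe[OF b o(1)] .
  have e: "?e ?x = bframe b' (trans_base b b' \<zeta>)" by (simp add: bframe_def o(4))
  have x: "?x \<in> fst (snd b')" using o(2) by (auto simp: bdom_def)
  from frame_bij[OF b' x] base have "\<exists>c. bframe b \<zeta> = scale L c (?e ?x)"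
    unfolding bij_betw_def by blast
  then obtain c where c: "bframe b \<zeta> = scale L c (?e ?x)" by blast
  have "trans_fibre b b' \<zeta> = c" unfolding trans_fibre_def frame_coeff_def base
  proof (rule the_equality)
    show "bframe b \<zeta> = scale L c (?e ?x)" by (rule c)
    fix c' assume "bframe b \<zeta> = scale L c' (?e ?x)"
    then show "c' = c" using c scale_frame_inj[OF b' o(3)] e by metis
  qed
  then show ?thesis using c e by simp
qed

lemma overlap_open: "open (overlap b b')"
  unfolding overlap_def using bcoord_open[OF b] bdom_open[OF b] bdom_open[OF b'] bdom_sub[OF b] by blast

lemma trans_fibre_nz:
  assumes "\<zeta> \<in> overlap b b'"
  shows "trans_fibre b b' \<zeta> \<noteq> 0"
proof
  assume "trans_fibre b b' \<zeta> = 0"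
  then have "bframe b \<zeta> = scale L 0 (bframe b' (trans_base b b' \<zeta>))"
    using frame_change[OF assms] by simp
  then have "bframe b \<zeta> = scale L 0 (bframe b \<zeta>)" using scale_scale by (metis mult_zero_left)
  then show False using frame_nz[OF b overlap_D(1)[OF assms]] by blast
qed

lemma change: "calabi_change (UU b) (gg b) (HH b) (UU b') (gg b') (HH b') (overlap b b')
  (trans_base b b') (trans_fibre b b')"
proof (intro calabi_change.intro local_data b b' calabi_change_axioms.intro)
  show "open (overlap b b')" by (rule overlap_open)
  show "overlap b b' \<subseteq> UU b" "trans_base b b' ` overlap b b' \<subseteq> UU b'" using overlap_D by blast+
  have sub: "overlap b b' \<subseteq> snd (fst b) ` (fst (fst b) \<inter> fst (fst b'))"
    by (auto simp: overlap_def bdom_def bcoord_def)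
  have "(snd (fst b') \<circ> chart_inv (fst b)) holomorphic_on (snd (fst b) ` (fst (fst b) \<inter> fst (fst b')))"
    using surface chart_A[OF b] chart_A[OF b'] unfolding riemann_surface_def by blast
  then show "trans_base b b' holomorphic_on overlap b b'"
    unfolding trans_base_def bcoord_def[of b'] using sub holomorphic_on_subset by blast
  have "\<forall>(U, e)\<in>frames L. \<forall>(V, e')\<in>frames L. \<forall>\<kappa>\<in>A.
        (\<lambda>\<zeta>. frame_coeff L e (e' (chart_inv \<kappa> \<zeta>))) holomorphic_on (snd \<kappa> ` (fst \<kappa> \<inter> U \<inter> V))"
    using line_bundle[unfolded holomorphic_line_bundle_def] by blast
  from bspec[OF this frame_L[OF b']]
  have "\<forall>(V, e')\<in>frames L. \<forall>\<kappa>\<in>A. (\<lambda>\<zeta>. frame_coeff L (snd (snd b')) (e' (chart_inv \<kappa> \<zeta>)))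
     holomorphic_on (snd \<kappa> ` (fst \<kappa> \<inter> fst (snd b') \<inter> V))" by (simp add: case_prod_beta)
  from bspec[OF this frame_L[OF b]] chart_A[OF b]
  have "(\<lambda>\<zeta>. frame_coeff L (snd (snd b')) (snd (snd b) (chart_inv (fst b) \<zeta>)))
     holomorphic_on (snd (fst b) ` (fst (fst b) \<inter> fst (snd b') \<inter> fst (snd b)))" by (simp add: case_prod_beta)
  moreover have "overlap b b' \<subseteq> snd (fst b) ` (fst (fst b) \<inter> fst (snd b') \<inter> fst (snd b))"
    by (auto simp: overlap_def bdom_def bcoord_def)
  ultimately show "trans_fibre b b' holomorphic_on overlap b b'"
    unfolding trans_fibre_def[abs_def] bframe_def using holomorphic_on_subset by blast
  fix z assume z: "z \<in> overlap b b'"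
  show "trans_fibre b b' z \<noteq> 0" using trans_fibre_nz[OF z] .
  show "HH b z = (cmod (trans_fibre b b' z))\<^sup>2 * HH b' (trans_base b b' z)"
    unfolding frame_change[OF z] h_scale ..
  show "gg b z = (cmod (deriv (trans_base b b') z))\<^sup>2 * gg b' (trans_base b b' z)"
    using base_metric[unfolded base_kahler_def, THEN conjunct2, rule_format, OF chart_A[OF b] chart_A[OF b'], of z] z sub
    by (auto simp: trans_base_def bcoord_def comp_def)
qed

lemma pt_change:
  assumes "fst q \<in> overlap b b'"
  shows "pt L b q = pt L b' (trans_base b b' (fst q), trans_fibre b b' (fst q) * snd q)"
  unfolding pt_def frame_change[OF assms] by (simp add: scale_scale mult.commute)

lemma transition_eq:
  assumes "fst q \<in> overlap b b'"
  shows "transition L b b' q = (trans_base b b' (fst q), trans_fibre b b' (fst q) * snd q)"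
  unfolding transition_def pt_change[OF assms]
  by (rule inv_into_f_f[OF pt_inj[OF b']]) (use overlap_D[OF assms] in \<open>auto simp: cdom_def\<close>)

lemma mem_overlap:
  assumes q: "q \<in> cdom b" and "pt L b q \<in> pt L b' ` cdom b'"
  shows "fst q \<in> overlap b b'"
proof -
  obtain p where p: "p \<in> cdom b'" "pt L b q = pt L b' p" using assms by blast
  have z: "fst q \<in> UU b" "fst p \<in> UU b'" using q p by (auto simp: cdom_def)
  have "scale L (snd q) (bframe b (fst q)) = scale L (snd p) (bframe b' (fst p))"
    using p(2) line_of_inj by (simp add: pt_def)
  then have "chart_inv (fst b) (fst q) = chart_inv (fst b') (fst p)"
    using base_bframe[OF b z(1)] base_bframe[OF b' z(2)] base_scale by metis
  then show ?thesis
    using UU_D[OF b z(1)] UU_D[OF b' z(2)] unfolding overlap_def by (metis IntI imageI)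
qed

end

subsection \<open>Compact sets avoid a neighbourhood of the infinity divisor\<close>

lemma istopology_ruled: "istopology (\<lambda>V. V \<subseteq> ruled_surface L \<and>
     (\<forall>b\<in>bcharts A L. open {q \<in> cdom b. pt L b q \<in> V} \<and> open {q \<in> cdom b. pt_inf L b q \<in> V}))"
proof -
  have 1: "{q \<in> cdom b. k q \<in> V \<inter> W} = {q \<in> cdom b. k q \<in> V} \<inter> {q \<in> cdom b. k q \<in> W}"
    for b :: "('a, 'l) bchart" and k :: "c2 \<Rightarrow> 'l line" and V W by auto
  have 2: "{q \<in> cdom b. k q \<in> \<Union>\<V>} = (\<Union>V\<in>\<V>. {q \<in> cdom b. k q \<in> V})"
    for b :: "('a, 'l) bchart" and k :: "c2 \<Rightarrow> 'l line" and \<V> by auto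
  show ?thesis unfolding istopology_def 1 2 by (auto intro!: open_Int open_UN)
qed

text \<open>These sets exhaust the complement of the infinity divisor, so that a compact subset lies
  in one of them.\<close>

definition tube :: "real \<Rightarrow> 'l line set" where "tube x = {line_of L l 1 | l. h l < x}"

lemma openin_tube: "openin (ruled_topology A L) (tube x)"
proof -
  have mem: "line_of L l 1 \<in> tube x \<longleftrightarrow> h l < x" for l
    unfolding tube_def using line_of_inj by auto
  \<comment> \<open>The condition \<open>t \<noteq> 0\<close> has to be explicit: with
    \<open>1 / 0 = 0\<close> the infinity divisor would otherwise satisfy the inequality for
    \<open>x > 0\<close>.\<close>
  have mem_inf: "line_of L l t \<in> tube x \<longleftrightarrow> t \<noteq> 0 \<and> h (scale L (1 / t) l) < x" for l t
  proof (cases "t = 0")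
    case True
    then show ?thesis unfolding tube_def using line_of_0_neq by auto
  qed (simp add: line_of_normalize[of t] mem)
  have "open {q \<in> cdom b. pt L b q \<in> tube x} \<and> open {q \<in> cdom b. pt_inf L b q \<in> tube x}"
    if b: "b \<in> bcharts A L" for b
  proof
    interpret C: calabi_local "UU b" "gg b" "HH b" by (rule local_data[OF b])
    have "{q \<in> cdom b. pt L b q \<in> tube x} = C.\<Omega> \<inter> C.r -` {..<x}"
      by (auto simp: cdom_\<Omega>[OF b] pt_def mem h_pt[OF b])
    then show "open {q \<in> cdom b. pt L b q \<in> tube x}"
      using continuous_open_preimage[OF C.continuous_r C.open_\<Omega>, of "{..<x}"] by simp
    define \<Omega>' where "\<Omega>' = C.\<Omega> \<inter> snd -` (- {0})"
    have o: "open \<Omega>'" unfolding \<Omega>'_def by (intro open_Int C.open_\<Omega> open_vimage_snd) auto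
    have "continuous_on C.\<Omega> (\<lambda>q. HH b (fst q))"
      by (intro smooth_on_imp_continuous_on C.smooth_fst C.smooth_H)
    then have c: "continuous_on \<Omega>' (\<lambda>q. (cmod (1 / snd q))\<^sup>2 * HH b (fst q))"
      by (intro continuous_intros) (auto simp: \<Omega>'_def elim: continuous_on_subset)
    have "{q \<in> cdom b. pt_inf L b q \<in> tube x} = \<Omega>' \<inter> (\<lambda>q. (cmod (1 / snd q))\<^sup>2 * HH b (fst q)) -` {..<x}"
      by (auto simp: cdom_\<Omega>[OF b] pt_inf_def mem_inf h_scale \<Omega>'_def)
    then show "open {q \<in> cdom b. pt_inf L b q \<in> tube x}"
      using continuous_open_preimage[OF c o, of "{..<x}"] by simp
  qed
  moreover have "tube x \<subseteq> ruled_surface L" unfolding tube_def ruled_surface_def by force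
  ultimately show ?thesis
    unfolding ruled_topology_def topology_inverse'[OF istopology_ruled] by blast
qed

lemma compact_in_tube:
  assumes K: "compactin (ruled_topology A L) K" "K \<subseteq> ruled_surface L - infinity_divisor L"
  shows "\<exists>x>0. K \<subseteq> tube x"
proof -
  have "K \<subseteq> \<Union> (range (\<lambda>n. tube (real n)))"
  proof
    fix P assume P: "P \<in> K"
    then obtain l t where lt: "P = line_of L l t" "\<not> (l = scale L 0 l \<and> t = 0)"
      using K(2) unfolding ruled_surface_def by blast
    have "t \<noteq> 0" using P K(2) lt unfolding infinity_divisor_def by auto
    then obtain l' where l': "P = line_of L l' 1" using lt line_of_normalize by blast
    obtain n where "h l' < real n" using reals_Archimedean2 by blast
    then have "P \<in> tube (real n)" unfolding tube_def l' by blast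
    then show "P \<in> \<Union> (range (\<lambda>n. tube (real n)))" by blast
  qed
  moreover have "\<forall>V\<in>range (\<lambda>n. tube (real n)). openin (ruled_topology A L) V" using openin_tube by blast
  ultimately obtain \<F> where \<F>: "finite \<F>" "\<F> \<subseteq> range (\<lambda>n. tube (real n))" "K \<subseteq> \<Union>\<F>"
    using K(1) unfolding compactin_def by meson
  then obtain I where I: "finite I" "\<F> = (\<lambda>n. tube (real n)) ` I"
    using finite_subset_image by meson
  \<comment> \<open>Inserting 0 covers an empty index set, and \<open>Suc\<close> makes the radius
    positive.\<close>
  define x where "x = real (Suc (Max (insert 0 I)))"
  have "tube (real n) \<subseteq> tube x" if "n \<in> I" for n
  proof -
    have "n \<le> Max (insert 0 I)" using I(1) that by simp
    then have "real n \<le> x" by (simp add: x_def)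
    then show ?thesis unfolding tube_def by force
  qed
  then have "K \<subseteq> tube x" using \<F>(3) I(2) by blast
  then show ?thesis by (intro exI[of _ x]) (simp add: x_def)
qed

lemma test_function_support:
  assumes "test_function A L \<psi>"
  shows "\<exists>x>0. \<forall>b\<in>bcharts A L. \<forall>q\<in>cdom b. calabi_local.r (HH b) q \<ge> x \<longrightarrow> \<psi> (pt L b q) = 0"
proof -
  obtain K where K: "compactin (ruled_topology A L) K" "K \<subseteq> ruled_surface L - infinity_divisor L"
    "\<forall>P\<in>ruled_surface L - infinity_divisor L - K. \<psi> P = 0"
    using assms unfolding test_function_def by blast
  obtain x where x: "x > 0" "K \<subseteq> tube x" using compact_in_tube[OF K(1,2)] by blast
  have "\<psi> (pt L b q) = 0" if b: "b \<in> bcharts A L" and q: "q \<in> cdom b" "calabi_local.r (HH b) q \<ge> x" for b q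
  proof -
    have "pt L b q \<notin> tube x"
      unfolding tube_def pt_def using line_of_inj q(2) by (auto simp: h_pt[OF b])
    then show ?thesis using K(3) x pt_ruled by blast
  qed
  then show ?thesis using x by blast
qed

subsection \<open>Decompositions\<close>

text \<open>A chart is injective, so the image of a difference is the difference of the images. A
  piece is thus a compact set minus a compact set, hence Borel.\<close>

lemma piece_facts:
  assumes D: "decomposition A L D" and j: "j < length D"
  defines "b \<equiv> fst (D ! j)"
  shows "b \<in> bcharts A L" "compact (bcoord b ` snd (D ! j))" "bcoord b ` snd (D ! j) \<subseteq> UU b"
    "piece D j \<subseteq> bcoord b ` snd (D ! j)" "piece D j \<in> sets borel"
proof -
  have mem: "D ! i \<in> set D" if "i \<le> j" for i using that j by simp
  have d: "fst (D ! i) \<in> bcharts A L" "compact (snd (D ! i))" "snd (D ! i) \<subseteq> bdom (fst (D ! i))" if "i \<le> j" for i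
    using D mem[OF that] unfolding decomposition_def by (auto simp: case_prod_beta)
  show b: "b \<in> bcharts A L" unfolding b_def using d(1) by simp
  have K: "compact (snd (D ! j))" "snd (D ! j) \<subseteq> bdom b" using d[of j] by (auto simp: b_def)
  have cont: "continuous_on (fst (fst b)) (bcoord b)"
    using chart_open(3)[OF b] unfolding homeomorphism_def by blast
  have img: "compact (bcoord b ` T)" if "compact T" "T \<subseteq> snd (D ! j)" for T
    using that K bdom_sub[OF b] by (intro compact_continuous_image continuous_on_subset[OF cont]) auto
  show "compact (bcoord b ` snd (D ! j))" using img K by blast
  show "bcoord b ` snd (D ! j) \<subseteq> UU b" using K by blast
  show "piece D j \<subseteq> bcoord b ` snd (D ! j)" unfolding piece_def b_def by blast
  define T where "T = snd (D ! j) \<inter> (\<Union>i<j. snd (D ! i))"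
  have "compact (\<Union>i<j. snd (D ! i))" using d(2) by (intro compact_UN) auto
  then have T: "compact T" unfolding T_def using K(1) compact_Int by blast
  have "piece D j = bcoord b ` snd (D ! j) - bcoord b ` T"
    unfolding piece_def b_def[symmetric] T_def
    using inj_on_image_set_diff[OF bcoord_inj[OF b], of "snd (D ! j)" "snd (D ! j) \<inter> (\<Union>i<j. snd (D ! i))"] K bdom_sub[OF b]
    by (auto simp: Diff_Int_distrib Diff_Int)
  then show "piece D j \<in> sets borel"
    using img[OF K(1)] img[OF T] by (auto simp: T_def compact_imp_closed)
qed

end

section \<open>The regularized metrics\<close>

lemma filterlim_square_at_right_0: "filterlim (\<lambda>x::real. x\<^sup>2) (at_right 0) (at_right 0)"
proof -
  have "((\<lambda>x::real. x\<^sup>2) \<longlongrightarrow> 0\<^sup>2) (at_right 0)" by (intro tendsto_intros)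
  moreover have "eventually (\<lambda>x::real. x\<^sup>2 \<in> {0<..} \<and> x\<^sup>2 \<noteq> 0) (at_right 0)"
    by (rule eventually_mono[OF eventually_at_right_less[of 0]]) simp
  ultimately show ?thesis by (simp add: filterlim_at)
qed

locale calabi_setting =
  calabi_bundle A om L h + profile f \<phi> m \<beta>
  for A :: "'a::t2_space chart set" and om L and h :: "'l \<Rightarrow> real" and f \<phi> m \<beta>
begin

abbreviation \<Omega>b where "\<Omega>b b \<equiv> calabi_local.\<Omega> (UU b)"
abbreviation rb where "rb b \<equiv> calabi_local.r (HH b)"
abbreviation GG where
  "GG b \<delta> \<equiv> calabi_potential.Gm (gg b) (HH b) (\<lambda>x. F1 (x + \<delta>)) (\<lambda>x. F2 (x + \<delta>))"

definition NN where
  "NN b \<delta> q = complex_of_real (2 * gg b (fst q) * HH b (fst q) * W1 \<delta> (rb b q) / (2 * pi)\<^sup>2)"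

lemma cpot: "b \<in> bcharts A L \<Longrightarrow> calabi_potential (UU b) (gg b) (HH b) (Jd \<delta>) (\<lambda>x. F0 (x + \<delta>))
    (\<lambda>x. F1 (x + \<delta>)) (\<lambda>x. F2 (x + \<delta>)) (\<lambda>x. F3 (x + \<delta>)) (\<lambda>x. F4 (x + \<delta>))"
  by (intro calabi_potential.intro local_data potential_Jd)

context
  fixes b assumes b: "b \<in> bcharts A L"
begin

interpretation C: calabi_local "UU b" "gg b" "HH b" by (rule local_data[OF b])
interpretation P: calabi_potential "UU b" "gg b" "HH b" "Jd \<delta>" "\<lambda>x. F0 (x + \<delta>)"
    "\<lambda>x. F1 (x + \<delta>)" "\<lambda>x. F2 (x + \<delta>)" "\<lambda>x. F3 (x + \<delta>)" "\<lambda>x. F4 (x + \<delta>)" for \<delta>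
  by (rule cpot[OF b])

lemma \<Omega>J_eq: "\<delta> \<ge> 0 \<Longrightarrow> P.\<Omega>J \<delta> = {q \<in> cdom b. rb b q + \<delta> > 0}"
proof -
  assume "\<delta> \<ge> 0"
  moreover have "x \<in> Jd \<delta> \<Longrightarrow> x + \<delta> > 0" for x by (simp add: Jd_def)
  ultimately show ?thesis
    using C.r_nonneg mem_Jd[of \<delta>] unfolding P.\<Omega>J_def cdom_\<Omega>[OF b] by blast
qed

lemma \<Omega>J_eps: "\<epsilon> \<noteq> 0 \<Longrightarrow> P.\<Omega>J (\<epsilon>\<^sup>2) = cdom b"
  using \<Omega>J_eq[of "\<epsilon>\<^sup>2"] C.r_nonneg by (auto simp: cdom_\<Omega>[OF b] add_nonneg_pos)

lemma ddbar_form_eq: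
  assumes u: "\<And>p. p \<in> P.\<Omega>J \<delta> \<Longrightarrow> u (pt L b p) = F0 (rb b p + \<delta>)" and q: "q \<in> P.\<Omega>J \<delta>"
  shows "pullback_form om b q + ddbar_form L u b q = GG b \<delta> q"
proof -
  have 1: "delbar l (\<lambda>p. complex_of_real (u (pt L b p))) p =
      delbar l (\<lambda>p. complex_of_real (F0 (rb b p + \<delta>))) p" if "p \<in> P.\<Omega>J \<delta>" for l p
    unfolding delbar_wirt by (rule wirt_cong[OF P.open_\<Omega>J that]) (simp add: u)
  have 2: "del k (delbar l (\<lambda>p. complex_of_real (u (pt L b p)))) q =
      del k (delbar l (\<lambda>p. complex_of_real (F0 (rb b p + \<delta>)))) q" for k l
    unfolding del_wirt by (rule wirt_cong[OF P.open_\<Omega>J q]) (simp add: 1)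
  show ?thesis by (simp add: vec_eq_iff ddbar_form_def pullback_form_def 2 P.ddbar_F[OF q])
qed

lemma r_pos_iff: "q \<in> cdom b \<Longrightarrow> rb b q > 0 \<longleftrightarrow> snd q \<noteq> 0"
  using C.H_pos by (auto simp: C.r_def cdom_def zero_less_mult_iff)

lemma \<Omega>J_0: "P.\<Omega>J 0 = {q \<in> cdom b. snd q \<noteq> 0}"
  using \<Omega>J_eq[of 0] r_pos_iff by auto

lemma eps_form_eq:
  assumes \<epsilon>: "\<epsilon> \<noteq> 0" and q: "q \<in> cdom b"
  shows "eps_form L h om f \<epsilon> b q = GG b (\<epsilon>\<^sup>2) q"
proof -
  note O = \<Omega>J_eps[OF \<epsilon>]
  have "eps_potential L h f \<epsilon> (pt L b p) = F0 (rb b p + \<epsilon>\<^sup>2)" if p: "p \<in> cdom b" for p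
  \<comment> \<open>On the zero section the separate clause of \<open>eps_potential\<close> is the
    value \<open>F0 (0 + \<epsilon>^2)\<close>; elsewhere \<open>exp (ln r) = r\<close> requires
    \<open>r > 0\<close>.\<close>
  proof (cases "snd p = 0")
    case True
    then show ?thesis using pt_zero_iff[OF b p] by (simp add: eps_potential_def F0_def C.r_def)
  next
    case False
    then show ?thesis
      using pt_zero_iff[OF b p] r_pos_iff[OF p] by (simp add: eps_potential_def F0_def log_norm_pt[OF b])
  qed
  then show ?thesis
    unfolding eps_form_def using ddbar_form_eq[of "\<epsilon>\<^sup>2"] q unfolding O by blast
qed

lemma calabi_form_eq:
  assumes q: "q \<in> cdom b" "snd q \<noteq> 0"
  shows "calabi_form L h om f b q = GG b 0 q" unfolding calabi_form_def
  by (rule ddbar_form_eq) (use q r_pos_iff in \<open>auto simp: \<Omega>J_eq log_norm_pt[OF b] F0_def\<close>)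

lemma chern2_eps:
  assumes \<epsilon>: "\<epsilon> \<noteq> 0" and q: "q \<in> cdom b"
  shows "chern2 (eps_form L h om f \<epsilon>) b q = NN b (\<epsilon>\<^sup>2) q"
proof -
  note O = \<Omega>J_eps[OF \<epsilon>]
  show ?thesis unfolding NN_def W1_def
    by (rule P.chern_Gm[of q "\<epsilon>\<^sup>2" "eps_form L h om f \<epsilon>"]) (use q eps_form_eq[OF \<epsilon>] in \<open>auto simp: O\<close>)
qed

lemma hsc_calabi:
  assumes q: "q \<in> cdom b" "snd q \<noteq> 0"
  shows "hsc_form (calabi_form L h om f) b q = NN b 0 q"
proof -
  note O = \<Omega>J_0
  have G: "\<And>p. p \<in> P.\<Omega>J 0 \<Longrightarrow> calabi_form L h om f b p = GG b 0 p"
    using calabi_form_eq by (auto simp: O)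
  have q0: "q \<in> P.\<Omega>J 0" using q by (auto simp: O)
  show ?thesis
    using P.hsc_Gm[OF q0, of "calabi_form L h om f" b] P.chern_Gm[OF q0, of "calabi_form L h om f" b] G
    unfolding NN_def W1_def by simp
qed

text \<open>\<open>NN\<close> is smooth in the point and \<open>\<delta>\<close> jointly on the open
  set \<open>O'\<close>, which contains \<open>\<delta> = 0\<close> in its interior direction
  wherever \<open>w \<noteq> 0\<close>. The parameter is then specialized to
  \<open>\<epsilon>^2\<close>.\<close>

lemma smooth_convergence_eps:
  "smooth_convergence {q \<in> cdom b. snd q \<noteq> 0} (\<lambda>\<epsilon>. chern2 (eps_form L h om f \<epsilon>) b)
     (hsc_form (calabi_form L h om f) b) (at_right 0)"
proof -
  define X where "X = C.\<Omega> \<times> (UNIV :: real set)"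
  define O' where "O' = {p \<in> X. C.r (fst p) \<in> Jd (snd p)}"
  have X: "open X" unfolding X_def by (intro open_Times C.open_\<Omega>) auto
  have r: "smooth_on X (\<lambda>p. C.r (fst p))"
    by (rule smooth_on_comp_linear[OF X C.open_\<Omega> bounded_linear_fst _ C.smooth_r]) (auto simp: X_def)
  have s: "smooth_on X (\<lambda>p. snd p)" by (rule smooth_on_bounded_linear[OF X bounded_linear_snd])
  have O': "open O'" "O' \<subseteq> X"
    unfolding O'_def using open_Jd_preimage[OF X smooth_on_imp_continuous_on[OF r] smooth_on_imp_continuous_on[OF s]]
    by auto
  have base: "smooth_on O' (\<lambda>p. k (fst (fst p)))" if "smooth_on (UU b) k" for k :: "complex \<Rightarrow> real"
    by (rule smooth_on_subset[OF smooth_on_comp_linear[OF X C.open_\<Omega> bounded_linear_fst _ C.smooth_fst[OF that]] O'(2)])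
       (auto simp: X_def)
  have W: "smooth_on O' (\<lambda>p. W1 (snd p) (C.r (fst p)))"
    by (rule smooth_W(1)[OF O'(1) smooth_on_subset[OF r O'(2)] smooth_on_subset[OF s O'(2)]]) (simp add: O'_def)
  have sm: "smooth_on O' (\<lambda>p. NN b (snd p) (fst p))" unfolding NN_def
    by (intro smooth_on_of_real smooth_on_divide smooth_on_mult smooth_on_const base C.smooth_g C.smooth_H W O'(1)) simp
  show ?thesis
  proof (rule smooth_convergence_of_joint[OF _ O'(1) sm, where d = "\<lambda>\<epsilon>. \<epsilon>\<^sup>2"])
    show "open {q \<in> cdom b. snd q \<noteq> 0}" unfolding \<Omega>J_0[symmetric] by (rule P.open_\<Omega>J)
    show "{q \<in> cdom b. snd q \<noteq> 0} \<times> {0..} \<subseteq> O'"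
    proof
      fix p assume "p \<in> {q \<in> cdom b. snd q \<noteq> 0} \<times> {0::real..}"
      then have p: "fst p \<in> cdom b" "snd (fst p) \<noteq> 0" "snd p \<ge> 0" by auto
      then have "C.r (fst p) > 0" using r_pos_iff by blast
      then have "C.r (fst p) \<in> Jd (snd p)" using p by (intro mem_Jd) auto
      then show "p \<in> O'" using p by (auto simp: O'_def X_def cdom_\<Omega>[OF b] mem_Times_iff)
    qed
    show "filterlim (\<lambda>\<epsilon>::real. \<epsilon>\<^sup>2) (at_right 0) (at_right 0)" by (rule filterlim_square_at_right_0)
  qed (auto simp: chern2_eps hsc_calabi)
qed

lemma smooth_F_shift: "smooth_on (Jd \<delta>) (\<lambda>x. F1 (x + \<delta>))" "smooth_on (Jd \<delta>) (\<lambda>x. F2 (x + \<delta>))"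
proof -
  have a: "smooth_on (Jd \<delta>) (\<lambda>x. x + \<delta>)"
    by (intro smooth_on_add P.open_J smooth_on_bounded_linear bounded_linear_ident smooth_on_const)
  show "smooth_on (Jd \<delta>) (\<lambda>x. F1 (x + \<delta>))" "smooth_on (Jd \<delta>) (\<lambda>x. F2 (x + \<delta>))"
    by (rule smooth_on_real_comp[OF P.open_J _ _ smooth_F(1) a] smooth_on_real_comp[OF P.open_J _ _ smooth_F(2) a];
        auto simp: Jd_def)+
qed

lemma eps_kahler_local:
  assumes \<epsilon>: "\<epsilon> \<noteq> 0"
  defines "G \<equiv> eps_form L h om f \<epsilon> b"
  shows "smooth_on (cdom b) G"
    and "q \<in> cdom b \<Longrightarrow> G q $ l $ k = cnj (G q $ k $ l)"
    and "q \<in> cdom b \<Longrightarrow> v \<noteq> 0 \<Longrightarrow> 0 < Re (\<Sum>k\<in>UNIV. \<Sum>l\<in>UNIV. G q $ k $ l * v $ k * cnj (v $ l))"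
    and "q \<in> cdom b \<Longrightarrow> del j (\<lambda>q'. G q' $ k $ l) q = del k (\<lambda>q'. G q' $ j $ l) q"
proof -
  note O = \<Omega>J_eps[OF \<epsilon>]
  have eq: "G p = P.Gm (\<epsilon>\<^sup>2) p" if "p \<in> cdom b" for p
    using eps_form_eq[OF \<epsilon> that] by (simp add: G_def)
  have op: "open (cdom b)" using P.open_\<Omega>J[of "\<epsilon>\<^sup>2"] unfolding O .
  show "smooth_on (cdom b) G"
    by (rule smooth_on_cong[OF op _ P.smooth_Gm[OF smooth_F_shift, of "\<epsilon>\<^sup>2", unfolded O]]) (simp add: eq)
  assume q: "q \<in> cdom b"
  show "G q $ l $ k = cnj (G q $ k $ l)"
    unfolding eq[OF q] using P.Gm_hermitian[of q "\<epsilon>\<^sup>2"] q O by blast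
  show "v \<noteq> 0 \<Longrightarrow> 0 < Re (\<Sum>k\<in>UNIV. \<Sum>l\<in>UNIV. G q $ k $ l * v $ k * cnj (v $ l))"
    unfolding eq[OF q] using P.Gm_positive[of q "\<epsilon>\<^sup>2" v] q O by blast
  have c: "del j (\<lambda>q'. G q' $ k $ l) q = del j (\<lambda>q'. P.Gm (\<epsilon>\<^sup>2) q' $ k $ l) q" for j k l
    unfolding del_wirt by (rule wirt_cong[OF op q]) (simp add: eq)
  show "del j (\<lambda>q'. G q' $ k $ l) q = del k (\<lambda>q'. G q' $ j $ l) q"
    unfolding c using P.Gm_closed[of q "\<epsilon>\<^sup>2"] q O by blast
qed

lemma hsc_locally_integrable:
  assumes K: "compact K" "K \<subseteq> cdom b"
  shows "set_integrable lborel (K \<inter> {q \<in> cdom b. snd q \<noteq> 0}) (hsc_form (calabi_form L h om f) b)"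
proof -
  have K\<Omega>: "K \<subseteq> C.\<Omega>" using K cdom_\<Omega>[OF b] by simp
  have "compact (fst ` K)" using K by (intro compact_continuous_image continuous_intros)
  moreover have "fst ` K \<subseteq> UU b" using K by (auto simp: cdom_def)
  moreover obtain x0 where x0: "x0 > 0" "\<forall>q\<in>K. norm (C.r q) \<le> x0"
    using bounded_on_compact[OF K(1) continuous_on_subset[OF C.continuous_r K\<Omega>]] by blast
  \<comment> \<open>The projection of \<open>K\<close> serves both as the Borel set and as its
    compact hull; the radius \<open>x0 + 1\<close> turns the bound \<open>r \<le> x0\<close> on
    \<open>K\<close> into a strict one.\<close>
  ultimately interpret T: calabi_weak "UU b" "gg b" "HH b" f \<phi> m \<beta> "fst ` K" "fst ` K" "x0 + 1"
    by unfold_locales (auto simp: compact_imp_closed)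
  have "set_integrable lborel T.TB (NN b 0)"
    using T.N_integrable[of 0] unfolding T.N_def NN_def by simp
  moreover have "K \<inter> {q \<in> cdom b. snd q \<noteq> 0} \<in> sets lborel"
    using P.open_\<Omega>J[of 0, unfolded \<Omega>J_0] compact_imp_closed[OF K(1)] by auto
  moreover have "K \<inter> {q \<in> cdom b. snd q \<noteq> 0} \<subseteq> T.TB"
  proof
    fix q assume q: "q \<in> K \<inter> {q \<in> cdom b. snd q \<noteq> 0}"
    then have "norm (C.r q) \<le> x0" using x0 by blast
    then have "C.r q < x0 + 1" by simp
    then show "q \<in> T.TB" using q by (auto simp: T.TB_def)
  qed
  ultimately have "set_integrable lborel (K \<inter> {q \<in> cdom b. snd q \<noteq> 0}) (NN b 0)"
    by (rule set_integrable_subset)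
  then show ?thesis by (rule set_integrable_cong[THEN iffD1, rotated -1]) (auto simp: hsc_calabi)
qed

end

lemma eps_kahler:
  assumes \<epsilon>: "\<epsilon> \<noteq> 0"
  shows "kahler_metric A L (ruled_surface L - infinity_divisor L) (eps_form L h om f \<epsilon>)"
proof -
  have change: "eps_form L h om f \<epsilon> b q $ k $ l =
           (\<Sum>i\<in>UNIV. \<Sum>j\<in>UNIV. del k (\<lambda>q'. coord i (transition L b b' q')) q
              * eps_form L h om f \<epsilon> b' (transition L b b' q) $ i $ j
              * cnj (del l (\<lambda>q'. coord j (transition L b b' q')) q))"
    if b: "b \<in> bcharts A L" "b' \<in> bcharts A L" and q: "q \<in> cdom b" "pt L b q \<in> pt L b' ` cdom b'" for b b' q k l
  proof -
    interpret T: calabi_change "UU b" "gg b" "HH b" "UU b'" "gg b'" "HH b'" "overlap b b'"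
      "trans_base b b'" "trans_fibre b b'" by (rule change[OF b])
    have o: "fst q \<in> overlap b b'" by (rule mem_overlap[OF b q])
    have tr: "transition L b b' p = T.\<tau> p" if "fst p \<in> overlap b b'" for p
      using transition_eq[OF b that] by (simp add: T.\<tau>_def)
    have op: "open (overlap b b' \<times> (UNIV :: complex set))"
      using overlap_open[OF b] by (intro open_Times) auto
    \<comment> \<open>\<open>transition\<close> is an \<open>inv_into\<close> and is known
      explicitly only over the overlap. As that set is open, its derivatives are those of
      \<open>T.\<tau>\<close>.\<close>
    have d: "del k (\<lambda>q'. coord i (transition L b b' q')) q = del k (\<lambda>q'. coord i (T.\<tau> q')) q" for i k
      unfolding del_wirt by (rule wirt_cong[OF op]) (use o tr in \<open>auto simp: mem_Times_iff\<close>)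
    have "T.\<tau> q \<in> cdom b'" using T.\<tau>_mem[OF o] cdom_\<Omega>[OF b(2)] by simp
    then show ?thesis
      unfolding d tr[OF o] eps_form_eq[OF b(1) \<epsilon> q(1)] eps_form_eq[OF b(2) \<epsilon> \<open>T.\<tau> q \<in> cdom b'\<close>]
      by (rule_tac T.Gm_change[OF o potential_Jd])
  qed
  show ?thesis unfolding kahler_metric_def
    using eps_kahler_local[OF _ \<epsilon>] change by (auto simp: coord_part_eqs)
qed

text \<open>The current is a finite sum over the pieces, and one radius \<open>x0\<close> serves for
  all of them. On each piece the local limit is composed with \<open>\<epsilon>^2\<close>, which
  tends to 0 from the right.\<close>

lemma weak_convergence:
  assumes D: "decomposition A L D" and \<psi>: "test_function A L \<psi>"
  shows "((\<lambda>\<epsilon>. form_current L D (ruled_surface L - infinity_divisor L)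
                (chern2 (eps_form L h om f \<epsilon>)) \<psi>) \<longlongrightarrow>
          form_current L D (ruled_surface L - (zero_divisor L \<union> infinity_divisor L))
            (hsc_form (calabi_form L h om f)) \<psi>
          + complex_of_real ((\<beta> - 1) / pi) * zero_divisor_current L D om \<psi>) (at_right 0)"
proof -
  obtain x0 where x0: "x0 > 0" "\<forall>b\<in>bcharts A L. \<forall>q\<in>cdom b. rb b q \<ge> x0 \<longrightarrow> \<psi> (pt L b q) = 0"
    using test_function_support[OF \<psi>] by blast
  define c where "c = complex_of_real ((\<beta> - 1) / pi)"
  have lim: "((\<lambda>\<epsilon>. (LINT q:{q \<in> piece D j \<times> UNIV. pt L (fst (D ! j)) q \<in> ruled_surface L - infinity_divisor L}|lborel.
        4 * (\<psi> (pt L (fst (D ! j)) q) * chern2 (eps_form L h om f \<epsilon>) (fst (D ! j)) q)))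
      \<longlongrightarrow> (LINT q:{q \<in> piece D j \<times> UNIV. pt L (fst (D ! j)) q \<in> ruled_surface L - (zero_divisor L \<union> infinity_divisor L)}|lborel.
        4 * (\<psi> (pt L (fst (D ! j)) q) * hsc_form (calabi_form L h om f) (fst (D ! j)) q))
      + c * (LINT \<zeta>:piece D j|lborel.
          2 * (\<psi> (pt L (fst (D ! j)) (\<zeta>, 0)) * complex_of_real (om (fst (fst (D ! j))) \<zeta>)))) (at_right 0)"
    if j: "j < length D" for j
  proof -
    define b where "b = fst (D ! j)"
    define B where "B = piece D j"
    note pf = piece_facts[OF D j, folded b_def B_def]
    have sub: "B \<times> UNIV \<subseteq> cdom b" using pf(3,4) by (auto simp: cdom_def)
    interpret C: calabi_local "UU b" "gg b" "HH b" by (rule local_data[OF pf(1)])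
    interpret T: calabi_test "UU b" "gg b" "HH b" f \<phi> m \<beta> B "bcoord b ` snd (D ! j)" x0 "\<lambda>q. \<psi> (pt L b q)"
    proof unfold_locales
      show "smooth_on C.\<Omega> (\<lambda>q. \<psi> (pt L b q))"
        using \<psi> pf(1) unfolding test_function_def by (simp add: cdom_\<Omega>)
    qed (use pf x0 in \<open>auto simp: cdom_\<Omega>\<close>)
    have N: "T.N \<delta> q = NN b \<delta> q" for \<delta> q unfolding T.N_def NN_def ..
    have s1: "{q \<in> B \<times> UNIV. pt L b q \<in> ruled_surface L - infinity_divisor L} = B \<times> UNIV"
      using pt_ruled by auto
    have s0: "{q \<in> B \<times> UNIV. pt L b q \<in> ruled_surface L - (zero_divisor L \<union> infinity_divisor L)} = {q \<in> B \<times> UNIV. snd q \<noteq> 0}"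
      using pt_ruled pt_zero_iff[OF pf(1)] sub by auto
    have m: "B \<times> UNIV \<in> sets (lborel :: c2 measure)"
      using pf(5) by (simp add: borel_prod[symmetric])
    have m0: "{q \<in> B \<times> UNIV. snd q \<noteq> 0} \<in> sets (lborel :: c2 measure)"
    proof -
      have "{q \<in> B \<times> UNIV. snd q \<noteq> 0} = B \<times> (- {0::complex})" by auto
      moreover have "B \<times> (- {0}) \<in> sets (borel :: c2 measure)"
        unfolding borel_prod[symmetric] using pf(5) by (intro pair_measureI) auto
      ultimately show ?thesis by (simp only: sets_lborel)
    qed
    have lim: "((\<lambda>\<epsilon>. (LINT q:B \<times> UNIV|lborel. 4 * (\<psi> (pt L b q) * NN b (\<epsilon>\<^sup>2) q))) \<longlongrightarrow>
        (LINT q:{q \<in> B \<times> UNIV. snd q \<noteq> 0}|lborel. 4 * (\<psi> (pt L b q) * NN b 0 q))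
        + c * (LINT z:B|lborel. 2 * (\<psi> (pt L b (z, 0)) * complex_of_real (gg b z)))) (at_right 0)"
      using filterlim_compose[OF T.weak_limit filterlim_square_at_right_0] unfolding N c_def .
    have ev: "eventually (\<lambda>\<epsilon>::real. \<epsilon> > 0) (at_right 0)" by (simp add: eventually_at_right_less)
    have eqe: "(LINT q:B \<times> UNIV|lborel. 4 * (\<psi> (pt L b q) * NN b (\<epsilon>\<^sup>2) q)) =
        (LINT q:B \<times> UNIV|lborel. 4 * (\<psi> (pt L b q) * chern2 (eps_form L h om f \<epsilon>) b q))"
      if "\<epsilon> > 0" for \<epsilon>
    proof (intro set_lebesgue_integral_cong m allI impI)
      fix q assume "q \<in> B \<times> (UNIV :: complex set)"
      then have "q \<in> cdom b" using sub by blast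
      then show "4 * (\<psi> (pt L b q) * NN b (\<epsilon>\<^sup>2) q) = 4 * (\<psi> (pt L b q) * chern2 (eps_form L h om f \<epsilon>) b q)"
        using that by (simp add: chern2_eps[OF pf(1)])
    qed
    have eq0: "(LINT q:{q \<in> B \<times> UNIV. snd q \<noteq> 0}|lborel. 4 * (\<psi> (pt L b q) * NN b 0 q)) =
        (LINT q:{q \<in> B \<times> UNIV. snd q \<noteq> 0}|lborel. 4 * (\<psi> (pt L b q) * hsc_form (calabi_form L h om f) b q))"
    proof (intro set_lebesgue_integral_cong m0 allI impI)
      fix q assume q: "q \<in> {q \<in> B \<times> (UNIV :: complex set). snd q \<noteq> 0}"
      then have "q \<in> cdom b" "snd q \<noteq> 0" using sub by blast+
      then show "4 * (\<psi> (pt L b q) * NN b 0 q) = 4 * (\<psi> (pt L b q) * hsc_form (calabi_form L h om f) b q)"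
        by (simp add: hsc_calabi[OF pf(1)])
    qed
    show ?thesis unfolding b_def[symmetric] B_def[symmetric] s1 s0 eq0[symmetric]
      by (rule Lim_transform_eventually[OF lim eventually_mono[OF ev]]) (rule eqe)
  qed
  have "((\<lambda>\<epsilon>. form_current L D (ruled_surface L - infinity_divisor L) (chern2 (eps_form L h om f \<epsilon>)) \<psi>) \<longlongrightarrow>
     (\<Sum>j<length D. (LINT q:{q \<in> piece D j \<times> UNIV. pt L (fst (D ! j)) q \<in> ruled_surface L - (zero_divisor L \<union> infinity_divisor L)}|lborel.
        4 * (\<psi> (pt L (fst (D ! j)) q) * hsc_form (calabi_form L h om f) (fst (D ! j)) q))
      + c * (LINT \<zeta>:piece D j|lborel.
          2 * (\<psi> (pt L (fst (D ! j)) (\<zeta>, 0)) * complex_of_real (om (fst (fst (D ! j))) \<zeta>))))) (at_right 0)"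
    unfolding form_current_def by (intro tendsto_sum lim) simp
  then show ?thesis unfolding sum.distrib sum_distrib_left[symmetric] c_def
    by (simp only: form_current_def zero_divisor_current_def base_integral_def)
qed

end

theorem mainTheorem3:
  fixes A :: "'a::t2_space chart set"
    and om :: "'a base_form"
    and L :: "('a, 'l) line_bundle"
    and h :: "'l \<Rightarrow> real"
    and f \<phi> :: "real \<Rightarrow> real"
    and m \<beta>_0 \<beta>_inf :: real
  assumes surface: "riemann_surface A" "compact (UNIV :: 'a set)" "has_genus TYPE('a) 2"
    and base_metric: "base_kahler A om"
    and ricci: "\<forall>\<kappa>\<in>A. \<forall>\<zeta>\<in>snd \<kappa> ` fst \<kappa>. ricci om \<kappa> \<zeta> = complex_of_real (- 2 * om \<kappa> \<zeta>)"
    and line_bundle: "holomorphic_line_bundle A L" "has_degree A L (- 1)"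
    and metric: "hermitian_metric A L h"
    and curvature: "\<forall>b\<in>bcharts A L. \<forall>\<zeta>\<in>bcoord b ` bdom b.
          curvature h b \<zeta> = complex_of_real (- om (fst b) \<zeta>)"
    and pos: "m > 0" "\<beta>_0 > 0" "\<beta>_inf > 0"
    and f_smooth: "smooth_on UNIV f"
    and f_convex: "strictly_convex f"
    and kahler_class: "(deriv f \<longlongrightarrow> 0) at_bot" "(deriv f \<longlongrightarrow> m) at_top"
    and kahler: "kahler_metric A L (ruled_surface L - (zero_divisor L \<union> infinity_divisor L))
          (calabi_form L h om f)"
    and profile: "\<forall>s. \<phi> (1 + deriv f s) = deriv (deriv f) s"
    and profile_smooth: "smooth_on_interval 1 (m + 1) \<phi>"
    and profile_pos: "\<forall>\<gamma>\<in>{1<..<m + 1}. \<phi> \<gamma> > 0"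
    and profile_ends: "\<phi> 1 = 0" "\<phi> (m + 1) = 0"
          "(\<phi> has_real_derivative \<beta>_0) (at 1 within {1..m + 1})"
          "(\<phi> has_real_derivative - \<beta>_inf) (at (m + 1) within {1..m + 1})"
  shows "(\<forall>\<epsilon>>0. kahler_metric A L (ruled_surface L - infinity_divisor L) (eps_form L h om f \<epsilon>)) \<and>
    (\<forall>b\<in>bcharts A L.
       smooth_convergence (coord_part L (ruled_surface L - (zero_divisor L \<union> infinity_divisor L)) b)
         (\<lambda>\<epsilon>. chern2 (eps_form L h om f \<epsilon>) b) (hsc_form (calabi_form L h om f) b) (at_right 0)) \<and>
    locally_integrable A L (ruled_surface L - (zero_divisor L \<union> infinity_divisor L))
      (hsc_form (calabi_form L h om f)) \<and>
    (\<forall>D \<psi>. decomposition A L D \<and> test_function A L \<psi> \<longrightarrow>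
       ((\<lambda>\<epsilon>. form_current L D (ruled_surface L - infinity_divisor L)
                (chern2 (eps_form L h om f \<epsilon>)) \<psi>) \<longlongrightarrow>
          form_current L D (ruled_surface L - (zero_divisor L \<union> infinity_divisor L))
            (hsc_form (calabi_form L h om f)) \<psi>
          + complex_of_real ((\<beta>_0 - 1) / pi) * zero_divisor_current L D om \<psi>) (at_right 0))"
proof -
  interpret calabi_setting A om L h f \<phi> m \<beta>_0
    by unfold_locales
       (use assms in \<open>auto simp: eventually_at_bot_linorder\<close>)
  show ?thesis
    using eps_kahler smooth_convergence_eps hsc_locally_integrable weak_convergence
    by (auto simp: coord_part_eqs locally_integrable_def)
qed

end
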